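(* Let $G=(G_t)_{t\ge 0}$ be a continuous centered Gaussian process with $G_0=0$ and continuous covariance function $R(t,s)=\mathbb{E}[G_tG_s]$ satisfying Hypothesis (A) of the context for some $H\in(0,1)$, and let $V_n$ be the renormalized quadratic variation of $G$ defined in the context. If $H\in(0,\frac34]$, then the sequence $(V_n)_{n\ge1}$ satisfies the almost sure central limit theorem: for any bounded and continuous function $\varphi:\mathbb{R}\to\mathbb{R}$, almost surely, $$\frac{1}{\log n}\sum_{k=1}^{n}\frac1k\,\varphi(V_k)\longrightarrow \mathbb{E}[\varphi(N)]\qquad\text{as } n\to\infty,$$ where $N\sim\mathcal N(0,1)$.
   Context: Quadratic variation: for $n\ge1$, $Z_n:=\sum_{k=0}^{n-1}\big[(G_{k+1}-G_k)^2-\mathbb{E}[(G_{k+1}-G_k)^2]\big]$, $\sigma_n^2:=\mathbb{E}[Z_n^2]$ with $\sigma_n>0$ (assumed nonzero so that the renormalization makes sense), and $V_n:=Z_n/\sigma_n$, so that $\mathbb{E}[V_n^2]=1$. $R^B(t,s)=\frac12\big(|s|^{2H}+|t|^{2H}-|t-s|^{2H}\big)$ is the covariance function of fractional Brownian motion with Hurst index $H$. Hypothesis (A) (for a given $H\in(0,1)$): there is a constant $C_H'\ge0$ such that for every $T>0$ ($H$ and $C'_H$ do not depend on $T$): (1) for any $s\ge0$, $R(0,s)=0$; (2) for any fixed $s\in(0,T)$, the function $t\mapsto R(t,s)$ is continuous on $[0,T]$ and differentiable on $(0,s)\cup(s,T)$, and $\frac{\partial}{\partial t}R(t,s)$ is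 absolutely integrable; (3) for any fixed $t\in(0,T)$, the difference $\frac{\partial R(t,s)}{\partial t}-\frac{\partial R^B(t,s)}{\partial t}$, as a function of $s$, is continuous on $[0,T]$ (at $s=t$, where the individual derivatives need not exist, the difference is understood through its continuous extension) and differentiable with respect to $s$ on $(0,T)$, and its partial derivative $\Psi(t,s)$ with respect to $s$ satisfies $|\Psi(t,s)|\le C_H'|ts|^{H-1}$. *)

theory Defs
  imports "HOL-Probability.Probability"
begin

text \<open>
  The normal law with mean \<open>m\<close> and standard deviation \<open>s \<ge> 0\<close>. The case \<open>s = 0\<close> (a point
  mass) is treated separately, since \<^const>\<open>normal_density\<close> is not a density there.
\<close>

definition normal_law :: "real \<Rightarrow> real \<Rightarrow> real measure" where
  "normal_law m s =
     (if s = 0 then return borel m else density lborel (\<lambda>x. ennreal (normal_density m s x)))"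

text \<open>
  Processes indexed by \<open>[0, \<infinity>)\<close> are functions on all of \<^typ>\<open>real\<close>; the values at negative
  times are never constrained.
\<close>

definition centered_gaussian_process :: "'a measure \<Rightarrow> (real \<Rightarrow> 'a \<Rightarrow> real) \<Rightarrow> bool" where
  "centered_gaussian_process M G \<longleftrightarrow>
     (\<forall>t\<ge>0. G t \<in> borel_measurable M \<and> integral\<^sup>L M (G t) = 0) \<and>
     (\<forall>I c. finite I \<and> I \<subseteq> {0..} \<longrightarrow>
        (\<exists>m s. s \<ge> 0 \<and> distr M borel (\<lambda>\<omega>. \<Sum>t\<in>I. c t * G t \<omega>) = normal_law m s))"

definition covariance_fun :: "'a measure \<Rightarrow> (real \<Rightarrow> 'a \<Rightarrow> real) \<Rightarrow> real \<Rightarrow> real \<Rightarrow> real" where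
  "covariance_fun M G t s = integral\<^sup>L M (\<lambda>\<omega>. G t \<omega> * G s \<omega>)"

definition fbm_covariance :: "real \<Rightarrow> real \<Rightarrow> real \<Rightarrow> real" where
  "fbm_covariance H t s =
     (\<bar>s\<bar> powr (2 * H) + \<bar>t\<bar> powr (2 * H) - \<bar>t - s\<bar> powr (2 * H)) / 2"

text \<open>
  The difference of the partial derivatives in the first variable, seen as a function of \<open>s\<close>.
  On the diagonal, where the individual derivatives need not exist, its value is the limit
  along \<open>s \<rightarrow> t\<close>, \<open>s \<noteq> t\<close>. If that limit does not exist, the value is unspecified, but then
  the continuity required in \<open>hypothesis_A\<close> fails whatever it is.
\<close>

definition partial_diff :: "(real \<Rightarrow> real \<Rightarrow> real) \<Rightarrow> real \<Rightarrow> real \<Rightarrow> real \<Rightarrow> real" where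
  "partial_diff R H t s =
     (let d = (\<lambda>u. deriv (\<lambda>r. R r u) t - deriv (\<lambda>r. fbm_covariance H r u) t)
      in if s = t then Lim (at t) d else d s)"

definition hypothesis_A :: "real \<Rightarrow> (real \<Rightarrow> real \<Rightarrow> real) \<Rightarrow> bool" where
  "hypothesis_A H R \<longleftrightarrow> (\<exists>C\<ge>0. \<forall>T>0.
     (\<forall>s\<ge>0. R 0 s = 0) \<and>
     (\<forall>s\<in>{0<..<T}.
        continuous_on {0..T} (\<lambda>t. R t s) \<and>
        (\<lambda>t. R t s) differentiable_on ({0<..<s} \<union> {s<..<T}) \<and>
        (\<lambda>t. deriv (\<lambda>r. R r s) t) absolutely_integrable_on ({0<..<s} \<union> {s<..<T})) \<and>
     (\<forall>t\<in>{0<..<T}.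
        continuous_on {0..T} (partial_diff R H t) \<and>
        partial_diff R H t differentiable_on {0<..<T} \<and>
        (\<forall>s\<in>{0<..<T}. \<bar>deriv (partial_diff R H t) s\<bar> \<le> C * \<bar>t * s\<bar> powr (H - 1))))"

definition quad_var :: "'a measure \<Rightarrow> (real \<Rightarrow> 'a \<Rightarrow> real) \<Rightarrow> nat \<Rightarrow> 'a \<Rightarrow> real" where
  "quad_var M G n \<omega> =
     (\<Sum>k<n. (G (real (k + 1)) \<omega> - G (real k) \<omega>)\<^sup>2
             - integral\<^sup>L M (\<lambda>\<omega>'. (G (real (k + 1)) \<omega>' - G (real k) \<omega>')\<^sup>2))"

definition quad_var_sd :: "'a measure \<Rightarrow> (real \<Rightarrow> 'a \<Rightarrow> real) \<Rightarrow> nat \<Rightarrow> real" where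
  "quad_var_sd M G n = sqrt (integral\<^sup>L M (\<lambda>\<omega>. (quad_var M G n \<omega>)\<^sup>2))"

definition renorm_quad_var :: "'a measure \<Rightarrow> (real \<Rightarrow> 'a \<Rightarrow> real) \<Rightarrow> nat \<Rightarrow> 'a \<Rightarrow> real" where
  "renorm_quad_var M G n \<omega> = quad_var M G n \<omega> / quad_var_sd M G n"

text \<open>
  The exceptional null set may depend on \<open>\<phi>\<close>, and \<open>V 0\<close> plays no role.
\<close>

definition satisfies_ASCLT :: "'a measure \<Rightarrow> (nat \<Rightarrow> 'a \<Rightarrow> real) \<Rightarrow> bool" where
  "satisfies_ASCLT M V \<longleftrightarrow>
     (\<forall>\<phi> :: real \<Rightarrow> real. continuous_on UNIV \<phi> \<and> bounded (range \<phi>) \<longrightarrow>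
        (AE \<omega> in M.
           (\<lambda>n. 1 / ln (real n) * (\<Sum>k=1..n. 1 / real k * \<phi> (V k \<omega>)))
             \<longlonglongrightarrow> integral\<^sup>L std_normal_distribution \<phi>))"

end

theory Submission
  imports Defs
begin

text \<open>
  Why the theorem holds. The increments \<open>X\<^sub>i = G (i + 1) - G i\<close> form a centered Gaussian sequence, and
  hypothesis (A) says that their covariance is that of fractional Gaussian noise up to an error
  of size \<open>(i + 1)\<^sup>H\<^sup>-\<^sup>1 (j + 1)\<^sup>H\<^sup>-\<^sup>1\<close> (\<open>increment_covariance_bound\<close>): the mixed second difference of
  \<open>R - R\<^sup>B\<close> over a unit square is controlled by integrating the bound on \<open>\<Psi>\<close> in each variable. For
  \<open>H \<le> 3/4\<close> this error is of rank-one type and negligible in Hilbert-Schmidt norm against the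
  noise itself, whose contribution to the variance of \<open>Z\<^sub>n\<close> is of order \<open>n\<close> for \<open>H < 3/4\<close> and of
  order \<open>n ln n\<close> for \<open>H = 3/4\<close>. Consequently the covariance matrix of \<open>X\<^sub>0, \<dots>, X\<^sub>n\<^sub>-\<^sub>1\<close>, divided by the standard
  deviation of \<open>Z\<^sub>n\<close>, has operator norm at most \<open>K / sqrt (ln (n + 1))\<close>, and the covariance of \<open>V\<^sub>k\<close> and
  \<open>V\<^sub>l\<close> is small when \<open>k\<close> is large and \<open>(k / l) ln l\<close> is small (\<open>quad_var_scale\<close>).

  These two bounds control the characteristic functions of \<open>V\<^sub>k\<close> and of \<open>V\<^sub>k - V\<^sub>l\<close>. Both variables have the form
  \<open>F = \<Sum>\<^sub>i w\<^sub>i (X\<^sub>i\<^sup>2 - E X\<^sub>i\<^sup>2)\<close>, and Gaussian integration by parts gives for \<open>\<phi> t = E exp (i t F)\<close> the equation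
  \<open>\<phi>' t = - t Var(F) \<phi> t - 2 t E [(\<Gamma> - E \<Gamma>) exp (i t F)]\<close>, where \<open>\<Gamma> = \<Sum>\<^sub>i\<^sub>j w\<^sub>i E[X\<^sub>i X\<^sub>j] w\<^sub>j X\<^sub>i X\<^sub>j\<close>. Hence
  the distance of \<open>\<phi>\<close> to the Gaussian characteristic function is at most \<open>2 t\<^sup>2\<close> times the standard
  deviation of \<open>\<Gamma>\<close>, and this deviation is bounded by the operator norm above (\<open>qf_char_normal\<close>,
  \<open>qf_diff_char_normal\<close>). This is the second-order (Malliavin-Stein) argument, reduced to finite sums of
  Gaussian variables; Wick's formula for four variables is the only identity for higher moments that it uses.

  The two bounds show that \<open>\<Delta>\<^sub>n t\<close>, the logarithmic average of \<open>exp (i t V\<^sub>k) - exp (- t\<^sup>2 / 2)\<close> over \<open>k \<le> n\<close>, has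
  second moment at most a constant times \<open>t\<^sup>2 / sqrt (ln n)\<close>. Along the sparse sequence \<open>n\<^sub>j = 2 ^ (j ^ 16)\<close> this is summable even
  after adding up a grid of values of \<open>t\<close> that becomes finer and longer with \<open>j\<close>, so almost surely the
  characteristic functions of the logarithmic empirical measures converge at every \<open>t\<close>, and Levy's
  continuity theorem yields weak convergence along \<open>n\<^sub>j\<close>. Since \<open>ln n\<^sub>j\<^sub>+\<^sub>1 / ln n\<^sub>j\<close> tends to 1, logarithmic
  averages of a bounded function change little between \<open>n\<^sub>j\<close> and \<open>n\<^sub>j\<^sub>+\<^sub>1\<close>, which gives the whole sequence.
\<close>

section \<open>Gaussian sequences and their characteristic functions\<close>

lemma has_vector_derivative_quadratic_bound:
  fixes f :: "real \<Rightarrow> 'b::real_normed_vector"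
  assumes "\<And>s. norm (f s - f s0 - (s - s0) *\<^sub>R v) \<le> K * (s - s0)\<^sup>2"
  shows "(f has_vector_derivative v) (at s0)"
  unfolding has_vector_derivative_def
proof (rule has_derivativeI_sandwich[of 1])
  show "bounded_linear (\<lambda>x. x *\<^sub>R v)" by (rule bounded_linear_scaleR_left)
  fix y assume "y \<noteq> s0" "dist y s0 < 1"
  have "norm ((f y - f s0) - (y - s0) *\<^sub>R v) / norm (y - s0) \<le> K * (y - s0)\<^sup>2 / norm (y - s0)"
    by (intro divide_right_mono assms) auto
  also have "\<dots> = K * \<bar>y - s0\<bar>" using \<open>y \<noteq> s0\<close>
    by (auto simp: power2_eq_square field_simps abs_mult_self_eq)
  finally show "norm ((f y - f s0) - (y - s0) *\<^sub>R v) / norm (y - s0) \<le> K * \<bar>y - s0\<bar>" .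
next
  have "((\<lambda>y. K * \<bar>y - s0\<bar>) \<longlongrightarrow> K * \<bar>s0 - s0\<bar>) (at s0)"
    by (intro tendsto_intros)
  then show "((\<lambda>y. K * \<bar>y - s0\<bar>) \<longlongrightarrow> 0) (at s0)" by simp
qed auto

lemma (in prob_space) integrable_bounded:
  fixes f :: "'a \<Rightarrow> 'b::{banach, second_countable_topology}"
  assumes "f \<in> borel_measurable M" "\<And>x. norm (f x) \<le> B"
  shows "integrable M f"
  using assms by (intro integrable_const_bound[where B=B]) auto

lemma integrable_mult_bounded_complex:
  fixes f :: "'a \<Rightarrow> real" and g :: "'a \<Rightarrow> complex"
  assumes "integrable M f" "g \<in> borel_measurable M" "\<And>x. norm (g x) \<le> B"
  shows "integrable M (\<lambda>x. f x * g x)"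
proof (rule Bochner_Integration.integrable_bound[where f="\<lambda>x. B * f x"])
  show "integrable M (\<lambda>x. B * f x)" using assms(1) by simp
  show "(\<lambda>x. f x * g x) \<in> borel_measurable M" using assms by measurable
  have "0 \<le> B" using assms(3)[of undefined] norm_ge_zero order_trans by blast
  then show "AE x in M. norm (f x * g x) \<le> norm (B * f x)"
    using mult_right_mono[OF assms(3) abs_ge_zero] by (auto simp: norm_mult abs_mult mult.commute)
qed

text \<open>
  Differentiation under the integral sign. The bound \<open>|exp (i x) - 1 - i x| \<le> x\<^sup>2 / 2\<close> gives a remainder
  that is quadratic in the increment of \<open>s\<close>, uniformly in \<open>\<omega>\<close> up to the integrable factor \<open>B\<^sup>2\<close>.
\<close>
lemma (in prob_space) has_vector_derivative_integral_iexp: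
  fixes A B :: "'a \<Rightarrow> real"
  assumes [measurable]: "A \<in> borel_measurable M" "B \<in> borel_measurable M"
    and B2: "integrable M (\<lambda>\<omega>. (B \<omega>)\<^sup>2)"
  shows "((\<lambda>s. \<integral>\<omega>. iexp (A \<omega> + s * B \<omega>) \<partial>M) has_vector_derivative
           (\<integral>\<omega>. \<i> * (B \<omega> * iexp (A \<omega> + s0 * B \<omega>)) \<partial>M)) (at s0)"
proof (rule has_vector_derivative_quadratic_bound[where K="(\<integral>\<omega>. (B \<omega>)\<^sup>2 \<partial>M)"])
  fix s
  have B1: "integrable M B" by (rule square_integrable_imp_integrable[OF _ B2]) simp
  have i1: "integrable M (\<lambda>\<omega>. iexp (A \<omega> + r * B \<omega>))" for r
    by (rule integrable_bounded[where B=1]) auto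
  have i2: "integrable M (\<lambda>\<omega>. complex_of_real (B \<omega>) * iexp (A \<omega> + s0 * B \<omega>))"
    by (rule integrable_mult_bounded_complex[where B=1, OF B1]) auto
  have "(\<integral>\<omega>. iexp (A \<omega> + s * B \<omega>) \<partial>M) - (\<integral>\<omega>. iexp (A \<omega> + s0 * B \<omega>) \<partial>M)
        - (s - s0) *\<^sub>R (\<integral>\<omega>. \<i> * (B \<omega> * iexp (A \<omega> + s0 * B \<omega>)) \<partial>M)
      = (\<integral>\<omega>. iexp (A \<omega> + s * B \<omega>) - iexp (A \<omega> + s0 * B \<omega>)
          - (s - s0) *\<^sub>R (\<i> * (B \<omega> * iexp (A \<omega> + s0 * B \<omega>))) \<partial>M)"
    using i1 i2 by (simp add: scaleR_conv_of_real)
  also have "norm \<dots> \<le> (\<integral>\<omega>. (B \<omega>)\<^sup>2 * (s - s0)\<^sup>2 \<partial>M)"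
  proof (rule order_trans[OF integral_norm_bound integral_mono])
    show "integrable M (\<lambda>\<omega>. norm (iexp (A \<omega> + s * B \<omega>) - iexp (A \<omega> + s0 * B \<omega>)
          - (s - s0) *\<^sub>R (\<i> * (B \<omega> * iexp (A \<omega> + s0 * B \<omega>)))))"
      using i1 i2 by (intro integrable_norm Bochner_Integration.integrable_diff integrable_scaleR_right integrable_mult_right)
    show "integrable M (\<lambda>\<omega>. (B \<omega>)\<^sup>2 * (s - s0)\<^sup>2)" using B2 by simp
    fix \<omega>
    let ?h = "(s - s0) * B \<omega>"
    have "iexp (A \<omega> + s * B \<omega>) = iexp (A \<omega> + s0 * B \<omega>) * iexp ?h"
      unfolding exp_add[symmetric] by (simp add: algebra_simps)
    then have "iexp (A \<omega> + s * B \<omega>) - iexp (A \<omega> + s0 * B \<omega>)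
          - (s - s0) *\<^sub>R (\<i> * (B \<omega> * iexp (A \<omega> + s0 * B \<omega>)))
        = iexp (A \<omega> + s0 * B \<omega>) * (iexp ?h - (1 + \<i> * ?h))"
      by (simp add: algebra_simps scaleR_conv_of_real)
    also have "norm \<dots> = norm (iexp ?h - (1 + \<i> * ?h))"
      by (simp only: norm_mult norm_exp_i_times)
    also have "\<dots> \<le> ?h\<^sup>2 / 2"
      using iexp_approx1[of ?h 1] by (simp add: numeral_2_eq_2 power2_eq_square)
    also have "\<dots> \<le> (B \<omega>)\<^sup>2 * (s - s0)\<^sup>2" by (simp add: power_mult_distrib mult.commute)
    finally show "norm (iexp (A \<omega> + s * B \<omega>) - iexp (A \<omega> + s0 * B \<omega>)
          - (s - s0) *\<^sub>R (\<i> * (B \<omega> * iexp (A \<omega> + s0 * B \<omega>)))) \<le> (B \<omega>)\<^sup>2 * (s - s0)\<^sup>2" .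
  qed
  also have "\<dots> = (\<integral>\<omega>. (B \<omega>)\<^sup>2 \<partial>M) * (s - s0)\<^sup>2" by simp
  finally show "norm ((\<integral>\<omega>. iexp (A \<omega> + s * B \<omega>) \<partial>M) - (\<integral>\<omega>. iexp (A \<omega> + s0 * B \<omega>) \<partial>M)
        - (s - s0) *\<^sub>R (\<integral>\<omega>. \<i> * (B \<omega> * iexp (A \<omega> + s0 * B \<omega>)) \<partial>M))
      \<le> (\<integral>\<omega>. (B \<omega>)\<^sup>2 \<partial>M) * (s - s0)\<^sup>2" .
qed

text \<open>
  The point mass (\<open>s = 0\<close>) is included, because linear combinations of a degenerate Gaussian
  vector may be constant.
\<close>
lemma normal_law_facts:
  assumes "prob_space M" and Y: "Y \<in> borel_measurable M" and s: "s \<ge> 0"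
    and d: "distr M borel Y = normal_law m s"
  shows "integrable M (\<lambda>\<omega>. Y \<omega> ^ k)"
    and "integral\<^sup>L M Y = m"
    and "m = 0 \<Longrightarrow> integral\<^sup>L M (\<lambda>\<omega>. iexp (Y \<omega>)) = exp (- of_real ((\<integral>\<omega>. (Y \<omega>)\<^sup>2 \<partial>M) / 2))"
proof -
  interpret prob_space M by fact
  have "integrable M (\<lambda>\<omega>. Y \<omega> ^ k) \<and> integral\<^sup>L M Y = m \<and>
     (m = 0 \<longrightarrow> integral\<^sup>L M (\<lambda>\<omega>. iexp (Y \<omega>)) = exp (- of_real ((\<integral>\<omega>. (Y \<omega>)\<^sup>2 \<partial>M) / 2)))"
  proof (cases "s = 0")
    case True
    have "AE x in distr M borel Y. x = m"
      unfolding d normal_law_def using True by (simp add: AE_return)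
    then have ae: "AE \<omega> in M. Y \<omega> = m" using Y by (subst (asm) AE_distr_iff) auto
    have "integrable M (\<lambda>\<omega>. Y \<omega> ^ k)"
      using ae Y by (subst integrable_cong_AE[where g="\<lambda>_. m ^ k"]) auto
    moreover have "integral\<^sup>L M Y = integral\<^sup>L M (\<lambda>_. m)"
      using ae Y by (intro integral_cong_AE) auto
    moreover have "(\<integral>\<omega>. (Y \<omega>)\<^sup>2 \<partial>M) = (\<integral>\<omega>. m\<^sup>2 \<partial>M)"
      using ae Y by (intro integral_cong_AE) auto
    moreover have "(\<integral>\<omega>. iexp (Y \<omega>) \<partial>M) = (\<integral>\<omega>. iexp m \<partial>M)"
      using ae Y by (intro integral_cong_AE) auto
    ultimately show ?thesis by (auto simp: prob_space)
  next
    case False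
    then have sp: "s > 0" using s by simp
    have D: "distributed M lborel Y (normal_density m s)"
      unfolding distributed_def using d Y False by (auto simp: normal_law_def cong: distr_cong)
    let ?Z = "\<lambda>\<omega>. (Y \<omega> - m) / s"
    have DZ: "distributed M lborel ?Z std_normal_density"
      using normal_standard_normal_convert[OF sp, of Y m] D by simp
    have dZ: "distr M borel ?Z = std_normal_distribution"
    proof -
      have "distr M lborel ?Z = std_normal_distribution" using DZ unfolding distributed_def by simp
      then show ?thesis by (metis distr_cong sets_lborel)
    qed
    have Zm: "?Z \<in> borel_measurable M" using Y by measurable
    have Zk: "integrable M (\<lambda>\<omega>. ?Z \<omega> ^ k)" for k
      using integrable_std_normal_distribution_moment[of k]
      unfolding dZ[symmetric] by (subst (asm) integrable_distr_eq) (use Zm in auto)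
    have Yeq: "Y \<omega> = m + s * ?Z \<omega>" for \<omega> using sp by simp
    have yk: "integrable M (\<lambda>\<omega>. Y \<omega> ^ k)" for k
    proof -
      have "integrable M (\<lambda>\<omega>. \<Sum>j\<le>k. of_nat (k choose j) * m ^ j * (s * ?Z \<omega>) ^ (k - j))"
        unfolding power_mult_distrib
        by (intro Bochner_Integration.integrable_sum integrable_mult_right Zk)
      then show ?thesis unfolding binomial_ring[symmetric] Yeq[symmetric] .
    qed
    have ey: "integral\<^sup>L M Y = m" using normal_distributed_expectation[OF sp D] .
    have "(\<integral>\<omega>. iexp (Y \<omega>) \<partial>M) = exp (- of_real ((\<integral>\<omega>. (Y \<omega>)\<^sup>2 \<partial>M) / 2))" if m0: "m = 0"
    proof -
      have "variance Y = s\<^sup>2" using normal_distributed_variance[OF sp D] .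
      then have v: "(\<integral>\<omega>. (Y \<omega>)\<^sup>2 \<partial>M) = s\<^sup>2" using ey m0 by simp
      have "(\<integral>\<omega>. iexp (Y \<omega>) \<partial>M) = (\<integral>\<omega>. iexp (s * ?Z \<omega>) \<partial>M)" using m0 sp by simp
      also have "\<dots> = char std_normal_distribution s"
        unfolding char_def dZ[symmetric] by (subst integral_distr) (use Zm in auto)
      finally show ?thesis unfolding char_std_normal_distribution v
        by (simp add: exp_of_real[symmetric])
    qed
    then show ?thesis using yk ey by blast
  qed
  then show "integrable M (\<lambda>\<omega>. Y \<omega> ^ k)"
    and "integral\<^sup>L M Y = m"
    and "m = 0 \<Longrightarrow> integral\<^sup>L M (\<lambda>\<omega>. iexp (Y \<omega>)) = exp (- of_real ((\<integral>\<omega>. (Y \<omega>)\<^sup>2 \<partial>M) / 2))"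
    by blast+
qed

text \<open>
  Joint Gaussianity is expressed through the laws of linear combinations. No independent standard
  normals representing the sequence are ever constructed: everything below is derived from the
  characteristic functions of these combinations.
\<close>
locale gaussian_seq = prob_space M for M :: "'a measure" +
  fixes X :: "nat \<Rightarrow> 'a \<Rightarrow> real"
  assumes X_measurable [measurable]: "\<And>i. X i \<in> borel_measurable M"
    and X_gauss: "\<And>n c. \<exists>m s. s \<ge> 0 \<and> distr M borel (\<lambda>\<omega>. \<Sum>i<n. c i * X i \<omega>) = normal_law m s"
    and X_centered: "\<And>i. expectation (X i) = 0"
begin

definition cv :: "nat \<Rightarrow> nat \<Rightarrow> real" where
  "cv i j = expectation (\<lambda>\<omega>. X i \<omega> * X j \<omega>)"

lemma cv_sym: "cv i j = cv j i"
  unfolding cv_def by (simp add: mult.commute)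

lemma lincomb_single: "i < n \<Longrightarrow> (\<Sum>j<n. (if j = i then 1 else 0) * X j \<omega>) = X i \<omega>"
  by (simp add: if_distrib[of "\<lambda>c. c * _"] cong: if_cong)

lemma integrable_X_power: "integrable M (\<lambda>\<omega>. X i \<omega> ^ k)"
proof -
  obtain m s where "s \<ge> 0" "distr M borel (\<lambda>\<omega>. \<Sum>j<Suc i. (if j = i then 1 else 0) * X j \<omega>) = normal_law m s"
    using X_gauss[of "\<lambda>j. if j = i then 1 else 0" "Suc i"] by blast
  then show ?thesis
    using normal_law_facts(1)[OF prob_space_axioms, of "\<lambda>\<omega>. \<Sum>j<Suc i. (if j = i then 1 else 0) * X j \<omega>" s m k]
    by (subst (asm) lincomb_single) (auto simp: lincomb_single)
qed

lemma integrable_X: "integrable M (X i)"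
  using integrable_X_power[of i 1] by simp

lemma integrable_abs_X4: "integrable M (\<lambda>\<omega>. \<bar>X i \<omega> * X j \<omega> * X k \<omega> * X l \<omega>\<bar>)"
proof (rule Bochner_Integration.integrable_bound)
  show "integrable M (\<lambda>\<omega>. X i \<omega> ^ 4 + X j \<omega> ^ 4 + X k \<omega> ^ 4 + X l \<omega> ^ 4)"
    by (intro Bochner_Integration.integrable_add integrable_X_power)
  show "AE \<omega> in M. norm \<bar>X i \<omega> * X j \<omega> * X k \<omega> * X l \<omega>\<bar>
      \<le> norm (X i \<omega> ^ 4 + X j \<omega> ^ 4 + X k \<omega> ^ 4 + X l \<omega> ^ 4)"
  proof (rule AE_I2)
    fix \<omega>
    have "\<bar>a * b * c * d\<bar> \<le> a^4 + b^4 + c^4 + d^4" for a b c d :: real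
    proof -
      have "\<bar>a * b * c * d\<bar> = \<bar>a * b\<bar> * \<bar>c * d\<bar>" by (simp add: abs_mult)
      also have "\<dots> \<le> (\<bar>a * b\<bar>\<^sup>2 + \<bar>c * d\<bar>\<^sup>2) / 2"
        using sum_squares_bound[of "\<bar>a * b\<bar>" "\<bar>c * d\<bar>"] by simp
      also have "\<dots> = (a\<^sup>2 * b\<^sup>2 + c\<^sup>2 * d\<^sup>2) / 2" by (simp add: power_mult_distrib)
      also have "\<dots> \<le> a^4 + b^4 + c^4 + d^4"
        using sum_squares_bound[of "a\<^sup>2" "b\<^sup>2"] sum_squares_bound[of "c\<^sup>2" "d\<^sup>2"]
          zero_le_power2[of "a\<^sup>2"] zero_le_power2[of "b\<^sup>2"] zero_le_power2[of "c\<^sup>2"] zero_le_power2[of "d\<^sup>2"]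
        by (simp add: power2_eq_square power4_eq_xxxx mult.assoc)
      finally show ?thesis .
    qed
    then show "norm \<bar>X i \<omega> * X j \<omega> * X k \<omega> * X l \<omega>\<bar> \<le> norm (X i \<omega> ^ 4 + X j \<omega> ^ 4 + X k \<omega> ^ 4 + X l \<omega> ^ 4)"
      by (auto intro: order_trans[OF _ abs_ge_self])
  qed
qed simp

lemma integrable_X4: "integrable M (\<lambda>\<omega>. X i \<omega> * X j \<omega> * X k \<omega> * X l \<omega>)"
  using integrable_abs_X4[of i j k l] by (subst (asm) integrable_abs_iff) simp_all

lemma integrable_XX: "integrable M (\<lambda>\<omega>. X i \<omega> * X j \<omega>)"
proof (rule Bochner_Integration.integrable_bound)
  show "integrable M (\<lambda>\<omega>. X i \<omega> ^ 2 + X j \<omega> ^ 2)"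
    by (intro Bochner_Integration.integrable_add integrable_X_power)
  show "AE \<omega> in M. norm (X i \<omega> * X j \<omega>) \<le> norm (X i \<omega> ^ 2 + X j \<omega> ^ 2)"
  proof (rule AE_I2)
    fix \<omega> show "norm (X i \<omega> * X j \<omega>) \<le> norm (X i \<omega> ^ 2 + X j \<omega> ^ 2)"
      using sum_squares_bound[of "\<bar>X i \<omega>\<bar>" "\<bar>X j \<omega>\<bar>"]
        mult_nonneg_nonneg[OF abs_ge_zero[of "X i \<omega>"] abs_ge_zero[of "X j \<omega>"]]
      unfolding real_norm_def abs_mult power2_abs by linarith
  qed
qed simp

lemma square_lincomb:
  "(\<Sum>i<n. c i * X i \<omega>)\<^sup>2 = (\<Sum>i<n. \<Sum>j<n. c i * c j * (X i \<omega> * X j \<omega>))"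
  by (simp add: power2_eq_square sum_product algebra_simps)

lemma integrable_square_lincomb: "integrable M (\<lambda>\<omega>. (\<Sum>i<n. c i * X i \<omega>)\<^sup>2)"
  unfolding square_lincomb by (intro Bochner_Integration.integrable_sum integrable_mult_right integrable_XX)

lemma expectation_square_lincomb:
  "expectation (\<lambda>\<omega>. (\<Sum>i<n. c i * X i \<omega>)\<^sup>2) = (\<Sum>i<n. \<Sum>j<n. c i * c j * cv i j)"
  unfolding square_lincomb cv_def
  using integrable_XX by (simp add: Bochner_Integration.integral_sum Bochner_Integration.integrable_sum)

lemma char_lincomb:
  "expectation (\<lambda>\<omega>. iexp (\<Sum>i<n. c i * X i \<omega>)) = exp (- of_real ((\<Sum>i<n. \<Sum>j<n. c i * c j * cv i j) / 2))"
proof -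
  let ?Y = "\<lambda>\<omega>. \<Sum>i<n. c i * X i \<omega>"
  obtain m s where ms: "s \<ge> 0" "distr M borel ?Y = normal_law m s"
    using X_gauss[of c n] by blast
  have "expectation ?Y = 0" using integrable_X X_centered by (simp add: Bochner_Integration.integral_sum)
  moreover have "expectation ?Y = m" by (rule normal_law_facts(2)[OF prob_space_axioms _ ms]) simp
  ultimately have "m = 0" by simp
  from normal_law_facts(3)[OF prob_space_axioms _ ms this] show ?thesis
    by (simp add: expectation_square_lincomb)
qed

text \<open>
  Gaussian integration by parts against \<open>exp (i Y)\<close>, \<open>Y\<close> a linear combination: differentiate
  \<open>E exp (i (Y + s X\<^sub>i)) = exp (- Var (Y + s X\<^sub>i) / 2)\<close> at \<open>s = 0\<close>.
\<close>
lemma ibp_iexp: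
  assumes i: "i < n"
  shows "expectation (\<lambda>\<omega>. X i \<omega> * iexp (\<Sum>j<n. c j * X j \<omega>))
     = \<i> * of_real (\<Sum>j<n. cv i j * c j) * expectation (\<lambda>\<omega>. iexp (\<Sum>j<n. c j * X j \<omega>))"
proof -
  let ?Y = "\<lambda>\<omega>. \<Sum>j<n. c j * X j \<omega>"
  let ?k = "\<Sum>j<n. cv i j * c j"
  let ?v = "\<Sum>k<n. \<Sum>j<n. c k * c j * cv k j"
  have "expectation (\<lambda>\<omega>. iexp (?Y \<omega> + s * X i \<omega>)) = exp (- of_real ((?v + 2 * s * ?k + s\<^sup>2 * cv i i) / 2))" for s
  proof -
    let ?d = "\<lambda>j. c j + s * (if j = i then 1 else 0)"
    have Yd: "?Y \<omega> + s * X i \<omega> = (\<Sum>j<n. ?d j * X j \<omega>)" for \<omega>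
      using lincomb_single[OF i, of \<omega>] by (simp add: distrib_right sum.distrib sum_distrib_left[symmetric] mult.assoc)
    then have "expectation (\<lambda>\<omega>. iexp (?Y \<omega> + s * X i \<omega>)) = exp (- of_real ((\<Sum>k<n. \<Sum>j<n. ?d k * ?d j * cv k j) / 2))"
      using char_lincomb[where n=n and c="?d"] by simp
    also have "(\<Sum>k<n. \<Sum>j<n. ?d k * ?d j * cv k j) = expectation (\<lambda>\<omega>. (?Y \<omega> + s * X i \<omega>)\<^sup>2)"
      unfolding Yd by (rule expectation_square_lincomb[symmetric])
    also have "\<dots> = expectation (\<lambda>\<omega>. (?Y \<omega>)\<^sup>2 + 2 * s * (\<Sum>j<n. c j * (X i \<omega> * X j \<omega>)) + s\<^sup>2 * (X i \<omega> * X i \<omega>))"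
      by (simp add: power2_sum power_mult_distrib sum_distrib_left sum_distrib_right algebra_simps power2_eq_square[of "X i _"])
    also have "\<dots> = ?v + 2 * s * ?k + s\<^sup>2 * cv i i"
      using integrable_square_lincomb integrable_XX
      by (simp add: expectation_square_lincomb cv_def Bochner_Integration.integral_sum mult.commute)
    finally show ?thesis .
  qed
  then have eq: "(\<lambda>s. expectation (\<lambda>\<omega>. iexp (?Y \<omega> + s * X i \<omega>)))
      = (\<lambda>s. exp (- of_real ((?v + 2 * s * ?k + s\<^sup>2 * cv i i) / 2)))" by auto
  have "((\<lambda>s. expectation (\<lambda>\<omega>. iexp (?Y \<omega> + s * X i \<omega>))) has_vector_derivative
           expectation (\<lambda>\<omega>. \<i> * (X i \<omega> * iexp (?Y \<omega> + 0 * X i \<omega>)))) (at 0)"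
    by (intro has_vector_derivative_integral_iexp) (auto intro: integrable_X_power)
  moreover have "((\<lambda>s. complex_of_real (exp (- ((?v + 2 * s * ?k + s\<^sup>2 * cv i i) / 2)))) has_vector_derivative
       complex_of_real (- ?k * exp (- (?v / 2)))) (at 0)"
    by (intro has_vector_derivative_of_real)
       (auto intro!: derivative_eq_intros simp: has_real_derivative_iff_has_vector_derivative[symmetric])
  then have "((\<lambda>s. exp (- of_real ((?v + 2 * s * ?k + s\<^sup>2 * cv i i) / 2)) :: complex) has_vector_derivative
       complex_of_real (- ?k * exp (- (?v / 2)))) (at 0)"
    by (simp only: of_real_exp[symmetric] of_real_minus exp_of_real[symmetric])
  ultimately have "expectation (\<lambda>\<omega>. \<i> * (X i \<omega> * iexp (?Y \<omega> + 0 * X i \<omega>))) = complex_of_real (- ?k * exp (- (?v / 2)))"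
    unfolding eq by (rule vector_derivative_unique_at)
  then have "\<i> * expectation (\<lambda>\<omega>. X i \<omega> * iexp (?Y \<omega>)) = - of_real ?k * exp (- of_real (?v / 2))"
    by (simp only: integral_mult_right_zero of_real_mult of_real_minus exp_of_real[symmetric] mult_zero_left add_0_right)
  then have "\<i> * expectation (\<lambda>\<omega>. X i \<omega> * iexp (?Y \<omega>)) = - of_real ?k * expectation (\<lambda>\<omega>. iexp (?Y \<omega>))"
    unfolding char_lincomb .
  then have "\<i> * (\<i> * expectation (\<lambda>\<omega>. X i \<omega> * iexp (?Y \<omega>))) = \<i> * (- of_real ?k * expectation (\<lambda>\<omega>. iexp (?Y \<omega>)))"
    by simp
  then show ?thesis by simp
qed

end

section \<open>Gaussian integration by parts\<close>

text \<open>
  Trigonometric polynomials in the coordinates \<open>x 0, \<dots>, x (n - 1)\<close>, paired with their gradients. Integration by parts is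
  linear, so it passes from exponentials to this class, and the class is closed under products;
  nonlinear functions of the \<open>X\<^sub>i\<close> are then reached by limits.
\<close>
inductive trig_poly ::
  "nat \<Rightarrow> ((nat \<Rightarrow> real) \<Rightarrow> complex) \<Rightarrow> (nat \<Rightarrow> (nat \<Rightarrow> real) \<Rightarrow> complex) \<Rightarrow> bool" for n where
  exp: "trig_poly n (\<lambda>x. z * iexp (\<Sum>j<n. a j * x j)) (\<lambda>k x. z * (\<i> * a k) * iexp (\<Sum>j<n. a j * x j))"
| add: "trig_poly n f f' \<Longrightarrow> trig_poly n g g' \<Longrightarrow> trig_poly n (\<lambda>x. f x + g x) (\<lambda>k x. f' k x + g' k x)"

lemma trig_poly_const: "trig_poly n (\<lambda>x. z) (\<lambda>k x. 0)"
  using trig_poly.exp[of n z "\<lambda>_. 0"] by simp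

lemma trig_poly_mult:
  assumes "trig_poly n f f'" "trig_poly n g g'"
  shows "trig_poly n (\<lambda>x. f x * g x) (\<lambda>k x. f' k x * g x + f x * g' k x)"
  using assms(1)
proof induction
  case (exp z a)
  from assms(2) show ?case
  proof induction
    case (exp w b)
    have e: "iexp (\<Sum>j<n. (a j + b j) * x j) = iexp (\<Sum>j<n. a j * x j) * iexp (\<Sum>j<n. b j * x j)" for x
      unfolding exp_add[symmetric] by (simp add: distrib_right sum.distrib distrib_left)
    show ?case
      using trig_poly.exp[of n "z * w" "\<lambda>j. a j + b j"] unfolding e
      by (simp add: algebra_simps)
  next
    case (add f f' g g')
    from trig_poly.add[OF add.IH] show ?case by (simp add: algebra_simps)
  qed
next
  case (add f f' g g')
  from trig_poly.add[OF add.IH] show ?case by (simp add: algebra_simps)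
qed

lemma trig_poly_cmult:
  assumes "trig_poly n f f'"
  shows "trig_poly n (\<lambda>x. z * f x) (\<lambda>k x. z * f' k x)"
  using trig_poly_mult[OF trig_poly_const[of n z] assms] by simp

lemma trig_poly_sum:
  assumes "finite I" "\<And>i. i \<in> I \<Longrightarrow> trig_poly n (f i) (f' i)"
  shows "trig_poly n (\<lambda>x. \<Sum>i\<in>I. f i x) (\<lambda>k x. \<Sum>i\<in>I. f' i k x)"
  using assms
proof (induction I rule: finite_induct)
  case empty then show ?case using trig_poly_const[of n 0] by simp
next
  case (insert i I)
  then show ?case using trig_poly.add[of n "f i" "f' i" "\<lambda>x. \<Sum>i\<in>I. f i x" "\<lambda>k x. \<Sum>i\<in>I. f' i k x"] by simp
qed

lemma trig_poly_power:
  assumes "trig_poly n f f'"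
  shows "trig_poly n (\<lambda>x. f x ^ p) (\<lambda>k x. of_nat p * f x ^ (p - 1) * f' k x)"
proof (induction p)
  case 0 then show ?case using trig_poly_const[of n 1] by simp
next
  case (Suc p)
  have "f' k x * f x ^ p + f x * (of_nat p * f x ^ (p - 1) * f' k x) = of_nat (Suc p) * f x ^ p * f' k x" for k x
    by (cases p) (simp_all add: algebra_simps)
  then show ?case using trig_poly_mult[OF assms Suc.IH] by simp
qed

text \<open>
  The gradient of a partial sum of the exponential series is the preceding partial sum times the
  gradient of the exponent; hence the shift from \<open>Suc K\<close> to \<open>K\<close>.
\<close>
lemma trig_poly_exp_series:
  assumes "trig_poly n g g'"
  shows "trig_poly n (\<lambda>x. \<Sum>p<Suc K. g x ^ p / fact p) (\<lambda>k x. (\<Sum>p<K. g x ^ p / fact p) * g' k x)"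
proof -
  have "trig_poly n (\<lambda>x. \<Sum>p<Suc K. (1 / fact p) * g x ^ p)
      (\<lambda>k x. \<Sum>p<Suc K. (1 / fact p) * (of_nat p * g x ^ (p - 1) * g' k x))"
    by (intro trig_poly_sum trig_poly_cmult trig_poly_power assms) auto
  moreover have "(\<Sum>p<Suc K. (1 / fact p) * (of_nat p * z ^ (p - 1) * w)) = (\<Sum>p<K. z ^ p / fact p) * w" for z w :: complex
    unfolding sum.lessThan_Suc_shift by (simp add: sum_distrib_right divide_simps del: of_nat_Suc)
  ultimately show ?thesis by simp
qed

text \<open>
  Bounded trigonometric substitutes for the coordinate \<open>x\<close> and for its derivative \<open>1\<close>, to which they converge
  as \<open>m\<close> grows. The factor \<open>Suc m\<close> avoids a division by zero.
\<close>
definition tsin :: "nat \<Rightarrow> real \<Rightarrow> real" where "tsin m x = real (Suc m) * sin (x / real (Suc m))"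
definition tcos :: "nat \<Rightarrow> real \<Rightarrow> real" where "tcos m x = cos (x / real (Suc m))"

lemma trig_poly_tsin:
  assumes "j < n"
  shows "trig_poly n (\<lambda>x. of_real (tsin m (x j))) (\<lambda>k x. if k = j then of_real (tcos m (x j)) else 0)"
proof -
  let ?M = "real (Suc m)"
  let ?a = "\<lambda>k. if k = j then 1 / ?M else 0"
  have e: "(\<Sum>k<n. ?a k * x k) = x j / ?M" for x :: "nat \<Rightarrow> real"
    using assms by (simp add: if_distrib[of "\<lambda>c. c * _"] cong: if_cong)
  have e': "(\<Sum>k<n. - ?a k * x k) = - (x j / ?M)" for x :: "nat \<Rightarrow> real"
    using e[of x] by (simp only: mult_minus_left sum_negf)
  have "trig_poly n (\<lambda>x. (?M / (2 * \<i>)) * iexp (\<Sum>k<n. ?a k * x k) + (- ?M / (2 * \<i>)) * iexp (\<Sum>k<n. - ?a k * x k))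
     (\<lambda>k x. (?M / (2 * \<i>)) * (\<i> * ?a k) * iexp (\<Sum>k<n. ?a k * x k)
        + (- ?M / (2 * \<i>)) * (\<i> * of_real (- ?a k)) * iexp (\<Sum>k<n. - ?a k * x k))"
    by (intro trig_poly.add trig_poly.exp)
  moreover have "(?M / (2 * \<i>)) * iexp (\<Sum>k<n. ?a k * x k) + (- ?M / (2 * \<i>)) * iexp (\<Sum>k<n. - ?a k * x k)
     = of_real (tsin m (x j))" for x
    unfolding e e' tsin_def of_real_mult sin_of_real[symmetric] sin_exp_eq
    by (simp add: field_simps del: of_nat_Suc)
  moreover have "(?M / (2 * \<i>)) * (\<i> * ?a k) * iexp (\<Sum>k<n. ?a k * x k)
        + (- ?M / (2 * \<i>)) * (\<i> * of_real (- ?a k)) * iexp (\<Sum>k<n. - ?a k * x k)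
     = (if k = j then of_real (tcos m (x j)) else 0)" for k x
  proof (cases "k = j")
    case True
    show ?thesis unfolding e e' tcos_def cos_of_real[symmetric] cos_exp_eq using True
      by (simp add: field_simps del: of_nat_Suc)
  qed simp
  ultimately show ?thesis by simp
qed

lemma abs_tsin_le: "\<bar>tsin m x\<bar> \<le> \<bar>x\<bar>"
proof -
  have "\<bar>tsin m x\<bar> \<le> real (Suc m) * \<bar>x / real (Suc m)\<bar>"
    unfolding tsin_def abs_mult by (intro mult_mono abs_sin_x_le_abs_x) auto
  then show ?thesis by (simp del: of_nat_Suc)
qed

lemma abs_tsin_le': "\<bar>tsin m x\<bar> \<le> real (Suc m)"
  unfolding tsin_def abs_mult using mult_left_mono[OF abs_sin_le_one, of "real (Suc m)"] by simp

lemma abs_tcos_le: "\<bar>tcos m x\<bar> \<le> 1" by (simp add: tcos_def)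

lemma tcos_tendsto: "(\<lambda>m. tcos m x) \<longlonglongrightarrow> 1"
proof -
  have "(\<lambda>m. cos (x / real (Suc m))) \<longlonglongrightarrow> cos 0"
    by (intro tendsto_cos LIMSEQ_Suc[OF lim_const_over_n])
  then show ?thesis by (simp add: tcos_def)
qed

lemma tsin_tendsto: "(\<lambda>m. tsin m x) \<longlonglongrightarrow> x"
proof -
  have "((\<lambda>h. sin (0 + h * x) ) has_real_derivative x) (at 0)"
    by (auto intro!: derivative_eq_intros)
  then have "((\<lambda>h. sin (h * x) / h) \<longlongrightarrow> x) (at 0)" by (simp add: DERIV_def)
  moreover have "filterlim (\<lambda>m. 1 / real (Suc m)) (at 0) sequentially"
    unfolding filterlim_at using LIMSEQ_Suc[OF lim_const_over_n[of 1]] by (auto simp del: of_nat_Suc)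
  ultimately have "(\<lambda>m. sin (1 / real (Suc m) * x) / (1 / real (Suc m))) \<longlonglongrightarrow> x"
    by (rule filterlim_compose)
  then show ?thesis by (simp add: tsin_def mult.commute del: of_nat_Suc)
qed

lemma tsin_measurable [measurable]: "tsin m \<in> borel_measurable borel"
  unfolding tsin_def by measurable
lemma tcos_measurable [measurable]: "tcos m \<in> borel_measurable borel"
  unfolding tcos_def by measurable

context gaussian_seq
begin

abbreviation Xv :: "'a \<Rightarrow> nat \<Rightarrow> real" where "Xv \<omega> \<equiv> \<lambda>j. X j \<omega>"

lemma trig_poly_bounded:
  assumes "trig_poly n f f'"
  shows "(\<lambda>\<omega>. f (Xv \<omega>)) \<in> borel_measurable M \<and> (\<forall>k. (\<lambda>\<omega>. f' k (Xv \<omega>)) \<in> borel_measurable M) \<and>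
     (\<exists>B. \<forall>x. norm (f x) \<le> B) \<and> (\<forall>k. \<exists>B. \<forall>x. norm (f' k x) \<le> B)"
  using assms
proof induction
  case (exp z a)
  have "norm (z * iexp (\<Sum>j<n. a j * x j)) \<le> norm z" "norm (z * (\<i> * of_real (a k)) * iexp (\<Sum>j<n. a j * x j)) \<le> norm (z * (\<i> * of_real (a k)))" for k x
    by (simp_all only: norm_mult norm_exp_i_times mult_1_right order_refl)
  then show ?case by (intro conjI allI; (measurable; fail)?; blast)
next
  case (add f f' g g')
  then obtain B C where BC: "\<And>x. norm (f x) \<le> B" "\<And>x. norm (g x) \<le> C" by blast
  have [measurable]: "(\<lambda>\<omega>. f (Xv \<omega>)) \<in> borel_measurable M" "(\<lambda>\<omega>. g (Xv \<omega>)) \<in> borel_measurable M"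
    "\<And>k. (\<lambda>\<omega>. f' k (Xv \<omega>)) \<in> borel_measurable M" "\<And>k. (\<lambda>\<omega>. g' k (Xv \<omega>)) \<in> borel_measurable M"
    using add.IH by blast+
  have "\<exists>B. \<forall>x. norm (f' k x + g' k x) \<le> B" for k
  proof -
    from add.IH obtain B' C' where "\<And>x. norm (f' k x) \<le> B'" "\<And>x. norm (g' k x) \<le> C'" by meson
    then have "norm (f' k x + g' k x) \<le> B' + C'" for x by (rule norm_triangle_mono)
    then show ?thesis by blast
  qed
  moreover have "norm (f x + g x) \<le> B + C" for x using BC by (rule norm_triangle_mono)
  ultimately show ?case by (intro conjI allI; (measurable; fail)?; blast)
qed

lemma ibp_trig_poly:
  fixes f :: "(nat \<Rightarrow> real) \<Rightarrow> complex" and f' :: "nat \<Rightarrow> (nat \<Rightarrow> real) \<Rightarrow> complex"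
  assumes "trig_poly n f f'" and i: "i < n"
  shows "expectation (\<lambda>\<omega>. X i \<omega> * f (Xv \<omega>)) = (\<Sum>j<n. cv i j * expectation (\<lambda>\<omega>. f' j (Xv \<omega>)))"
  using assms(1)
proof (induction rule: trig_poly.induct)
  case (exp z a)
  have "expectation (\<lambda>\<omega>. X i \<omega> * (z * iexp (\<Sum>j<n. a j * X j \<omega>)))
     = z * expectation (\<lambda>\<omega>. X i \<omega> * iexp (\<Sum>j<n. a j * X j \<omega>))"
    by (subst integral_mult_right_zero[symmetric]) (simp add: algebra_simps)
  also have "\<dots> = (\<Sum>j<n. cv i j * (z * (\<i> * a j) * expectation (\<lambda>\<omega>. iexp (\<Sum>j<n. a j * X j \<omega>))))"
    unfolding ibp_iexp[OF i] by (simp add: sum_distrib_left sum_distrib_right algebra_simps)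
  finally show ?case by (simp only: integral_mult_right_zero)
next
  case (add f f' g g')
  have int: "integrable M (\<lambda>\<omega>. f (Xv \<omega>))" "integrable M (\<lambda>\<omega>. X i \<omega> * f (Xv \<omega>))" "\<And>k. integrable M (\<lambda>\<omega>. f' k (Xv \<omega>))"
    if tp: "trig_poly n f f'" for f :: "(nat \<Rightarrow> real) \<Rightarrow> complex" and f' :: "nat \<Rightarrow> (nat \<Rightarrow> real) \<Rightarrow> complex"
  proof -
    obtain B where B: "\<And>x. norm (f x) \<le> B" using trig_poly_bounded[OF tp] by blast
    have [measurable]: "(\<lambda>\<omega>. f (Xv \<omega>)) \<in> borel_measurable M" "\<And>k. (\<lambda>\<omega>. f' k (Xv \<omega>)) \<in> borel_measurable M"
      using trig_poly_bounded[OF tp] by blast+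
    show "integrable M (\<lambda>\<omega>. f (Xv \<omega>))" by (rule integrable_bounded[where B=B]) (auto intro: B)
    show "integrable M (\<lambda>\<omega>. X i \<omega> * f (Xv \<omega>))"
      by (rule integrable_mult_bounded_complex[OF integrable_X, where B=B]) (auto intro: B)
    fix k
    obtain C where C: "\<And>x. norm (f' k x) \<le> C" using trig_poly_bounded[OF tp] by blast
    show "integrable M (\<lambda>\<omega>. f' k (Xv \<omega>))" by (rule integrable_bounded[where B=C]) (auto intro: C)
  qed
  show ?case
    using int[OF add.hyps(1)] int[OF add.hyps(2)] add.IH
    by (simp add: distrib_left sum.distrib)
qed

end

lemma norm_exp_partial_sum_le: "norm (\<Sum>p<K. z ^ p / fact p :: complex) \<le> exp (norm z)"
proof -
  have "norm (\<Sum>p<K. z ^ p / fact p) \<le> (\<Sum>p<K. norm z ^ p /\<^sub>R fact p)"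
    by (rule order_trans[OF norm_sum]) (simp add: norm_divide norm_mult norm_inverse norm_power divide_inverse mult.commute)
  also have "\<dots> \<le> exp (norm z)"
    unfolding exp_def by (rule sum_le_suminf[OF summable_exp_generic]) auto
  finally show ?thesis .
qed

lemma exp_partial_sum_tendsto: "(\<lambda>K. \<Sum>p<K. z ^ p / fact p :: complex) \<longlonglongrightarrow> exp z"
  using exp_converges[of z] by (simp add: sums_def scaleR_conv_of_real divide_inverse mult.commute)

context gaussian_seq
begin

text \<open>
  Integration by parts for a random variable \<open>f\<close> with a prescribed gradient \<open>f'\<close>. Stating it for
  functions on the probability space makes it stable under dominated limits.
\<close>
definition ibp :: "nat \<Rightarrow> nat \<Rightarrow> ('a \<Rightarrow> complex) \<Rightarrow> (nat \<Rightarrow> 'a \<Rightarrow> complex) \<Rightarrow> bool" where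
  "ibp n i f f' \<longleftrightarrow>
     expectation (\<lambda>\<omega>. complex_of_real (X i \<omega>) * f \<omega>) = (\<Sum>j<n. complex_of_real (cv i j) * expectation (f' j))"

lemma ibp_limit:
  fixes f :: "nat \<Rightarrow> 'a \<Rightarrow> complex" and f' :: "nat \<Rightarrow> nat \<Rightarrow> 'a \<Rightarrow> complex"
    and g :: "'a \<Rightarrow> complex" and g' :: "nat \<Rightarrow> 'a \<Rightarrow> complex"
  assumes ibp: "\<And>m. ibp n i (f m) (f' m)"
    and [measurable]: "\<And>m. f m \<in> borel_measurable M" "\<And>m j. j < n \<Longrightarrow> f' m j \<in> borel_measurable M"
      "g \<in> borel_measurable M" "\<And>j. j < n \<Longrightarrow> g' j \<in> borel_measurable M"
    and lim: "\<And>\<omega>. (\<lambda>m. f m \<omega>) \<longlonglongrightarrow> g \<omega>" "\<And>\<omega> j. j < n \<Longrightarrow> (\<lambda>m. f' m j \<omega>) \<longlonglongrightarrow> g' j \<omega>"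
    and W: "\<And>m \<omega>. norm (f m \<omega>) \<le> W \<omega>" "integrable M (\<lambda>\<omega>. \<bar>X i \<omega>\<bar> * W \<omega>)"
    and W': "\<And>m \<omega> j. j < n \<Longrightarrow> norm (f' m j \<omega>) \<le> W' j \<omega>" "\<And>j. j < n \<Longrightarrow> integrable M (W' j)"
  shows "ibp n i g g'"
proof -
  have "(\<lambda>m. expectation (\<lambda>\<omega>. X i \<omega> * f m \<omega>)) \<longlonglongrightarrow> expectation (\<lambda>\<omega>. X i \<omega> * g \<omega>)"
  proof (rule integral_dominated_convergence[where w="\<lambda>\<omega>. \<bar>X i \<omega>\<bar> * W \<omega>"])
    show "AE \<omega> in M. (\<lambda>m. X i \<omega> * f m \<omega>) \<longlonglongrightarrow> X i \<omega> * g \<omega>"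
      by (intro AE_I2 tendsto_intros lim)
    show "AE \<omega> in M. norm (X i \<omega> * f m \<omega>) \<le> \<bar>X i \<omega>\<bar> * W \<omega>" for m
      by (intro AE_I2) (simp add: norm_mult mult_left_mono W(1))
  qed (use W(2) in \<open>auto\<close>)
  moreover have "(\<lambda>m. \<Sum>j<n. cv i j * expectation (f' m j)) \<longlonglongrightarrow> (\<Sum>j<n. cv i j * expectation (g' j))"
  proof (intro tendsto_intros)
    fix j assume "j \<in> {..<n}"
    then have j: "j < n" by simp
    show "(\<lambda>m. expectation (f' m j)) \<longlonglongrightarrow> expectation (g' j)"
      by (rule integral_dominated_convergence[where w="W' j"])
         (use j lim W' in \<open>auto\<close>)
  qed
  ultimately show ?thesis
    using ibp unfolding ibp_def by (simp only:) (rule LIMSEQ_unique)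
qed

lemma ibp_trig_poly': "trig_poly n f f' \<Longrightarrow> i < n \<Longrightarrow> ibp n i (\<lambda>\<omega>. f (Xv \<omega>)) (\<lambda>j \<omega>. f' j (Xv \<omega>))"
  unfolding ibp_def by (rule ibp_trig_poly)

text \<open>
  Wick's formula. Integrate \<open>X\<^sub>i\<close> by parts against the product of the other three factors, each
  replaced by its bounded substitute, and let the truncation tend to infinity.
\<close>
lemma wick4:
  "expectation (\<lambda>\<omega>. X i \<omega> * X a \<omega> * X b \<omega> * X c \<omega>) = cv i a * cv b c + cv i b * cv a c + cv i c * cv a b"
proof -
  define n where "n = Suc (i + a + b + c)"
  have n: "i < n" "a < n" "b < n" "c < n" by (auto simp: n_def)
  let ?T = "\<lambda>m (j::real). complex_of_real (tsin m j)"
  let ?D = "\<lambda>m (k::nat) (j::nat) x. if k = j then complex_of_real (tcos m x) else 0"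
  let ?E = "\<lambda>(k::nat) (j::nat). if k = j then 1 else (0::complex)"
  let ?F = "\<lambda>m \<omega>. ?T m (X a \<omega>) * (?T m (X b \<omega>) * ?T m (X c \<omega>))"
  let ?G = "\<lambda>m k \<omega>. ?D m k a (X a \<omega>) * (?T m (X b \<omega>) * ?T m (X c \<omega>)) + ?T m (X a \<omega>) * (?D m k b (X b \<omega>) * ?T m (X c \<omega>) + ?T m (X b \<omega>) * ?D m k c (X c \<omega>))"
  let ?W = "\<lambda>\<omega>. 1 * (\<bar>X b \<omega>\<bar> * \<bar>X c \<omega>\<bar>) + \<bar>X a \<omega>\<bar> * (1 * \<bar>X c \<omega>\<bar> + \<bar>X b \<omega>\<bar> * 1)"
  have "ibp n i (\<lambda>\<omega>. of_real (X a \<omega>) * (of_real (X b \<omega>) * of_real (X c \<omega>)))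
     (\<lambda>k \<omega>. ?E k a * (of_real (X b \<omega>) * of_real (X c \<omega>)) + of_real (X a \<omega>) * (?E k b * of_real (X c \<omega>) + of_real (X b \<omega>) * ?E k c))"
  proof (rule ibp_limit[where f="?F"
     and f'="?G"
     and W="\<lambda>\<omega>. \<bar>X a \<omega>\<bar> * (\<bar>X b \<omega>\<bar> * \<bar>X c \<omega>\<bar>)"
     and W'="\<lambda>k. ?W"])
    fix m
    show "ibp n i (\<lambda>\<omega>. ?F m \<omega>)
      (\<lambda>k \<omega>. ?G m k \<omega>)"
      using ibp_trig_poly'[OF trig_poly_mult[OF trig_poly_tsin[OF n(2), of m]
         trig_poly_mult[OF trig_poly_tsin[OF n(3), of m] trig_poly_tsin[OF n(4), of m]]] n(1)] .
  next
    fix m \<omega>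
    show "norm (?F m \<omega>) \<le> \<bar>X a \<omega>\<bar> * (\<bar>X b \<omega>\<bar> * \<bar>X c \<omega>\<bar>)"
      unfolding norm_mult norm_of_real by (intro mult_mono abs_tsin_le) auto
    fix k
    have d: "norm (?D m k j x) \<le> 1" for j x by (simp add: abs_tcos_le)
    show "norm (?G m k \<omega>)
      \<le> ?W \<omega>"
      by (intro norm_triangle_mono order_trans[OF norm_mult_ineq] mult_mono d abs_tsin_le)
         (auto simp: abs_tsin_le)
  next
    show "integrable M (\<lambda>\<omega>. \<bar>X i \<omega>\<bar> * (\<bar>X a \<omega>\<bar> * (\<bar>X b \<omega>\<bar> * \<bar>X c \<omega>\<bar>)))"
      using integrable_abs_X4[of i a b c] by (simp add: abs_mult mult.assoc)
    have "integrable M (\<lambda>\<omega>. \<bar>X i \<omega>\<bar> * \<bar>X j \<omega>\<bar>)" for i j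
      using integrable_abs[OF integrable_XX[of i j]] by (simp add: abs_mult)
    then show "integrable M (\<lambda>\<omega>. ?W \<omega>)"
      by (simp add: distrib_left)
  next
    fix \<omega>
    have D: "(\<lambda>m. ?D m k j x) \<longlonglongrightarrow> ?E k j" for k j x
      using tendsto_of_real[OF tcos_tendsto[of x], where 'a=complex] by auto
    have T: "(\<lambda>m. ?T m x) \<longlonglongrightarrow> of_real x" for x by (intro tendsto_of_real tsin_tendsto)
    show "(\<lambda>m. ?F m \<omega>) \<longlonglongrightarrow> of_real (X a \<omega>) * (of_real (X b \<omega>) * of_real (X c \<omega>))"
      by (intro tendsto_mult T)
    fix k
    show "(\<lambda>m. ?G m k \<omega>)
       \<longlonglongrightarrow> ?E k a * (of_real (X b \<omega>) * of_real (X c \<omega>)) + of_real (X a \<omega>) * (?E k b * of_real (X c \<omega>) + of_real (X b \<omega>) * ?E k c)"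
      by (intro tendsto_mult tendsto_add T D)
  qed simp_all
  moreover have e: "?E k a * (of_real (X b \<omega>) * of_real (X c \<omega>)) + of_real (X a \<omega>) * (?E k b * of_real (X c \<omega>) + of_real (X b \<omega>) * ?E k c)
    = complex_of_real ((if k = a then 1 else 0) * (X b \<omega> * X c \<omega>) + (if k = b then 1 else 0) * (X a \<omega> * X c \<omega>) + (if k = c then 1 else 0) * (X a \<omega> * X b \<omega>))" for k \<omega>
    by (cases "k = a"; cases "k = b"; cases "k = c"; simp add: distrib_left)
  ultimately have "expectation (\<lambda>\<omega>. complex_of_real (X i \<omega> * X a \<omega> * X b \<omega> * X c \<omega>))
    = (\<Sum>k<n. cv i k * expectation (\<lambda>\<omega>. complex_of_real ((if k = a then 1 else 0) * (X b \<omega> * X c \<omega>) + (if k = b then 1 else 0) * (X a \<omega> * X c \<omega>) + (if k = c then 1 else 0) * (X a \<omega> * X b \<omega>))))"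
    unfolding ibp_def e by (simp add: mult.assoc)
  then have "expectation (\<lambda>\<omega>. X i \<omega> * X a \<omega> * X b \<omega> * X c \<omega>)
    = (\<Sum>k<n. cv i k * expectation (\<lambda>\<omega>. (if k = a then 1 else 0) * (X b \<omega> * X c \<omega>) + (if k = b then 1 else 0) * (X a \<omega> * X c \<omega>) + (if k = c then 1 else 0) * (X a \<omega> * X b \<omega>)))"
    unfolding integral_complex_of_real of_real_mult[symmetric] of_real_sum[symmetric] of_real_eq_iff .
  also have "\<dots> = (\<Sum>k<n. cv i k * ((if k = a then 1 else 0) * cv b c + (if k = b then 1 else 0) * cv a c + (if k = c then 1 else 0) * cv a b))"
    unfolding cv_def using integrable_XX by simp
  also have "\<dots> = cv i a * cv b c + cv i b * cv a c + cv i c * cv a b"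
    using n by (simp add: distrib_left sum.distrib if_distrib[of "\<lambda>c. c * _"] if_distrib[of "\<lambda>c. _ * c"] cong: if_cong)
  finally show ?thesis .
qed

text \<open>
  Integration by parts against \<open>X\<^sub>a exp (i t \<Sum> w\<^sub>k X\<^sub>k\<^sup>2)\<close>. With the coordinates replaced by \<open>tsin m\<close>, the
  exponent is a bounded trigonometric polynomial and its exponential is a uniformly bounded limit of
  trigonometric polynomials. When \<open>m\<close> tends to infinity the exponential stays on the unit circle
  and its gradient is at most linear in the \<open>X\<^sub>j\<close>, so dominated convergence applies a second time.
\<close>
lemma ibp_exp_quadratic:
  assumes n: "i < n" "a < n"
  shows "expectation (\<lambda>\<omega>. (X i \<omega> * X a \<omega>) * iexp (t * (\<Sum>k<n. w k * (X k \<omega>)\<^sup>2)))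
    = cv i a * expectation (\<lambda>\<omega>. iexp (t * (\<Sum>k<n. w k * (X k \<omega>)\<^sup>2)))
      + 2 * \<i> * t * (\<Sum>j<n. cv i j * w j * expectation (\<lambda>\<omega>. (X a \<omega> * X j \<omega>) * iexp (t * (\<Sum>k<n. w k * (X k \<omega>)\<^sup>2))))"
proof -
  let ?T = "\<lambda>m (j::real). complex_of_real (tsin m j)"
  let ?D = "\<lambda>m k x. if k = a then complex_of_real (tcos m x) else 0"
  let ?E = "\<lambda>k. if k = a then 1 else (0::complex)"
  define q where "q m x = t * (\<Sum>k<n. w k * (tsin m (x k))\<^sup>2)" for m and x :: "nat \<Rightarrow> real"
  define q' where "q' m j x = (2 * \<i> * t * w j) * (?T m (x j) * complex_of_real (tcos m (x j)))" for m j and x :: "nat \<Rightarrow> real"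
  define q1 where "q1 m j x = (\<Sum>k<n. (\<i> * t * w k) * ((if j = k then complex_of_real (tcos m (x k)) else 0) * ?T m (x k) + ?T m (x k) * (if j = k then complex_of_real (tcos m (x k)) else 0)))" for m j and x :: "nat \<Rightarrow> real"
  \<comment> \<open>\<open>q1\<close> is the gradient in the form produced by the product rule, \<open>q'\<close> its closed form\<close>
  have q1: "q1 m j = q' m j" if "j < n" for m j
    unfolding q1_def q'_def
    using that by (intro ext) (simp add: if_distrib[of "\<lambda>c. c * _"] if_distrib[of "\<lambda>c. _ * c"] if_distrib[of "\<lambda>c. c + _"] cong: if_cong)
  have tq: "trig_poly n (\<lambda>x. \<i> * of_real (q m x)) (q1 m)" for m
  proof -
    have "trig_poly n (\<lambda>x. \<Sum>k<n. (\<i> * t * w k) * (?T m (x k) * ?T m (x k))) (\<lambda>j x. q1 m j x)"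
      unfolding q1_def by (intro trig_poly_sum trig_poly_cmult trig_poly_mult trig_poly_tsin) auto
    then show ?thesis unfolding q_def by (simp add: power2_eq_square sum_distrib_left mult.assoc)
  qed
  have [measurable]: "(\<lambda>\<omega>. q m (Xv \<omega>)) \<in> borel_measurable M" "(\<lambda>\<omega>. q' m j (Xv \<omega>)) \<in> borel_measurable M" for m j
    unfolding q_def q'_def by measurable
  define Q where "Q m = \<bar>t\<bar> * (\<Sum>k<n. \<bar>w k\<bar> * (real (Suc m))\<^sup>2)" for m
  have sq: "(tsin m y)\<^sup>2 \<le> (real (Suc m))\<^sup>2" for m y
    using power_mono[OF abs_tsin_le'[of m y], of 2] by (simp del: of_nat_Suc)
  have qQ: "\<bar>q m x\<bar> \<le> Q m" for m x
  proof -
    have "\<bar>\<Sum>k<n. w k * (tsin m (x k))\<^sup>2\<bar> \<le> (\<Sum>k<n. \<bar>w k * (tsin m (x k))\<^sup>2\<bar>)" by (rule sum_abs)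
    also have "\<dots> \<le> (\<Sum>k<n. \<bar>w k\<bar> * (real (Suc m))\<^sup>2)"
      unfolding abs_mult abs_power2 by (intro sum_mono mult_left_mono sq) auto
    finally show ?thesis unfolding q_def Q_def abs_mult by (intro mult_left_mono) auto
  qed
  have q'Q: "norm (q' m j x) \<le> 2 * \<bar>t\<bar> * \<bar>w j\<bar> * \<bar>x j\<bar>" for m j x
    unfolding q'_def norm_mult norm_of_real
    using mult_mono[OF abs_tsin_le[of m "x j"] abs_tcos_le[of m "x j"]]
      mult_left_mono[of "\<bar>tsin m (x j)\<bar> * \<bar>tcos m (x j)\<bar>" "\<bar>x j\<bar>" "2 * \<bar>t\<bar> * \<bar>w j\<bar>"] by simp
  have absX: "integrable M (\<lambda>\<omega>. \<bar>X j \<omega>\<bar>)" for j using integrable_X by simp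
  have absXX: "integrable M (\<lambda>\<omega>. \<bar>X i \<omega>\<bar> * \<bar>X j \<omega>\<bar>)" for i j
    using integrable_abs[OF integrable_XX[of i j]] by (simp add: abs_mult)
  let ?s = "\<lambda>m K \<omega>. \<Sum>p<K. (\<i> * of_real (q m (Xv \<omega>))) ^ p / fact p"
  have step1: "ibp n i (\<lambda>\<omega>. ?T m (X a \<omega>) * iexp (q m (Xv \<omega>)))
      (\<lambda>k \<omega>. ?D m k (X a \<omega>) * iexp (q m (Xv \<omega>)) + ?T m (X a \<omega>) * (iexp (q m (Xv \<omega>)) * q' m k (Xv \<omega>)))" for m
  proof (rule ibp_limit[where
      f="\<lambda>K \<omega>. ?T m (X a \<omega>) * (?s m (Suc K) \<omega>)"
      and f'="\<lambda>K k \<omega>. ?D m k (X a \<omega>) * (?s m (Suc K) \<omega>)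
         + ?T m (X a \<omega>) * ((?s m K \<omega>) * q1 m k (Xv \<omega>))"
      and W="\<lambda>\<omega>. \<bar>X a \<omega>\<bar> * exp (Q m)"
      and W'="\<lambda>k \<omega>. 1 * exp (Q m) + \<bar>X a \<omega>\<bar> * (exp (Q m) * (2 * \<bar>t\<bar> * \<bar>w k\<bar> * \<bar>X k \<omega>\<bar>))"])
    fix K
    show "ibp n i (\<lambda>\<omega>. ?T m (X a \<omega>) * (?s m (Suc K) \<omega>))
      (\<lambda>k \<omega>. ?D m k (X a \<omega>) * (?s m (Suc K) \<omega>)
         + ?T m (X a \<omega>) * ((?s m K \<omega>) * q1 m k (Xv \<omega>)))"
      using ibp_trig_poly'[OF trig_poly_mult[OF trig_poly_tsin[OF n(2), of m] trig_poly_exp_series[OF tq]] n(1)] .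
  next
    fix K \<omega>
    have e: "norm (?s m K \<omega>) \<le> exp (Q m)" for K
      using norm_exp_partial_sum_le[of "\<i> * of_real (q m (Xv \<omega>))" K] qQ[of m "Xv \<omega>"]
      by (simp add: norm_mult) (meson exp_le_cancel_iff order_trans)
    show "norm (?T m (X a \<omega>) * (?s m (Suc K) \<omega>)) \<le> \<bar>X a \<omega>\<bar> * exp (Q m)"
      unfolding norm_mult norm_of_real by (intro mult_mono abs_tsin_le e) auto
    fix k assume k: "k < n"
    have d: "norm (?D m k x) \<le> 1" for x by (simp add: abs_tcos_le)
    have t: "norm (?T m x) \<le> \<bar>x\<bar>" for x by (simp add: abs_tsin_le)
    show "norm (?D m k (X a \<omega>) * (?s m (Suc K) \<omega>)
         + ?T m (X a \<omega>) * ((?s m K \<omega>) * q1 m k (Xv \<omega>)))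
      \<le> 1 * exp (Q m) + \<bar>X a \<omega>\<bar> * (exp (Q m) * (2 * \<bar>t\<bar> * \<bar>w k\<bar> * \<bar>X k \<omega>\<bar>))"
      unfolding q1[OF k]
      by (intro norm_triangle_mono order_trans[OF norm_mult_ineq] mult_mono d t e q'Q) auto
  next
    show "integrable M (\<lambda>\<omega>. \<bar>X i \<omega>\<bar> * (\<bar>X a \<omega>\<bar> * exp (Q m)))"
      using integrable_mult_left[OF absXX[of i a], of "exp (Q m)"] by (simp add: mult.assoc)
    fix k
    show "integrable M (\<lambda>\<omega>. 1 * exp (Q m) + \<bar>X a \<omega>\<bar> * (exp (Q m) * (2 * \<bar>t\<bar> * \<bar>w k\<bar> * \<bar>X k \<omega>\<bar>)))"
      using integrable_mult_left[OF absXX[of a k], of "exp (Q m) * (2 * \<bar>t\<bar> * \<bar>w k\<bar>)"] by (simp add: algebra_simps)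
  next
    fix \<omega>
    show "(\<lambda>K. ?T m (X a \<omega>) * (?s m (Suc K) \<omega>)) \<longlonglongrightarrow> ?T m (X a \<omega>) * iexp (q m (Xv \<omega>))"
      by (intro tendsto_intros LIMSEQ_Suc[OF exp_partial_sum_tendsto])
    fix k assume k: "k < n"
    show "(\<lambda>K. ?D m k (X a \<omega>) * (?s m (Suc K) \<omega>)
         + ?T m (X a \<omega>) * ((?s m K \<omega>) * q1 m k (Xv \<omega>)))
        \<longlonglongrightarrow> ?D m k (X a \<omega>) * iexp (q m (Xv \<omega>)) + ?T m (X a \<omega>) * (iexp (q m (Xv \<omega>)) * q' m k (Xv \<omega>))"
      unfolding q1[OF k]
      by (intro tendsto_add tendsto_mult tendsto_const LIMSEQ_Suc[OF exp_partial_sum_tendsto] exp_partial_sum_tendsto)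
  next
    fix K k assume k: "k < n"
    show "(\<lambda>\<omega>. ?D m k (X a \<omega>) * (?s m (Suc K) \<omega>)
         + ?T m (X a \<omega>) * ((?s m K \<omega>) * q1 m k (Xv \<omega>))) \<in> borel_measurable M"
      unfolding q1[OF k] by measurable
  qed measurable
  define F where "F \<omega> = t * (\<Sum>k<n. w k * (X k \<omega>)\<^sup>2)" for \<omega>
  have [measurable]: "F \<in> borel_measurable M" unfolding F_def by measurable
  have "ibp n i (\<lambda>\<omega>. of_real (X a \<omega>) * iexp (F \<omega>))
      (\<lambda>k \<omega>. ?E k * iexp (F \<omega>) + of_real (X a \<omega>) * (iexp (F \<omega>) * ((2 * \<i> * t * w k) * (of_real (X k \<omega>) * 1))))"
  proof (rule ibp_limit[OF step1, where W="\<lambda>\<omega>. \<bar>X a \<omega>\<bar> * 1"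
      and W'="\<lambda>k \<omega>. 1 * 1 + \<bar>X a \<omega>\<bar> * (1 * (2 * \<bar>t\<bar> * \<bar>w k\<bar> * \<bar>X k \<omega>\<bar>))"])
    fix \<omega>
    have T: "(\<lambda>m. ?T m x) \<longlonglongrightarrow> of_real x" for x by (intro tendsto_of_real tsin_tendsto)
    have D: "(\<lambda>m. ?D m k x) \<longlonglongrightarrow> ?E k" for k x
      using tendsto_of_real[OF tcos_tendsto[of x], where 'a=complex] by auto
    have C: "(\<lambda>m. complex_of_real (tcos m x)) \<longlonglongrightarrow> 1" for x
      using tendsto_of_real[OF tcos_tendsto[of x], where 'a=complex] by simp
    have q: "(\<lambda>m. q m (Xv \<omega>)) \<longlonglongrightarrow> F \<omega>" unfolding q_def F_def by (intro tendsto_intros tsin_tendsto)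
    have e: "(\<lambda>m. iexp (q m (Xv \<omega>))) \<longlonglongrightarrow> iexp (F \<omega>)" by (intro tendsto_intros q)
    show "(\<lambda>m. ?T m (X a \<omega>) * iexp (q m (Xv \<omega>))) \<longlonglongrightarrow> of_real (X a \<omega>) * iexp (F \<omega>)"
      by (intro tendsto_mult T e)
    fix k
    show "(\<lambda>m. ?D m k (X a \<omega>) * iexp (q m (Xv \<omega>)) + ?T m (X a \<omega>) * (iexp (q m (Xv \<omega>)) * q' m k (Xv \<omega>)))
       \<longlonglongrightarrow> ?E k * iexp (F \<omega>) + of_real (X a \<omega>) * (iexp (F \<omega>) * ((2 * \<i> * t * w k) * (of_real (X k \<omega>) * 1)))"
      unfolding q'_def by (intro tendsto_add tendsto_mult T e D tendsto_const C)
  next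
    fix m \<omega>
    have t: "norm (?T m x) \<le> \<bar>x\<bar>" for x by (simp add: abs_tsin_le)
    have e: "norm (iexp (q m (Xv \<omega>))) \<le> 1" by simp
    show "norm (?T m (X a \<omega>) * iexp (q m (Xv \<omega>))) \<le> \<bar>X a \<omega>\<bar> * 1"
      by (intro order_trans[OF norm_mult_ineq] mult_mono t e) auto
    fix k
    have d: "norm (?D m k x) \<le> 1" for x by (simp add: abs_tcos_le)
    show "norm (?D m k (X a \<omega>) * iexp (q m (Xv \<omega>)) + ?T m (X a \<omega>) * (iexp (q m (Xv \<omega>)) * q' m k (Xv \<omega>)))
      \<le> 1 * 1 + \<bar>X a \<omega>\<bar> * (1 * (2 * \<bar>t\<bar> * \<bar>w k\<bar> * \<bar>X k \<omega>\<bar>))"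
      by (intro norm_triangle_mono order_trans[OF norm_mult_ineq] mult_mono d t e q'Q) auto
  next
    show "integrable M (\<lambda>\<omega>. \<bar>X i \<omega>\<bar> * (\<bar>X a \<omega>\<bar> * 1))" using absXX by simp
    fix k
    show "integrable M (\<lambda>\<omega>. 1 * 1 + \<bar>X a \<omega>\<bar> * (1 * (2 * \<bar>t\<bar> * \<bar>w k\<bar> * \<bar>X k \<omega>\<bar>)))"
      using integrable_mult_left[OF absXX[of a k], of "2 * \<bar>t\<bar> * \<bar>w k\<bar>"] by (simp add: algebra_simps)
  qed measurable
  then have "expectation (\<lambda>\<omega>. X i \<omega> * (of_real (X a \<omega>) * iexp (F \<omega>)))
     = (\<Sum>k<n. cv i k * expectation (\<lambda>\<omega>. ?E k * iexp (F \<omega>) + (2 * \<i> * t * w k) * ((X a \<omega> * X k \<omega>) * iexp (F \<omega>))))"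
    unfolding ibp_def by (simp add: algebra_simps)
  also have "\<dots> = (\<Sum>k<n. cv i k * (?E k * expectation (\<lambda>\<omega>. iexp (F \<omega>)) + (2 * \<i> * t * w k) * expectation (\<lambda>\<omega>. (X a \<omega> * X k \<omega>) * iexp (F \<omega>))))"
  proof (rule sum.cong[OF refl], rule arg_cong[where f="\<lambda>x. _ * x"])
    fix k
    have i1: "integrable M (\<lambda>\<omega>. iexp (F \<omega>))" by (rule integrable_bounded[where B=1]) auto
    have "integrable M (\<lambda>\<omega>. complex_of_real (X a \<omega> * X k \<omega>) * iexp (F \<omega>))"
      by (rule integrable_mult_bounded_complex[OF integrable_XX, where B=1]) auto
    then show "expectation (\<lambda>\<omega>. ?E k * iexp (F \<omega>) + (2 * \<i> * t * w k) * ((X a \<omega> * X k \<omega>) * iexp (F \<omega>)))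
      = ?E k * expectation (\<lambda>\<omega>. iexp (F \<omega>)) + (2 * \<i> * t * w k) * expectation (\<lambda>\<omega>. (X a \<omega> * X k \<omega>) * iexp (F \<omega>))"
      using i1 by (subst Bochner_Integration.integral_add) (simp_all only: integral_mult_right_zero integrable_mult_right)
  qed
  also have "\<dots> = cv i a * expectation (\<lambda>\<omega>. iexp (F \<omega>))
      + 2 * \<i> * t * (\<Sum>j<n. cv i j * w j * expectation (\<lambda>\<omega>. (X a \<omega> * X j \<omega>) * iexp (F \<omega>)))"
    using n(2) by (simp add: distrib_left sum.distrib sum_distrib_left if_distrib[of "\<lambda>c. c * _"] if_distrib[of "\<lambda>c. _ * c"] cong: if_cong)
       (simp add: algebra_simps)
  finally show ?thesis unfolding F_def by (simp add: mult.assoc)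
qed

end

section \<open>Quadratic forms: variances and characteristic functions\<close>

lemma abs_exp_minus_diff_le:
  fixes x y :: real
  assumes "x \<ge> 0" "y \<ge> 0"
  shows "\<bar>exp (- x) - exp (- y)\<bar> \<le> \<bar>x - y\<bar>"
proof -
  have "norm (exp (- x) - exp (- y)) \<le> 1 * norm (x - y)"
  proof (rule field_differentiable_bound[where S="{0..}" and f'="\<lambda>x. - exp (- x)"])
    show "((\<lambda>x. exp (- x)) has_field_derivative - exp (- z)) (at z within {0..})" for z :: real
      by (auto intro!: derivative_eq_intros)
  qed (use assms in auto)
  then show ?thesis by simp
qed

text \<open>
  Multiply by the integrating factor \<open>exp (c t\<^sup>2 / 2)\<close>: the product has derivative at most
  \<open>2 |s| K exp (c s\<^sup>2 / 2)\<close> and equals 1 at 0.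
\<close>
lemma gaussian_ode_bound:
  fixes \<phi> \<phi>' :: "real \<Rightarrow> complex"
  assumes deriv: "\<And>s. (\<phi> has_vector_derivative \<phi>' s) (at s)"
    and err: "\<And>s. norm (\<phi>' s + of_real (c * s) * \<phi> s) \<le> 2 * \<bar>s\<bar> * K"
    and "\<phi> 0 = 1" "c \<ge> 0" "K \<ge> 0"
  shows "norm (\<phi> t - of_real (exp (- (c * t\<^sup>2 / 2)))) \<le> 2 * t\<^sup>2 * K"
proof -
  define g where "g s = of_real (exp (c * s\<^sup>2 / 2)) * \<phi> s" for s
  define g' where "g' s = of_real (exp (c * s\<^sup>2 / 2)) * (\<phi>' s + of_real (c * s) * \<phi> s)" for s
  have dg: "(g has_vector_derivative g' s) (at s)" for s
  proof -
    have "((\<lambda>s. exp (c * s\<^sup>2 / 2)) has_real_derivative exp (c * s\<^sup>2 / 2) * (c * s)) (at s)"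
      by (auto intro!: derivative_eq_intros)
    then have "((\<lambda>s. complex_of_real (exp (c * s\<^sup>2 / 2))) has_vector_derivative of_real (exp (c * s\<^sup>2 / 2) * (c * s))) (at s)"
      by (intro has_vector_derivative_of_real) (simp add: has_real_derivative_iff_has_vector_derivative)
    from has_vector_derivative_mult[OF this deriv[of s]] show ?thesis
      unfolding g_def[abs_def] g'_def by (simp add: algebra_simps)
  qed
  have "norm (g t - g 0) \<le> (exp (c * t\<^sup>2 / 2) * (2 * \<bar>t\<bar> * K)) * norm (t - 0)"
  proof (rule differentiable_bound[where S="{- \<bar>t\<bar>..\<bar>t\<bar>}" and f'="\<lambda>s h. h *\<^sub>R g' s"])
    fix s assume s: "s \<in> {- \<bar>t\<bar>..\<bar>t\<bar>}"
    show "(g has_derivative (\<lambda>h. h *\<^sub>R g' s)) (at s within {- \<bar>t\<bar>..\<bar>t\<bar>})"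
      using dg[of s] unfolding has_vector_derivative_def by (rule has_derivative_at_withinI)
    have st: "\<bar>s\<bar> \<le> \<bar>t\<bar>" using s by auto
    have "norm (g' s) \<le> exp (c * s\<^sup>2 / 2) * (2 * \<bar>s\<bar> * K)"
      unfolding g'_def norm_mult using err[of s] by (simp add: norm_mult[symmetric])
    also have "\<dots> \<le> exp (c * t\<^sup>2 / 2) * (2 * \<bar>t\<bar> * K)"
      using st assms(4,5) by (intro mult_mono) (auto intro!: mult_left_mono simp: abs_le_square_iff)
    finally have nb: "norm (g' s) \<le> exp (c * t\<^sup>2 / 2) * (2 * \<bar>t\<bar> * K)" .
    show "onorm (\<lambda>h. h *\<^sub>R g' s) \<le> exp (c * t\<^sup>2 / 2) * (2 * \<bar>t\<bar> * K)"
    proof (rule onorm_le)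
      fix h :: real
      show "norm (h *\<^sub>R g' s) \<le> exp (c * t\<^sup>2 / 2) * (2 * \<bar>t\<bar> * K) * norm h"
        unfolding norm_scaleR real_norm_def
        using mult_right_mono[OF nb abs_ge_zero[of h]] by (simp only: mult.commute)
    qed
  qed auto
  then have gt: "norm (g t - 1) \<le> exp (c * t\<^sup>2 / 2) * (2 * t\<^sup>2 * K)"
    using assms(3) by (simp add: g_def power2_eq_square abs_mult_self_eq mult_ac flip: abs_mult)
  have "\<phi> t - of_real (exp (- (c * t\<^sup>2 / 2))) = of_real (exp (- (c * t\<^sup>2 / 2))) * (g t - 1)"
    unfolding g_def right_diff_distrib mult.assoc[symmetric] of_real_mult[symmetric] exp_add[symmetric] by simp
  then have "norm (\<phi> t - of_real (exp (- (c * t\<^sup>2 / 2)))) = exp (- (c * t\<^sup>2 / 2)) * norm (g t - 1)"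
    by (simp add: norm_mult)
  also have "\<dots> \<le> exp (- (c * t\<^sup>2 / 2)) * (exp (c * t\<^sup>2 / 2) * (2 * t\<^sup>2 * K))"
    by (intro mult_left_mono gt) auto
  also have "\<dots> = 2 * t\<^sup>2 * K" by (simp add: mult.assoc[symmetric] exp_add[symmetric])
  finally show ?thesis .
qed

lemma sum_swap_pairs: "(\<Sum>q\<in>{..<n} \<times> {..<n}. f (prod.swap q)) = (\<Sum>q\<in>{..<n::nat} \<times> {..<n}. f q)"
  by (rule sum.reindex_bij_witness[of _ prod.swap prod.swap]) auto

context gaussian_seq
begin

lemma cv_psd: "0 \<le> (\<Sum>j<n. \<Sum>l<n. cv j l * y j * y l)"
proof -
  have "0 \<le> expectation (\<lambda>\<omega>. (\<Sum>i<n. y i * X i \<omega>)\<^sup>2)" by (intro Bochner_Integration.integral_nonneg) auto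
  then show ?thesis unfolding expectation_square_lincomb by (simp add: mult_ac)
qed

text \<open>
  The quadratic form of the tensor square of the covariance matrix, evaluated at the matrix \<open>A\<close>; with \<open>R\<close>
  the covariance matrix this is \<open>tr (A\<^sup>T R A R)\<close>.
\<close>
definition tensor_form :: "nat \<Rightarrow> (nat \<times> nat \<Rightarrow> real) \<Rightarrow> real" where
  "tensor_form n A = (\<Sum>p\<in>{..<n} \<times> {..<n}. \<Sum>q\<in>{..<n} \<times> {..<n}. A p * A q * (cv (fst p) (fst q) * cv (snd p) (snd q)))"

lemma tensor_form_alt: "tensor_form n A = (\<Sum>j<n. \<Sum>l<n. cv j l * (\<Sum>i<n. \<Sum>k<n. A (i, j) * A (k, l) * cv i k))"
proof -
  have "tensor_form n A = (\<Sum>i<n. \<Sum>j<n. \<Sum>k<n. \<Sum>l<n. A (i, j) * A (k, l) * (cv i k * cv j l))"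
    unfolding tensor_form_def by (simp add: sum.cartesian_product')
  also have "\<dots> = (\<Sum>j<n. \<Sum>i<n. \<Sum>l<n. \<Sum>k<n. A (i, j) * A (k, l) * (cv i k * cv j l))"
    by (subst sum.swap, rule sum.cong[OF refl], rule sum.cong[OF refl], rule sum.swap)
  also have "\<dots> = (\<Sum>j<n. \<Sum>l<n. \<Sum>i<n. \<Sum>k<n. A (i, j) * A (k, l) * (cv i k * cv j l))"
    by (rule sum.cong[OF refl], rule sum.swap)
  finally show ?thesis by (simp add: sum_distrib_left mult_ac)
qed

lemma expectation_lincomb_mult:
  "expectation (\<lambda>\<omega>. (\<Sum>i<n. a i * X i \<omega>) * (\<Sum>k<n. b k * X k \<omega>)) = (\<Sum>i<n. \<Sum>k<n. a i * b k * cv i k)"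
  "integrable M (\<lambda>\<omega>. (\<Sum>i<n. a i * X i \<omega>) * (\<Sum>k<n. b k * X k \<omega>))"
proof -
  have e: "(\<Sum>i<n. a i * X i \<omega>) * (\<Sum>k<n. b k * X k \<omega>) = (\<Sum>i<n. \<Sum>k<n. a i * b k * (X i \<omega> * X k \<omega>))" for \<omega>
    by (simp add: sum_product mult_ac)
  show "expectation (\<lambda>\<omega>. (\<Sum>i<n. a i * X i \<omega>) * (\<Sum>k<n. b k * X k \<omega>)) = (\<Sum>i<n. \<Sum>k<n. a i * b k * cv i k)"
    unfolding e cv_def using integrable_XX
    by (simp add: Bochner_Integration.integral_sum Bochner_Integration.integrable_sum)
  show "integrable M (\<lambda>\<omega>. (\<Sum>i<n. a i * X i \<omega>) * (\<Sum>k<n. b k * X k \<omega>))"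
    unfolding e by (intro Bochner_Integration.integrable_sum integrable_mult_right integrable_XX)
qed

text \<open>
  One of the two covariance factors is written as an expectation. This reduces positivity, and
  later the operator norm bound, to statements about a single covariance matrix applied to random vectors.
\<close>
lemma tensor_form_expectation:
  "tensor_form n A = expectation (\<lambda>\<omega>. \<Sum>j<n. \<Sum>l<n. cv j l * (\<Sum>i<n. A (i, j) * X i \<omega>) * (\<Sum>k<n. A (k, l) * X k \<omega>))"
  unfolding tensor_form_alt mult.assoc
  by (subst Bochner_Integration.integral_sum
      | intro Bochner_Integration.integrable_sum integrable_mult_right expectation_lincomb_mult
      | simp add: Bochner_Integration.integral_sum expectation_lincomb_mult Bochner_Integration.integrable_sum mult.assoc)+

lemma tensor_form_nonneg: "0 \<le> tensor_form n A"
  unfolding tensor_form_expectation by (intro Bochner_Integration.integral_nonneg cv_psd)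

text \<open>
  The second pairing in Wick's formula is the first one with one matrix transposed. The difference
  of the two sides is half of the form at \<open>A - A\<^sup>T\<close>, which is nonnegative.
\<close>
lemma tensor_form_transpose_le:
  "(\<Sum>p\<in>{..<n} \<times> {..<n}. \<Sum>q\<in>{..<n} \<times> {..<n}. A p * A q * (cv (fst p) (snd q) * cv (snd p) (fst q))) \<le> tensor_form n A"
    (is "?C \<le> _")
proof -
  let ?P = "{..<n} \<times> {..<n}"
  define K where "K p q = cv (fst p) (fst q) * cv (snd p) (snd q)" for p q :: "nat \<times> nat"
  have Ks: "K (prod.swap p) (prod.swap q) = K p q" for p q by (simp add: K_def)
  have C1: "?C = (\<Sum>p\<in>?P. \<Sum>q\<in>?P. A p * A (prod.swap q) * K p q)"
  proof (rule sum.cong[OF refl])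
    fix p
    show "(\<Sum>q\<in>?P. A p * A q * (cv (fst p) (snd q) * cv (snd p) (fst q))) = (\<Sum>q\<in>?P. A p * A (prod.swap q) * K p q)"
      using sum_swap_pairs[of "\<lambda>q. A p * A q * K p (prod.swap q)" n] by (simp add: K_def)
  qed
  have "(\<Sum>p\<in>?P. \<Sum>q\<in>?P. A p * A q * K (prod.swap p) q) = ?C" by (simp add: K_def mult_ac)
  then have C2: "(\<Sum>p\<in>?P. \<Sum>q\<in>?P. A (prod.swap p) * A q * K p q) = ?C"
    using sum_swap_pairs[of "\<lambda>p. \<Sum>q\<in>?P. A p * A q * K (prod.swap p) q" n] by simp
  have "(\<Sum>q\<in>?P. A (prod.swap p) * A (prod.swap q) * K p q) = (\<Sum>q\<in>?P. A (prod.swap p) * A q * K (prod.swap p) q)" for p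
    using sum_swap_pairs[of "\<lambda>q. A (prod.swap p) * A q * K (prod.swap p) q" n] by (simp add: Ks)
  then have N2: "(\<Sum>p\<in>?P. \<Sum>q\<in>?P. A (prod.swap p) * A (prod.swap q) * K p q) = tensor_form n A"
    using sum_swap_pairs[of "\<lambda>p. \<Sum>q\<in>?P. A p * A q * K p q" n] by (simp add: tensor_form_def K_def)
  have "tensor_form n (\<lambda>p. A p - A (prod.swap p)) =
      (\<Sum>p\<in>?P. \<Sum>q\<in>?P. A p * A q * K p q + A (prod.swap p) * A (prod.swap q) * K p q
         - A p * A (prod.swap q) * K p q - A (prod.swap p) * A q * K p q)"
    unfolding tensor_form_def K_def[symmetric] by (intro sum.cong refl) (simp add: algebra_simps)
  also have "\<dots> = tensor_form n A + tensor_form n A - ?C - ?C"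
    unfolding sum_subtractf sum.distrib N2 C2 C1[symmetric] by (simp add: tensor_form_def K_def)
  finally show ?thesis using tensor_form_nonneg[of n "\<lambda>p. A p - A (prod.swap p)"] by simp
qed

lemma expectation_centered_mult:
  "expectation (\<lambda>\<omega>. (X i \<omega> * X j \<omega> - cv i j) * (X k \<omega> * X l \<omega> - cv k l)) = cv i k * cv j l + cv i l * cv j k"
  "integrable M (\<lambda>\<omega>. (X i \<omega> * X j \<omega> - cv i j) * (X k \<omega> * X l \<omega> - cv k l))"
proof -
  have e: "(X i \<omega> * X j \<omega> - cv i j) * (X k \<omega> * X l \<omega> - cv k l)
    = X i \<omega> * X j \<omega> * X k \<omega> * X l \<omega> - cv k l * (X i \<omega> * X j \<omega>) - cv i j * (X k \<omega> * X l \<omega>) + cv i j * cv k l" for \<omega>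
    by (simp add: algebra_simps)
  show "integrable M (\<lambda>\<omega>. (X i \<omega> * X j \<omega> - cv i j) * (X k \<omega> * X l \<omega> - cv k l))"
    unfolding e using integrable_X4 integrable_XX by simp
  show "expectation (\<lambda>\<omega>. (X i \<omega> * X j \<omega> - cv i j) * (X k \<omega> * X l \<omega> - cv k l)) = cv i k * cv j l + cv i l * cv j k"
    unfolding e using integrable_X4 integrable_XX
    by (simp add: wick4 prob_space) (simp add: cv_def[symmetric] algebra_simps)
qed

lemma expectation_centered_form_square:
  "expectation (\<lambda>\<omega>. (\<Sum>p\<in>{..<n} \<times> {..<n}. A p * (X (fst p) \<omega> * X (snd p) \<omega> - cv (fst p) (snd p)))\<^sup>2) \<le> 2 * tensor_form n A"
  "integrable M (\<lambda>\<omega>. (\<Sum>p\<in>{..<n} \<times> {..<n}. A p * (X (fst p) \<omega> * X (snd p) \<omega> - cv (fst p) (snd p)))\<^sup>2)"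
proof -
  let ?P = "{..<n} \<times> {..<n}"
  have e: "(\<Sum>p\<in>?P. A p * (X (fst p) \<omega> * X (snd p) \<omega> - cv (fst p) (snd p)))\<^sup>2
    = (\<Sum>p\<in>?P. \<Sum>q\<in>?P. A p * A q * ((X (fst p) \<omega> * X (snd p) \<omega> - cv (fst p) (snd p)) * (X (fst q) \<omega> * X (snd q) \<omega> - cv (fst q) (snd q))))" for \<omega>
    unfolding power2_eq_square sum_product by (intro sum.cong refl) (simp only: mult_ac)
  show "integrable M (\<lambda>\<omega>. (\<Sum>p\<in>?P. A p * (X (fst p) \<omega> * X (snd p) \<omega> - cv (fst p) (snd p)))\<^sup>2)"
    unfolding e by (intro Bochner_Integration.integrable_sum integrable_mult_right expectation_centered_mult)
  have "expectation (\<lambda>\<omega>. (\<Sum>p\<in>?P. A p * (X (fst p) \<omega> * X (snd p) \<omega> - cv (fst p) (snd p)))\<^sup>2)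
    = (\<Sum>p\<in>?P. \<Sum>q\<in>?P. A p * A q * (cv (fst p) (fst q) * cv (snd p) (snd q) + cv (fst p) (snd q) * cv (snd p) (fst q)))"
    unfolding e
    by (simp only: Bochner_Integration.integral_sum Bochner_Integration.integrable_sum integrable_mult_right
        expectation_centered_mult integral_mult_right_zero)
  also have "\<dots> = tensor_form n A + (\<Sum>p\<in>?P. \<Sum>q\<in>?P. A p * A q * (cv (fst p) (snd q) * cv (snd p) (fst q)))"
    unfolding distrib_left sum.distrib tensor_form_def ..
  finally show "expectation (\<lambda>\<omega>. (\<Sum>p\<in>?P. A p * (X (fst p) \<omega> * X (snd p) \<omega> - cv (fst p) (snd p)))\<^sup>2) \<le> 2 * tensor_form n A"
    using tensor_form_transpose_le[where n=n and A=A] by simp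
qed

definition qf :: "nat \<Rightarrow> (nat \<Rightarrow> real) \<Rightarrow> 'a \<Rightarrow> real" where
  "qf n w \<omega> = (\<Sum>k<n. w k * ((X k \<omega>)\<^sup>2 - cv k k))"

definition qcov :: "nat \<Rightarrow> (nat \<Rightarrow> real) \<Rightarrow> (nat \<Rightarrow> real) \<Rightarrow> real" where
  "qcov n u v = 2 * (\<Sum>i<n. \<Sum>j<n. u i * v j * (cv i j)\<^sup>2)"

text \<open>
  For \<open>F\<^sub>u = qf n u\<close> and \<open>F\<^sub>v = qf n v\<close> this is, up to the factor 4 and centering, the inner product of their
  gradients (the carre du champ) in the covariance metric.
\<close>
definition gamma_form :: "nat \<Rightarrow> (nat \<Rightarrow> real) \<Rightarrow> (nat \<Rightarrow> real) \<Rightarrow> 'a \<Rightarrow> real" where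
  "gamma_form n u v \<omega> = (\<Sum>i<n. \<Sum>j<n. (u i * cv i j * v j) * (X i \<omega> * X j \<omega> - cv i j))"

text \<open>
  For nonnegative weights \<open>u\<close> this says that the matrix \<open>(sqrt u\<^sub>i cv\<^sub>i\<^sub>k sqrt u\<^sub>k)\<close> is at most \<open>b\<close> as a quadratic
  form; the formulation avoids square roots and matrices.
\<close>
definition opbound :: "nat \<Rightarrow> (nat \<Rightarrow> real) \<Rightarrow> real \<Rightarrow> bool" where
  "opbound n u b \<longleftrightarrow> b \<ge> 0 \<and> (\<forall>i<n. u i \<ge> 0) \<and>
     (\<forall>y. (\<Sum>i<n. \<Sum>k<n. cv i k * (u i * y i) * (u k * y k)) \<le> b * (\<Sum>i<n. u i * (y i)\<^sup>2))"

lemma opboundD: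
  "opbound n u b \<Longrightarrow> (\<Sum>i<n. \<Sum>k<n. cv i k * (u i * y i) * (u k * y k)) \<le> b * (\<Sum>i<n. u i * (y i)\<^sup>2)"
  unfolding opbound_def by blast

lemma qf_measurable [measurable]: "qf n w \<in> borel_measurable M"
  unfolding qf_def by measurable

lemma qf_mult:
  "expectation (\<lambda>\<omega>. qf n u \<omega> * qf n v \<omega>) = qcov n u v"
  "integrable M (\<lambda>\<omega>. qf n u \<omega> * qf n v \<omega>)"
proof -
  have e: "qf n u \<omega> * qf n v \<omega> = (\<Sum>i<n. \<Sum>j<n. u i * v j * ((X i \<omega> * X i \<omega> - cv i i) * (X j \<omega> * X j \<omega> - cv j j)))" for \<omega>
    unfolding qf_def sum_product power2_eq_square by (intro sum.cong refl) (simp only: mult_ac)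
  show "integrable M (\<lambda>\<omega>. qf n u \<omega> * qf n v \<omega>)"
    unfolding e by (intro Bochner_Integration.integrable_sum integrable_mult_right expectation_centered_mult)
  show "expectation (\<lambda>\<omega>. qf n u \<omega> * qf n v \<omega>) = qcov n u v"
    unfolding e
    by (simp only: Bochner_Integration.integral_sum Bochner_Integration.integrable_sum integrable_mult_right
        expectation_centered_mult integral_mult_right_zero)
       (simp add: qcov_def sum_distrib_left power2_eq_square mult_ac)
qed

lemma qf_square: "expectation (\<lambda>\<omega>. (qf n u \<omega>)\<^sup>2) = qcov n u u" "integrable M (\<lambda>\<omega>. (qf n u \<omega>)\<^sup>2)"
  using qf_mult[where n=n and u=u and v=u] by (simp_all add: power2_eq_square)

lemma qcov_nonneg: "0 \<le> qcov n u u"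
  unfolding qf_square(1)[symmetric] by (intro Bochner_Integration.integral_nonneg) auto

lemma gamma_form_alt: "gamma_form n u v \<omega> = (\<Sum>p\<in>{..<n} \<times> {..<n}. (case p of (i, j) \<Rightarrow> u i * cv i j * v j) * (X (fst p) \<omega> * X (snd p) \<omega> - cv (fst p) (snd p)))"
  unfolding gamma_form_def by (simp add: sum.cartesian_product split_beta)

lemma gamma_form_square_integrable: "integrable M (\<lambda>\<omega>. (gamma_form n u v \<omega>)\<^sup>2)"
  unfolding gamma_form_alt by (rule expectation_centered_form_square)

lemma gamma_form_measurable [measurable]: "gamma_form n u v \<in> borel_measurable M"
  unfolding gamma_form_def by measurable

text \<open>
  The matrix \<open>u\<^sub>i cv\<^sub>i\<^sub>j v\<^sub>j\<close> has \<open>tensor_form\<close> at most \<open>b d\<close> times half of \<open>qcov n u v\<close>: the operator bound for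
  \<open>v\<close> is applied pointwise to the random vector \<open>\<Sum>\<^sub>i u\<^sub>i cv\<^sub>i\<^sub>j X\<^sub>i\<close>, the one for \<open>u\<close> to its covariances.
\<close>
lemma gamma_form_square_le:
  assumes u: "opbound n u b" and v: "opbound n v d"
  shows "expectation (\<lambda>\<omega>. (gamma_form n u v \<omega>)\<^sup>2) \<le> b * d * qcov n u v"
proof -
  let ?A = "\<lambda>p. case p of (i, j) \<Rightarrow> u i * cv i j * v j"
  let ?y = "\<lambda>j \<omega>. \<Sum>i<n. (u i * cv i j) * X i \<omega>"
  have yy: "integrable M (\<lambda>\<omega>. (?y j \<omega>)\<^sup>2)" for j by (rule integrable_square_lincomb)
  have "tensor_form n ?A = expectation (\<lambda>\<omega>. \<Sum>j<n. \<Sum>l<n. cv j l * (v j * ?y j \<omega>) * (v l * ?y l \<omega>))"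
    unfolding tensor_form_expectation by (simp add: sum_distrib_left mult_ac)
  also have "\<dots> \<le> expectation (\<lambda>\<omega>. d * (\<Sum>j<n. v j * (?y j \<omega>)\<^sup>2))"
  proof (rule integral_mono)
    show "(\<Sum>j<n. \<Sum>l<n. cv j l * (v j * ?y j \<omega>) * (v l * ?y l \<omega>)) \<le> d * (\<Sum>j<n. v j * (?y j \<omega>)\<^sup>2)" for \<omega>
      by (rule opboundD[OF v])
    show "integrable M (\<lambda>\<omega>. d * (\<Sum>j<n. v j * (?y j \<omega>)\<^sup>2))"
      by (intro Bochner_Integration.integrable_sum integrable_mult_right yy)
    have "integrable M (\<lambda>\<omega>. \<Sum>j<n. \<Sum>l<n. (cv j l * v j * v l) * (?y j \<omega> * ?y l \<omega>))"
      by (intro Bochner_Integration.integrable_sum integrable_mult_right expectation_lincomb_mult)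
    then show "integrable M (\<lambda>\<omega>. \<Sum>j<n. \<Sum>l<n. cv j l * (v j * ?y j \<omega>) * (v l * ?y l \<omega>))"
      by (simp only: mult_ac)
  qed
  also have "\<dots> = d * (\<Sum>j<n. v j * (\<Sum>i<n. \<Sum>k<n. (u i * cv i j) * (u k * cv k j) * cv i k))"
    using yy by (simp add: Bochner_Integration.integral_sum expectation_square_lincomb)
  also have "\<dots> \<le> d * (\<Sum>j<n. v j * (b * (\<Sum>i<n. u i * (cv i j)\<^sup>2)))"
  proof (intro mult_left_mono sum_mono)
    fix j assume "j \<in> {..<n}"
    have "(\<Sum>i<n. \<Sum>k<n. cv i k * (u i * cv i j) * (u k * cv k j)) \<le> b * (\<Sum>i<n. u i * (cv i j)\<^sup>2)"
      by (rule opboundD[OF u])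
    then show "(\<Sum>i<n. \<Sum>k<n. (u i * cv i j) * (u k * cv k j) * cv i k) \<le> b * (\<Sum>i<n. u i * (cv i j)\<^sup>2)"
      by (simp only: mult_ac)
  qed (use v in \<open>auto simp: opbound_def\<close>)
  also have "(\<Sum>j<n. v j * (b * (\<Sum>i<n. u i * (cv i j)\<^sup>2))) = b * (qcov n u v / 2)"
    unfolding qcov_def by (subst sum.swap) (simp add: sum_distrib_left mult_ac)
  finally have "2 * tensor_form n ?A \<le> b * d * qcov n u v" by (simp add: mult_ac)
  then show ?thesis using expectation_centered_form_square(1)[where n=n and A="?A"] unfolding gamma_form_alt by simp
qed

text \<open>
  The left-hand side is \<open>\<phi>' t + Var(F) t \<phi> t\<close> for the characteristic function \<open>\<phi>\<close> of \<open>F = qf n w\<close>. Integration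
  by parts in \<open>E [X\<^sub>k X\<^sub>k exp (i t F)]\<close> removes the centering of \<open>F\<close> and leaves the quadratic form with
  matrix \<open>w\<^sub>k cv\<^sub>k\<^sub>j w\<^sub>j\<close>, whose mean is half of the variance.
\<close>
lemma qf_char_ode:
  "expectation (\<lambda>\<omega>. \<i> * (qf n w \<omega> * iexp (t * qf n w \<omega>)))
     + of_real (qcov n w w * t) * expectation (\<lambda>\<omega>. iexp (t * qf n w \<omega>))
   = of_real (- 2 * t) * expectation (\<lambda>\<omega>. gamma_form n w w \<omega> * iexp (t * qf n w \<omega>))"
proof -
  define F where "F \<omega> = (\<Sum>k<n. w k * (X k \<omega>)\<^sup>2)" for \<omega>
  \<comment> \<open>the deterministic phase by which \<open>F\<close> and \<open>qf n w\<close> differ\<close>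
  define z where "z = iexp (- t * (\<Sum>k<n. w k * cv k k))"
  define e where "e = (\<lambda>\<omega>. iexp (t * qf n w \<omega>))"
  have [measurable]: "e \<in> borel_measurable M" unfolding e_def by measurable
  have e1: "norm (e \<omega>) \<le> 1" for \<omega> by (simp add: e_def)
  have qF: "e \<omega> = z * iexp (t * F \<omega>)" for \<omega>
    unfolding e_def z_def exp_add[symmetric] qf_def F_def
    by (simp add: right_diff_distrib sum_subtractf algebra_simps)
  have ie: "integrable M e" by (rule integrable_bounded[where B=1]) (auto intro: e1)
  have ixx: "integrable M (\<lambda>\<omega>. complex_of_real (X i \<omega> * X j \<omega>) * e \<omega>)" for i j
    by (rule integrable_mult_bounded_complex[OF integrable_XX, where B=1]) (auto intro: e1)
  have xx: "expectation (\<lambda>\<omega>. complex_of_real (X i \<omega> * X j \<omega>) * e \<omega>) = z * expectation (\<lambda>\<omega>. complex_of_real (X i \<omega> * X j \<omega>) * iexp (t * F \<omega>))" for i j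
    unfolding qF by (subst integral_mult_right_zero[symmetric]) (simp add: mult_ac)
  have x0: "expectation e = z * expectation (\<lambda>\<omega>. iexp (t * F \<omega>))"
    unfolding qF[abs_def] by simp
  have ibp: "expectation (\<lambda>\<omega>. complex_of_real (X k \<omega> * X k \<omega>) * e \<omega>) = cv k k * expectation e
      + 2 * \<i> * t * (\<Sum>j<n. of_real (cv k j * w j) * expectation (\<lambda>\<omega>. complex_of_real (X k \<omega> * X j \<omega>) * e \<omega>))" if "k < n" for k
    unfolding xx x0 using ibp_exp_quadratic[OF that that, of t w, folded F_def]
    by (simp add: sum_distrib_left algebra_simps)
  have "expectation (\<lambda>\<omega>. qf n w \<omega> * e \<omega>) = expectation (\<lambda>\<omega>. \<Sum>k<n. of_real (w k) * (complex_of_real (X k \<omega> * X k \<omega>) * e \<omega> - of_real (cv k k) * e \<omega>))"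
    unfolding qf_def by (simp add: sum_distrib_right sum_distrib_left algebra_simps power2_eq_square)
  also have "\<dots> = (\<Sum>k<n. of_real (w k) * (expectation (\<lambda>\<omega>. complex_of_real (X k \<omega> * X k \<omega>) * e \<omega>) - of_real (cv k k) * expectation e))"
    using ixx ie
    by (simp only: Bochner_Integration.integral_sum Bochner_Integration.integral_diff Bochner_Integration.integrable_diff
        integrable_mult_right integral_mult_right_zero)
  also have "\<dots> = (\<Sum>k<n. of_real (w k) * (2 * \<i> * t * (\<Sum>j<n. of_real (cv k j * w j) * expectation (\<lambda>\<omega>. complex_of_real (X k \<omega> * X j \<omega>) * e \<omega>))))"
    by (intro sum.cong refl) (simp only: ibp lessThan_iff add_diff_cancel_left')
  also have "\<dots> = 2 * \<i> * t * (\<Sum>k<n. \<Sum>j<n. of_real (w k * cv k j * w j) * expectation (\<lambda>\<omega>. complex_of_real (X k \<omega> * X j \<omega>) * e \<omega>))"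
    by (simp add: sum_distrib_left mult_ac)
  finally have 1: "expectation (\<lambda>\<omega>. qf n w \<omega> * e \<omega>) = 2 * \<i> * t * (\<Sum>k<n. \<Sum>j<n. of_real (w k * cv k j * w j) * expectation (\<lambda>\<omega>. complex_of_real (X k \<omega> * X j \<omega>) * e \<omega>))" .
  have "expectation (\<lambda>\<omega>. gamma_form n w w \<omega> * e \<omega>) = expectation (\<lambda>\<omega>. \<Sum>k<n. \<Sum>j<n. of_real (w k * cv k j * w j) * (complex_of_real (X k \<omega> * X j \<omega>) * e \<omega> - of_real (cv k j) * e \<omega>))"
    unfolding gamma_form_def of_real_sum sum_distrib_right by (intro Bochner_Integration.integral_cong sum.cong refl) (simp add: algebra_simps)
  also have "\<dots> = (\<Sum>k<n. \<Sum>j<n. of_real (w k * cv k j * w j) * (expectation (\<lambda>\<omega>. complex_of_real (X k \<omega> * X j \<omega>) * e \<omega>) - of_real (cv k j) * expectation e))"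
    using ixx ie
    by (simp only: Bochner_Integration.integral_sum Bochner_Integration.integral_diff Bochner_Integration.integrable_diff
        Bochner_Integration.integrable_sum integrable_mult_right integral_mult_right_zero)
  also have "\<dots> = (\<Sum>k<n. \<Sum>j<n. of_real (w k * cv k j * w j) * expectation (\<lambda>\<omega>. complex_of_real (X k \<omega> * X j \<omega>) * e \<omega>))
      - of_real (qcov n w w / 2) * expectation e"
    unfolding right_diff_distrib sum_subtractf qcov_def
    by (simp add: sum_distrib_left sum_distrib_right power2_eq_square mult_ac)
  finally have 2: "expectation (\<lambda>\<omega>. gamma_form n w w \<omega> * e \<omega>) = (\<Sum>k<n. \<Sum>j<n. of_real (w k * cv k j * w j) * expectation (\<lambda>\<omega>. complex_of_real (X k \<omega> * X j \<omega>) * e \<omega>))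
      - of_real (qcov n w w / 2) * expectation e" .
  have "expectation (\<lambda>\<omega>. \<i> * (qf n w \<omega> * e \<omega>)) = \<i> * expectation (\<lambda>\<omega>. qf n w \<omega> * e \<omega>)" by simp
  then have "expectation (\<lambda>\<omega>. \<i> * (qf n w \<omega> * e \<omega>)) + of_real (qcov n w w * t) * expectation e
     = of_real (- 2 * t) * expectation (\<lambda>\<omega>. gamma_form n w w \<omega> * e \<omega>)"
    unfolding 1 2 by (simp add: algebra_simps)
  then show ?thesis unfolding e_def .
qed

text \<open>
  \<open>gaussian_ode_bound\<close> for the equation above; the error term is at most the \<open>L\<^sup>2\<close> norm of the
  centered form because the exponential has modulus one.
\<close>
lemma qf_char_bound:
  assumes K: "expectation (\<lambda>\<omega>. (gamma_form n w w \<omega>)\<^sup>2) \<le> K\<^sup>2" "K \<ge> 0"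
  shows "norm (expectation (\<lambda>\<omega>. iexp (t * qf n w \<omega>)) - of_real (exp (- (qcov n w w * t\<^sup>2 / 2)))) \<le> 2 * t\<^sup>2 * K"
proof (rule gaussian_ode_bound[where \<phi>="\<lambda>t. expectation (\<lambda>\<omega>. iexp (t * qf n w \<omega>))"
      and \<phi>'="\<lambda>t. expectation (\<lambda>\<omega>. \<i> * (qf n w \<omega> * iexp (t * qf n w \<omega>)))"])
  show "((\<lambda>t. expectation (\<lambda>\<omega>. iexp (t * qf n w \<omega>))) has_vector_derivative expectation (\<lambda>\<omega>. \<i> * (qf n w \<omega> * iexp (s * qf n w \<omega>)))) (at s)" for s
    using has_vector_derivative_integral_iexp[of "\<lambda>_. 0" "qf n w" s] qf_square(2) by simp
  fix s
  let ?g = "gamma_form n w w"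
  have ig: "integrable M ?g" by (rule square_integrable_imp_integrable[OF _ gamma_form_square_integrable]) simp
  have "norm (expectation (\<lambda>\<omega>. ?g \<omega> * iexp (s * qf n w \<omega>))) \<le> expectation (\<lambda>\<omega>. \<bar>?g \<omega>\<bar>)"
    by (rule order_trans[OF integral_norm_bound]) (simp add: norm_mult)
  also have "\<dots> \<le> K"
  proof -
    have "(expectation (\<lambda>\<omega>. \<bar>?g \<omega>\<bar>))\<^sup>2 \<le> expectation (\<lambda>\<omega>. \<bar>?g \<omega>\<bar>\<^sup>2)"
    proof -
      have "0 \<le> variance (\<lambda>\<omega>. \<bar>?g \<omega>\<bar>)" by (intro Bochner_Integration.integral_nonneg) auto
      also have "\<dots> = expectation (\<lambda>\<omega>. \<bar>?g \<omega>\<bar>\<^sup>2) - (expectation (\<lambda>\<omega>. \<bar>?g \<omega>\<bar>))\<^sup>2"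
        by (rule variance_eq) (use ig gamma_form_square_integrable in auto)
      finally show ?thesis by simp
    qed
    also have "\<dots> \<le> K\<^sup>2" using K(1) by simp
    finally show ?thesis using K(2) by (rule power2_le_imp_le)
  qed
  finally have "norm (expectation (\<lambda>\<omega>. ?g \<omega> * iexp (s * qf n w \<omega>))) \<le> K" .
  then show "norm (expectation (\<lambda>\<omega>. \<i> * (qf n w \<omega> * iexp (s * qf n w \<omega>))) + of_real (qcov n w w * s) * expectation (\<lambda>\<omega>. iexp (s * qf n w \<omega>)))
     \<le> 2 * \<bar>s\<bar> * K"
    unfolding qf_char_ode norm_mult by (simp add: mult_left_mono)
qed (use K qcov_nonneg in \<open>auto simp: prob_space\<close>)

lemma qf_char_normal:
  assumes u: "opbound n u b" "qcov n u u = 1"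
  shows "norm (expectation (\<lambda>\<omega>. iexp (t * qf n u \<omega>)) - of_real (exp (- (t\<^sup>2 / 2)))) \<le> 2 * t\<^sup>2 * b"
  using qf_char_bound[of n u b t] gamma_form_square_le[OF u(1) u(1)] u
  by (auto simp: opbound_def power2_eq_square)

lemma qcov_le_1:
  assumes "qcov n u u = 1" "qcov n v v = 1"
  shows "qcov n u v \<le> 1"
proof -
  have "0 \<le> expectation (\<lambda>\<omega>. (qf n u \<omega> - qf n v \<omega>)\<^sup>2)" by (intro Bochner_Integration.integral_nonneg) auto
  also have "\<dots> = expectation (\<lambda>\<omega>. qf n u \<omega> * qf n u \<omega> - 2 * (qf n u \<omega> * qf n v \<omega>) + qf n v \<omega> * qf n v \<omega>)"
    by (simp add: power2_eq_square algebra_simps)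
  also have "\<dots> = 2 - 2 * qcov n u v" using qf_mult assms by simp
  finally show ?thesis by simp
qed

lemma qcov_commute: "qcov n u v = qcov n v u"
  unfolding qf_mult(1)[symmetric] by (simp add: mult.commute)

text \<open>
  The difference is the form with weights \<open>u - v\<close>, whose signs are mixed. Its \<open>gamma_form\<close> is a combination of
  those of the pairs \<open>(u, u)\<close>, \<open>(u, v)\<close>, \<open>(v, v)\<close>, and its variance is \<open>2 - 2 qcov n u v\<close>.
\<close>
lemma qf_diff_char_normal:
  assumes u: "opbound n u b" "qcov n u u = 1" and v: "opbound n v d" "qcov n v v = 1"
  shows "norm (expectation (\<lambda>\<omega>. iexp (t * (qf n u \<omega> - qf n v \<omega>))) - of_real (exp (- t\<^sup>2))) \<le> t\<^sup>2 * (6 * (b + d) + \<bar>qcov n u v\<bar>)"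
proof -
  define w where "w k = u k - v k" for k
  have bd: "b \<ge> 0" "d \<ge> 0" using u v by (auto simp: opbound_def)
  have qw: "qf n u \<omega> - qf n v \<omega> = qf n w \<omega>" for \<omega>
    by (simp add: qf_def w_def left_diff_distrib sum_subtractf)
  have cw: "qcov n w w = 2 - 2 * qcov n u v"
    unfolding qf_mult(1)[symmetric] qw[symmetric] using qf_mult u v qcov_commute[of n v u]
    by (simp add: left_diff_distrib right_diff_distrib)
  have gw: "gamma_form n w w \<omega> = gamma_form n u u \<omega> - 2 * gamma_form n u v \<omega> + gamma_form n v v \<omega>" for \<omega>
  proof -
    have "gamma_form n v u \<omega> = gamma_form n u v \<omega>"
      unfolding gamma_form_def by (subst sum.swap) (simp add: cv_sym mult_ac)
    moreover have "gamma_form n w w \<omega> = gamma_form n u u \<omega> - gamma_form n u v \<omega> - gamma_form n v u \<omega> + gamma_form n v v \<omega>"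
      unfolding gamma_form_def w_def by (simp add: sum.distrib[symmetric] sum_subtractf[symmetric] algebra_simps)
    ultimately show ?thesis by simp
  qed
  have "expectation (\<lambda>\<omega>. (gamma_form n w w \<omega>)\<^sup>2) \<le> expectation (\<lambda>\<omega>. 3 * ((gamma_form n u u \<omega>)\<^sup>2 + 4 * (gamma_form n u v \<omega>)\<^sup>2 + (gamma_form n v v \<omega>)\<^sup>2))"
  proof (rule integral_mono)
    fix \<omega>
    have "(x - 2 * y + z)\<^sup>2 \<le> 3 * (x\<^sup>2 + 4 * y\<^sup>2 + z\<^sup>2)" for x y z :: real
    proof -
      have "3 * (x\<^sup>2 + 4 * y\<^sup>2 + z\<^sup>2) - (x - 2 * y + z)\<^sup>2 = (x + 2 * y)\<^sup>2 + (x - z)\<^sup>2 + (2 * y + z)\<^sup>2"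
        by (simp add: power2_eq_square algebra_simps)
      then show ?thesis by (smt (verit) zero_le_power2)
    qed
    then show "(gamma_form n w w \<omega>)\<^sup>2 \<le> 3 * ((gamma_form n u u \<omega>)\<^sup>2 + 4 * (gamma_form n u v \<omega>)\<^sup>2 + (gamma_form n v v \<omega>)\<^sup>2)" unfolding gw .
  qed (use gamma_form_square_integrable in auto)
  also have "\<dots> = 3 * (expectation (\<lambda>\<omega>. (gamma_form n u u \<omega>)\<^sup>2) + 4 * expectation (\<lambda>\<omega>. (gamma_form n u v \<omega>)\<^sup>2) + expectation (\<lambda>\<omega>. (gamma_form n v v \<omega>)\<^sup>2))"
    using gamma_form_square_integrable by simp
  also have "\<dots> \<le> 3 * (b * b + 4 * (b * d) + d * d)"
  proof -
    have "b * d * qcov n u v \<le> b * d * 1" using bd qcov_le_1[OF u(2) v(2)] by (intro mult_left_mono) auto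
    then show ?thesis
      using gamma_form_square_le[OF u(1) u(1)] gamma_form_square_le[OF u(1) v(1)] gamma_form_square_le[OF v(1) v(1)] u v by simp
  qed
  also have "\<dots> \<le> (3 * (b + d))\<^sup>2"
    using bd by (simp add: power2_eq_square algebra_simps)
  finally have "norm (expectation (\<lambda>\<omega>. iexp (t * qf n w \<omega>)) - of_real (exp (- (qcov n w w * t\<^sup>2 / 2)))) \<le> 2 * t\<^sup>2 * (3 * (b + d))"
    using bd by (intro qf_char_bound) auto
  moreover have "norm (of_real (exp (- (qcov n w w * t\<^sup>2 / 2))) - complex_of_real (exp (- t\<^sup>2))) \<le> t\<^sup>2 * \<bar>qcov n u v\<bar>"
  proof -
    have "norm (of_real (exp (- (qcov n w w * t\<^sup>2 / 2))) - complex_of_real (exp (- t\<^sup>2))) = \<bar>exp (- (qcov n w w * t\<^sup>2 / 2)) - exp (- t\<^sup>2)\<bar>"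
      by (metis norm_of_real of_real_diff)
    also have "\<dots> \<le> \<bar>qcov n w w * t\<^sup>2 / 2 - t\<^sup>2\<bar>"
      using qcov_nonneg[of n w] by (intro abs_exp_minus_diff_le) auto
    also have "qcov n w w * t\<^sup>2 / 2 - t\<^sup>2 = - (t\<^sup>2 * qcov n u v)" unfolding cw by (simp add: field_simps)
    finally show ?thesis by (simp add: abs_mult)
  qed
  ultimately have "norm (expectation (\<lambda>\<omega>. iexp (t * qf n w \<omega>)) - of_real (exp (- t\<^sup>2))) \<le> 2 * t\<^sup>2 * (3 * (b + d)) + t\<^sup>2 * \<bar>qcov n u v\<bar>"
    by (rule norm_diff_triangle_le)
  then show ?thesis unfolding qw by (simp add: algebra_simps)
qed

end

section \<open>The covariance of fractional Gaussian noise\<close>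

text \<open>
  The covariance of two unit increments of fractional Brownian motion at distance \<open>m\<close>. The absolute
  value makes the formula give the variance 1 for \<open>m = 0\<close>.
\<close>
definition fgn :: "real \<Rightarrow> nat \<Rightarrow> real" where
  "fgn H m = ((real m + 1) powr (2 * H) + \<bar>real m - 1\<bar> powr (2 * H) - 2 * real m powr (2 * H)) / 2"

lemma second_difference_powr:
  fixes m :: nat and p :: real
  assumes "m \<ge> 2"
  obtains \<eta> where "real m - 1 < \<eta>" "\<eta> < real m + 1"
    "(real m + 1) powr p + (real m - 1) powr p - 2 * real m powr p = p * (p - 1) * \<eta> powr (p - 2)"
proof -
  define g where "g x = x powr p - (x - 1) powr p" for x :: real
  define g' where "g' x = p * x powr (p - 1) - p * (x - 1) powr (p - 1)" for x :: real
  have "\<exists>z. real m < z \<and> z < real m + 1 \<and> g (real m + 1) - g (real m) = (real m + 1 - real m) * g' z"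
  proof (rule MVT2)
    fix x assume "real m \<le> x" "x \<le> real m + 1"
    then have "x > 0" "x - 1 > 0" using assms by auto
    then show "(g has_real_derivative g' x) (at x)"
      unfolding g_def g'_def by (auto intro!: derivative_eq_intros)
  qed simp
  then obtain z where z: "real m < z" "z < real m + 1" "g (real m + 1) - g (real m) = g' z" by auto
  have "\<exists>y. z - 1 < y \<and> y < z \<and> p * z powr (p - 1) - p * (z - 1) powr (p - 1) = (z - (z - 1)) * (p * ((p - 1) * y powr (p - 2)))"
  proof (rule MVT2)
    fix x assume "z - 1 \<le> x" "x \<le> z"
    then have "x > 0" using z assms by auto
    then show "((\<lambda>x. p * x powr (p - 1)) has_real_derivative p * ((p - 1) * x powr (p - 2))) (at x)"
      by (auto intro!: derivative_eq_intros simp: algebra_simps)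
  qed simp
  then obtain y where "z - 1 < y" "y < z" "g' z = p * ((p - 1) * y powr (p - 2))" by (auto simp: g'_def)
  then show ?thesis using z by (intro that[of y]) (auto simp: g_def algebra_simps)
qed

text \<open>
  A second difference is a second derivative at an intermediate point, at least \<open>(m + 1) / 3\<close> when
  \<open>m \<ge> 2\<close>; the constant is \<open>3\<^sup>2\<close>.
\<close>
lemma abs_fgn_le:
  assumes H: "0 < H" "H < 1"
  shows "\<bar>fgn H m\<bar> \<le> 9 * (real m + 1) powr (2 * H - 2)"
proof -
  consider "m = 0" | "m = 1" | "m \<ge> 2" by linarith
  then show ?thesis
  proof cases
    case 1 then show ?thesis using H by (simp add: fgn_def)
  next
    case 2
    have "2 powr (2 * H) \<le> 2 powr (2::real)" by (rule powr_mono) (use H in auto)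
    moreover have "2 powr (0::real) \<le> 2 powr (2 * H)" by (rule powr_mono) (use H in auto)
    moreover have "2 powr (-2::real) \<le> 2 powr (2 * H - 2)" by (rule powr_mono) (use H in auto)
    ultimately have "2 powr (2 * H) \<le> 4" "1 \<le> 2 powr (2 * H)" "1/4 \<le> 2 powr (2 * H - 2)"
      by (simp_all add: powr_minus)
    then show ?thesis using 2 H by (auto simp: fgn_def)
  next
    case 3
    obtain \<eta> where e: "real m - 1 < \<eta>" "\<eta> < real m + 1"
      "(real m + 1) powr (2*H) + (real m - 1) powr (2*H) - 2 * real m powr (2*H) = 2*H * (2*H - 1) * \<eta> powr (2*H - 2)"
      using second_difference_powr[OF 3] by blast
    have "fgn H m = H * (2*H - 1) * \<eta> powr (2*H - 2)" using e(3) 3 by (simp add: fgn_def)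
    then have "\<bar>fgn H m\<bar> = \<bar>H * (2*H - 1)\<bar> * \<eta> powr (2*H - 2)" by (simp add: abs_mult)
    also have "\<dots> \<le> 1 * ((real m + 1) / 3) powr (2*H - 2)"
    proof (intro mult_mono)
      show "\<bar>H * (2*H - 1)\<bar> \<le> 1" unfolding abs_mult
        using H mult_mono[of "\<bar>H\<bar>" 1 "\<bar>2*H - 1\<bar>" 1] by auto
      show "\<eta> powr (2*H - 2) \<le> ((real m + 1) / 3) powr (2*H - 2)"
        using e 3 H by (intro powr_mono2') auto
    qed auto
    also have "\<dots> = 3 powr (2 - 2*H) * (real m + 1) powr (2*H - 2)"
    proof -
      have "(3::real) powr (2*H - 2) * 3 powr (2 - 2*H) = 1" by (subst powr_add[symmetric]) simp
      then show ?thesis by (simp add: powr_divide field_simps)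
    qed
    also have "\<dots> \<le> 3 powr 2 * (real m + 1) powr (2*H - 2)"
      using H by (intro mult_right_mono powr_mono) auto
    finally show ?thesis by (simp add: powr_numeral)
  qed
qed

lemma fgn_three_quarters_ge: "(fgn (3/4) m)\<^sup>2 \<ge> (9 / 64) * (1 / (real m + 1))"
proof -
  consider "m = 0" | "m = 1" | "m \<ge> 2" by linarith
  then show ?thesis
  proof cases
    case 1 then show ?thesis by (simp add: fgn_def)
  next
    case 2
    have "2 powr (3/2) = 2 powr (1 + 1/2::real)" by simp
    also have "\<dots> = 2 * sqrt 2" by (subst powr_add) (simp add: powr_half_sqrt)
    finally have "fgn (3/4) m = sqrt 2 - 1" using 2 by (simp add: fgn_def)
    moreover have "sqrt 2 \<ge> 7/5" by (rule real_le_rsqrt) (simp add: power2_eq_square)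
    then have "(2/5)\<^sup>2 \<le> (sqrt 2 - 1)\<^sup>2" by (intro power_mono) auto
    ultimately show ?thesis using 2 by (simp add: power2_eq_square)
  next
    case 3
    obtain \<eta> where e: "real m - 1 < \<eta>" "\<eta> < real m + 1"
      "(real m + 1) powr (3/2) + (real m - 1) powr (3/2) - 2 * real m powr (3/2) = (3/2) * (3/2 - 1) * \<eta> powr (3/2 - 2)"
      using second_difference_powr[OF 3] by blast
    have ep: "\<eta> > 0" using e 3 by auto
    have "fgn (3/4) m = (3/8) * \<eta> powr (-1/2)" using e(3) 3 by (simp add: fgn_def)
    then have "(fgn (3/4) m)\<^sup>2 = (9/64) * (\<eta> powr (-1/2))\<^sup>2" by (simp only: power_mult_distrib) (simp add: power2_eq_square)
    also have "(\<eta> powr (-1/2))\<^sup>2 = 1 / \<eta>" using ep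
      by (simp add: power2_eq_square powr_add[symmetric] powr_minus_divide)
    also have "(9/64) * (1 / \<eta>) \<ge> (9/64) * (1 / (real m + 1))"
      using e ep by (intro mult_left_mono divide_left_mono) auto
    finally show ?thesis by simp
  qed
qed

lemma sum_powr_le:
  assumes q: "0 < q" "q \<le> 1"
  shows "(\<Sum>m<n. (real m + 1) powr (q - 1)) \<le> real n powr q / q"
proof (induction n)
  case 0 then show ?case by simp
next
  case (Suc n)
  have "(real n + 1) powr (q - 1) \<le> ((real n + 1) powr q - real n powr q) / q"
  proof (cases "n = 0")
    case True then show ?thesis using q by simp
  next
    case False
    have "\<exists>z. real n < z \<and> z < real n + 1 \<and> (real n + 1) powr q - real n powr q = (real n + 1 - real n) * (q * z powr (q - 1))"
    proof (rule MVT2)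
      fix x assume "real n \<le> x" "x \<le> real n + 1"
      then have "x > 0" using False by auto
      then show "((\<lambda>x. x powr q) has_real_derivative q * x powr (q - 1)) (at x)"
        by (auto intro!: derivative_eq_intros)
    qed simp
    then obtain z where z: "real n < z" "z < real n + 1" "(real n + 1) powr q - real n powr q = q * z powr (q - 1)" by auto
    have "(real n + 1) powr (q - 1) \<le> z powr (q - 1)" using z q False by (intro powr_mono2') auto
    then show ?thesis unfolding z(3) using q by simp
  qed
  then show ?case using Suc by (simp add: diff_divide_distrib add.commute)
qed

text \<open>
  The distance of two indices as a natural number: by truncation, one of the two differences is 0.
\<close>
definition index_dist :: "nat \<Rightarrow> nat \<Rightarrow> nat" where "index_dist i j = (i - j) + (j - i)"

lemma sum_index_dist_le:
  fixes f :: "nat \<Rightarrow> real"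
  assumes "i < l" "\<And>m. f m \<ge> 0"
  shows "(\<Sum>j<l. f (index_dist i j)) \<le> 2 * (\<Sum>m<l. f m)"
proof -
  have l: "{..<l} = {..i} \<union> {i<..<l}" using assms(1) by auto
  have "(\<Sum>j<l. f (index_dist i j)) = (\<Sum>j\<le>i. f (index_dist i j)) + (\<Sum>j\<in>{i<..<l}. f (index_dist i j))"
    unfolding l by (rule sum.union_disjoint) auto
  moreover have "(\<Sum>j\<le>i. f (index_dist i j)) = (\<Sum>m\<le>i. f m)"
    by (rule sum.reindex_bij_witness[of _ "\<lambda>m. i - m" "\<lambda>j. i - j"]) (auto simp: index_dist_def)
  moreover have "(\<Sum>m\<le>i. f m) \<le> (\<Sum>m<l. f m)" using assms by (intro sum_mono2) auto
  moreover have "(\<Sum>j\<in>{i<..<l}. f (index_dist i j)) = (\<Sum>m\<in>{0<..<l-i}. f m)"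
    by (rule sum.reindex_bij_witness[of _ "\<lambda>m. i + m" "\<lambda>j. j - i"]) (auto simp: index_dist_def)
  moreover have "(\<Sum>m\<in>{0<..<l-i}. f m) \<le> (\<Sum>m<l. f m)" using assms by (intro sum_mono2) auto
  ultimately show ?thesis by simp
qed

lemma sum_index_dist_ge:
  fixes f :: "nat \<Rightarrow> real"
  assumes "i < n" "\<And>m. f m \<ge> 0"
  shows "(\<Sum>m<Suc i. f m) \<le> (\<Sum>j<n. f (index_dist i j))"
proof -
  have "(\<Sum>m<Suc i. f m) = (\<Sum>j<Suc i. f (index_dist i j))"
    by (rule sum.reindex_bij_witness[of _ "\<lambda>m. i - m" "\<lambda>j. i - j"]) (auto simp: index_dist_def)
  also have "\<dots> \<le> (\<Sum>j<n. f (index_dist i j))" using assms by (intro sum_mono2) auto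
  finally show ?thesis .
qed

lemma sum_inverse_Suc: "(\<Sum>m<n. 1 / (real m + 1)) = harm n"
  by (induction n) (simp_all add: harm_Suc field_simps harm_expand(1))

lemma harm_le_ln: "n \<ge> 1 \<Longrightarrow> harm n \<le> ln (real n) + 1"
proof (induction n rule: nat_induct_at_least)
  case base then show ?case by (simp add: harm_expand)
next
  case (Suc n)
  have n: "real n > 0" using Suc by simp
  have "ln (1 + - (1 / (real n + 1))) \<le> - (1 / (real n + 1))"
    using n by (intro ln_add_one_self_le_self2) simp
  moreover have "1 + - (1 / (real n + 1)) = real n / (real n + 1)" using n by (simp add: field_simps)
  ultimately have "1 / (real n + 1) \<le> ln (real n + 1) - ln (real n)" using n by (simp add: ln_div)
  then show ?case using Suc by (simp add: harm_Suc inverse_eq_divide add.commute)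
qed

lemma ln_ge_half: "n \<ge> 1 \<Longrightarrow> ln (real n + 1) \<ge> 1 / 2"
proof -
  assume "n \<ge> 1"
  have "1/2 \<le> ln (2::real)" using ln2_ge_two_thirds by simp
  also have "\<dots> \<le> ln (real n + 1)" using \<open>n \<ge> 1\<close> by simp
  finally show ?thesis .
qed

lemma sum_ln_ge: "(\<Sum>i<n. ln (real i + 2)) \<ge> real n / 2 * ln (real n + 1)"
proof (induction n)
  case 0 then show ?case by simp
next
  case (Suc n)
  have l: "ln (real n + 2) - ln (real n + 1) \<le> 1 / (real n + 1)"
    using ln_diff_le[of "real n + 2" "real n + 1"] by simp
  have "real n / 2 * (ln (real n + 2) - ln (real n + 1)) \<le> real n / 2 * (1 / (real n + 1))"
    by (intro mult_left_mono l) auto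
  also have "\<dots> \<le> 1/2 * ln (real n + 2)"
  proof (cases "n = 0")
    case False
    have "1 - 1 / (real n + 2) \<le> ln (real n + 2)"
      using ln_add_one_self_le_self2[of "1 / (real n + 2) - 1"]
      by (simp add: ln_div)
    moreover have "real n / (real n + 1) \<le> 1 - 1 / (real n + 2)" by (simp add: field_simps)
    ultimately have "real n / (real n + 1) \<le> ln (real n + 2)" by linarith
    then show ?thesis using mult_left_mono[of "real n / (real n + 1)" "ln (real n + 2)" "1/2"] by (simp add: field_simps)
  qed simp
  finally show ?case using Suc by (simp add: field_simps)
qed

text \<open>
  Growth of the sums that govern the quadratic variation. \<open>\<Lambda>\<close> is 1 for \<open>H < 3/4\<close> and \<open>ln (n + 1)\<close> for
  \<open>H = 3/4\<close>; the sum of squares of the noise covariance over \<open>i, j < n\<close> is of order \<open>n \<Lambda> n\<close>. \<open>P n\<close> bounds both the row sums of the noise covariance and the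
  squared norm of the vector in the error term, and is smaller than \<open>sqrt (n \<Lambda> n)\<close> by a factor
  \<open>sqrt (ln n)\<close>. The last fact is where \<open>H \<le> 3/4\<close> enters; at \<open>3/4\<close> both of its sides have the same order.
\<close>
lemma fgn_scale:
  assumes H: "0 < H" "H \<le> 3/4"
  obtains \<Lambda> P :: "nat \<Rightarrow> real" and c D :: real where
    "c > 0" "D > 0" "\<And>n. n \<ge> 1 \<Longrightarrow> \<Lambda> n > 0" "\<And>n. P n \<ge> 0"
    "\<And>k l. k \<ge> 1 \<Longrightarrow> l \<ge> 1 \<Longrightarrow> \<Lambda> l \<le> 2 * ln (real l + 1) * \<Lambda> k"
    "\<And>n. (\<Sum>m<n. \<bar>fgn H m\<bar>) \<le> P n"
    "\<And>n. (\<Sum>m<n. ((real m + 1) powr (H - 1))\<^sup>2) \<le> P n"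
    "\<And>n. n \<ge> 1 \<Longrightarrow> (\<Sum>m<n. (fgn H m)\<^sup>2) \<le> D * \<Lambda> n"
    "\<And>n. (\<Sum>i<n. \<Sum>j<n. (fgn H (index_dist i j))\<^sup>2) \<ge> c * (real n * \<Lambda> n)"
    "\<And>n. n \<ge> 1 \<Longrightarrow> (P n)\<^sup>2 * ln (real n + 1) \<le> D * (real n * \<Lambda> n)"
proof -
  \<comment> \<open>replacing \<open>H\<close> by a larger exponent above 1/2 makes all partial sums genuine powers, without a case distinction at 1/2\<close>
  define K where "K = max H (5/8)"
  have K: "H \<le> K" "5/8 \<le> K" "K \<le> 3/4" "H < 3/4 \<Longrightarrow> K < 3/4" "H = 3/4 \<Longrightarrow> K = 3/4" using H by (auto simp: K_def)
  define P where "P n = 36 * real n powr (2 * K - 1)" for n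
  have P0: "P n \<ge> 0" for n by (simp add: P_def)
  have HK: "(real m + 1) powr (2 * H - 2) \<le> (real m + 1) powr (2 * K - 2)" for m
    using K by (intro powr_mono) auto
  have sK: "(\<Sum>m<n. (real m + 1) powr (2 * K - 2)) \<le> 4 * real n powr (2 * K - 1)" for n
  proof -
    have "(\<Sum>m<n. (real m + 1) powr (2 * K - 2)) \<le> real n powr (2 * K - 1) / (2 * K - 1)"
      using sum_powr_le[of "2 * K - 1" n] K by simp
    also have "\<dots> \<le> real n powr (2 * K - 1) / (1/4)" using K by (intro divide_left_mono) auto
    finally show ?thesis by simp
  qed
  have P1: "(\<Sum>m<n. \<bar>fgn H m\<bar>) \<le> P n" for n
  proof -
    have "(\<Sum>m<n. \<bar>fgn H m\<bar>) \<le> (\<Sum>m<n. 9 * (real m + 1) powr (2 * K - 2))"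
      using H HK by (intro sum_mono order_trans[OF abs_fgn_le]) auto
    also have "\<dots> \<le> P n" using sK[of n] by (simp add: P_def sum_distrib_left[symmetric])
    finally show ?thesis .
  qed
  have P2: "(\<Sum>m<n. ((real m + 1) powr (H - 1))\<^sup>2) \<le> P n" for n
  proof -
    have "(\<Sum>m<n. ((real m + 1) powr (H - 1))\<^sup>2) \<le> (\<Sum>m<n. (real m + 1) powr (2 * K - 2))"
      using HK by (intro sum_mono) (simp add: power2_eq_square powr_add[symmetric] algebra_simps)
    also have "\<dots> \<le> P n" using sK[of n] by (simp add: P_def) (smt (verit) powr_ge_zero)
    finally show ?thesis .
  qed
  have fs: "(fgn H m)\<^sup>2 \<le> 81 * (real m + 1) powr (4 * H - 4)" for m
  proof -
    have "(fgn H m)\<^sup>2 \<le> (9 * (real m + 1) powr (2 * H - 2))\<^sup>2"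
      using abs_fgn_le[of H m] H by (intro abs_le_square_iff[THEN iffD1]) auto
    also have "\<dots> = 81 * (real m + 1) powr (4 * H - 4)"
      by (simp add: power2_eq_square powr_add[symmetric] algebra_simps)
    finally show ?thesis .
  qed
  show ?thesis
  proof (cases "H < 3/4")
    case True
    have "summable (\<lambda>n. real n powr (4 * H - 4))" using True by (subst summable_real_powr_iff) simp
    then have "summable (\<lambda>m. real (Suc m) powr (4 * H - 4))" by (subst summable_Suc_iff)
    then have su: "summable (\<lambda>m. (real m + 1) powr (4 * H - 4))" by (simp add: add.commute)
    define \<epsilon> where "\<epsilon> = 3 - 4 * K"
    have \<epsilon>: "\<epsilon> > 0" using K(4)[OF True] by (simp add: \<epsilon>_def)
    define D where "D = 81 * (\<Sum>m. (real m + 1) powr (4 * H - 4)) + 1 + 1296 * (2 powr \<epsilon> / \<epsilon>)"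
    have s0: "0 \<le> (\<Sum>m. (real m + 1) powr (4 * H - 4))" by (intro suminf_nonneg su) auto
    have e0: "0 \<le> 2 powr \<epsilon> / \<epsilon>" using \<epsilon> by simp
    have D: "D > 0" unfolding D_def using s0 e0 by linarith
    show ?thesis
    proof (rule that[of 1 D "\<lambda>_. 1" P])
      fix n
      have "(\<Sum>m<n. (fgn H m)\<^sup>2) \<le> 81 * (\<Sum>m<n. (real m + 1) powr (4 * H - 4))"
        unfolding sum_distrib_left by (intro sum_mono fs)
      also have "\<dots> \<le> 81 * (\<Sum>m. (real m + 1) powr (4 * H - 4))"
        by (intro mult_left_mono sum_le_suminf su) auto
      also have "\<dots> \<le> D * 1" unfolding D_def mult_1_right using e0 by linarith
      finally show "(\<Sum>m<n. (fgn H m)\<^sup>2) \<le> D * 1" .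
      have "real n = (\<Sum>i<n. 1)" by simp
      also have "\<dots> \<le> (\<Sum>i<n. \<Sum>j<n. (fgn H (index_dist i j))\<^sup>2)"
      proof (rule sum_mono)
        fix i assume "i \<in> {..<n}"
        then have "(\<Sum>m<Suc i. (fgn H m)\<^sup>2) \<le> (\<Sum>j<n. (fgn H (index_dist i j))\<^sup>2)" by (intro sum_index_dist_ge) auto
        moreover have "(fgn H 0)\<^sup>2 \<le> (\<Sum>m<Suc i. (fgn H m)\<^sup>2)" by (rule member_le_sum) auto
        ultimately show "1 \<le> (\<Sum>j<n. (fgn H (index_dist i j))\<^sup>2)" by (simp add: fgn_def)
      qed
      finally show "1 * (real n * 1) \<le> (\<Sum>i<n. \<Sum>j<n. (fgn H (index_dist i j))\<^sup>2)" by simp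
    next
      fix n :: nat assume n: "n \<ge> 1"
      have "ln (real n + 1) \<le> (real n + 1) powr \<epsilon> / \<epsilon>" using \<epsilon> by (intro ln_powr_bound) auto
      also have "\<dots> \<le> (2 * real n) powr \<epsilon> / \<epsilon>" using \<epsilon> n by (intro divide_right_mono powr_mono2) auto
      finally have l: "ln (real n + 1) \<le> 2 powr \<epsilon> / \<epsilon> * real n powr \<epsilon>" using n by (simp add: powr_mult)
      have "(P n)\<^sup>2 = 1296 * real n powr (4 * K - 2)"
        by (simp add: P_def power2_eq_square powr_add[symmetric] algebra_simps)
      then have "(P n)\<^sup>2 * ln (real n + 1) \<le> 1296 * real n powr (4 * K - 2) * (2 powr \<epsilon> / \<epsilon> * real n powr \<epsilon>)"
        using mult_left_mono[OF l, of "1296 * real n powr (4 * K - 2)"] by simp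
      also have "\<dots> = 1296 * (2 powr \<epsilon> / \<epsilon>) * (real n powr (4 * K - 2) * real n powr \<epsilon>)" by simp
      also have "real n powr (4 * K - 2) * real n powr \<epsilon> = real n" using n by (simp add: powr_add[symmetric] \<epsilon>_def)
      also have "1296 * (2 powr \<epsilon> / \<epsilon>) * real n \<le> D * real n" unfolding D_def using s0 by (intro mult_right_mono) auto
      finally show "(P n)\<^sup>2 * ln (real n + 1) \<le> D * (real n * 1)" by simp
    next
      fix k l :: nat assume "l \<ge> 1"
      then show "1 \<le> 2 * ln (real l + 1) * 1" using ln_ge_half[of l] by simp
    qed (use D P0 P1 P2 in auto)
  next
    case False
    then have H34: "H = 3/4" using H by simp
    have h: "harm n \<le> 3 * ln (real n + 1)" if "n \<ge> 1" for n
    proof -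
      have "harm n \<le> ln (real n) + 1" using harm_le_ln[OF that] by simp
      moreover have "ln (real n) \<le> ln (real n + 1)" using that by simp
      ultimately show ?thesis using ln_ge_half[OF that] by linarith
    qed
    show ?thesis
    proof (rule that[of "9/128" 1296 "\<lambda>n. ln (real n + 1)" P])
      fix n :: nat assume n: "n \<ge> 1"
      have "4 * H - 4 = -1" using H34 by simp
      then have "(\<Sum>m<n. (fgn H m)\<^sup>2) \<le> (\<Sum>m<n. 81 * (1 / (real m + 1)))"
        using fs by (intro sum_mono) (simp add: powr_minus_divide)
      also have "\<dots> = 81 * harm n" unfolding sum_distrib_left[symmetric] sum_inverse_Suc ..
      also have "\<dots> \<le> 1296 * ln (real n + 1)" using h[OF n] ln_ge_half[OF n] by simp
      finally show "(\<Sum>m<n. (fgn H m)\<^sup>2) \<le> 1296 * ln (real n + 1)" .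
      have "2 * K - 1 = 1/2" using K(5)[OF H34] by simp
      then have "(P n)\<^sup>2 = 1296 * real n"
        unfolding P_def by (simp only:) (simp add: power2_eq_square powr_half_sqrt)
      then show "(P n)\<^sup>2 * ln (real n + 1) \<le> 1296 * (real n * ln (real n + 1))" by simp
    next
      fix n
      have "9/128 * (real n * ln (real n + 1)) = (9/64) * (real n / 2 * ln (real n + 1))" by simp
      also have "\<dots> \<le> (9/64) * (\<Sum>i<n. ln (real i + 2))" by (intro mult_left_mono sum_ln_ge) auto
      also have "\<dots> \<le> (\<Sum>i<n. \<Sum>j<n. (fgn H (index_dist i j))\<^sup>2)" unfolding sum_distrib_left
      proof (rule sum_mono)
        fix i assume "i \<in> {..<n}"
        have "(9/64) * ln (real i + 2) \<le> (9/64) * harm (Suc i)"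
          using ln_le_harm[of "Suc i"] by (simp add: add.commute)
        also have "\<dots> = (\<Sum>m<Suc i. (9/64) * (1 / (real m + 1)))" unfolding sum_distrib_left[symmetric] sum_inverse_Suc ..
        also have "\<dots> \<le> (\<Sum>m<Suc i. (fgn H m)\<^sup>2)" unfolding H34 by (intro sum_mono fgn_three_quarters_ge)
        also have "\<dots> \<le> (\<Sum>j<n. (fgn H (index_dist i j))\<^sup>2)" using \<open>i \<in> _\<close> by (intro sum_index_dist_ge) auto
        finally show "(9/64) * ln (real i + 2) \<le> (\<Sum>j<n. (fgn H (index_dist i j))\<^sup>2)" .
      qed
      finally show "9/128 * (real n * ln (real n + 1)) \<le> (\<Sum>i<n. \<Sum>j<n. (fgn H (index_dist i j))\<^sup>2)" .
    next
      fix k l :: nat assume "k \<ge> 1" "l \<ge> 1"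
      then show "ln (real l + 1) \<le> 2 * ln (real l + 1) * ln (real k + 1)"
        using ln_ge_half[of k] ln_ge_half[of l] mult_left_mono[of "1/2" "ln (real k + 1)" "2 * ln (real l + 1)"] by simp
    qed (use P0 P1 P2 in auto)
  qed
qed

section \<open>Normalization of the quadratic variation\<close>

lemma eventually_ge_imp_ge_scaled:
  fixes f g :: "nat \<Rightarrow> real"
  assumes f: "\<And>n. n \<ge> 1 \<Longrightarrow> f n > 0" and g: "\<And>n. n \<ge> 1 \<Longrightarrow> g n > 0"
    and ev: "\<And>n. n \<ge> N \<Longrightarrow> f n \<ge> c * g n" and "c > 0"
  obtains c' where "c' > 0" "\<And>n. n \<ge> 1 \<Longrightarrow> f n \<ge> c' * g n"
proof
  define c' where "c' = Min (insert c ((\<lambda>n. f n / g n) ` {1..N}))"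
  show "c' > 0" unfolding c'_def using f g \<open>c > 0\<close> by (subst Min_gr_iff) auto
  fix n :: nat assume n: "n \<ge> 1"
  show "f n \<ge> c' * g n"
  proof (cases "n \<le> N")
    case True
    then have "c' \<le> f n / g n" unfolding c'_def using n by (intro Min_le) auto
    then show ?thesis using g[OF n] by (simp add: field_simps)
  next
    case False
    have "c' \<le> c" unfolding c'_def by (intro Min_le) auto
    then have "c' * g n \<le> c * g n" using g[OF n] by (intro mult_right_mono) auto
    then show ?thesis using ev[of n] False by linarith
  qed
qed

text \<open>
  The Toeplitz part is bounded by its row sums (Schur test). Row sums may be too large for
  the error part, which is instead treated as a rank-one form by the Cauchy-Schwarz inequality.
\<close>
lemma quadratic_form_le:
  fixes f a :: "nat \<Rightarrow> real"
  assumes dev: "\<And>i j. \<bar>r i j - f (index_dist i j)\<bar> \<le> C * (a i * a j)" and a: "\<And>i. a i \<ge> 0" and C: "C \<ge> 0"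
    and P: "(\<Sum>m<n. \<bar>f m\<bar>) \<le> P" "(\<Sum>m<n. (a m)\<^sup>2) \<le> P"
  shows "(\<Sum>i<n. \<Sum>k<n. r i k * y i * y k) \<le> (2 + C) * P * (\<Sum>i<n. (y i)\<^sup>2)"
proof -
  have "(\<Sum>i<n. \<Sum>k<n. r i k * y i * y k)
     \<le> (\<Sum>i<n. \<Sum>k<n. (\<bar>f (index_dist i k)\<bar> * (y i)\<^sup>2 / 2 + \<bar>f (index_dist i k)\<bar> * (y k)\<^sup>2 / 2) + C * ((a i * \<bar>y i\<bar>) * (a k * \<bar>y k\<bar>)))"
  proof (intro sum_mono)
    fix i k
    have "r i k * y i * y k \<le> \<bar>r i k\<bar> * (\<bar>y i\<bar> * \<bar>y k\<bar>)"
      by (metis abs_ge_self abs_mult mult.assoc)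
    also have "\<dots> \<le> (\<bar>f (index_dist i k)\<bar> + C * (a i * a k)) * (\<bar>y i\<bar> * \<bar>y k\<bar>)"
      using dev[of i k] by (intro mult_right_mono) auto
    also have "\<dots> = \<bar>f (index_dist i k)\<bar> * (\<bar>y i\<bar> * \<bar>y k\<bar>) + C * ((a i * \<bar>y i\<bar>) * (a k * \<bar>y k\<bar>))"
      by (simp add: algebra_simps)
    also have "\<bar>f (index_dist i k)\<bar> * (\<bar>y i\<bar> * \<bar>y k\<bar>) \<le> \<bar>f (index_dist i k)\<bar> * (((y i)\<^sup>2 + (y k)\<^sup>2) / 2)"
      using sum_squares_bound[of "\<bar>y i\<bar>" "\<bar>y k\<bar>"] by (intro mult_left_mono) auto
    finally show "r i k * y i * y k \<le> (\<bar>f (index_dist i k)\<bar> * (y i)\<^sup>2 / 2 + \<bar>f (index_dist i k)\<bar> * (y k)\<^sup>2 / 2) + C * ((a i * \<bar>y i\<bar>) * (a k * \<bar>y k\<bar>))"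
      by (simp add: distrib_left add_divide_distrib)
  qed
  also have "\<dots> = (\<Sum>i<n. \<Sum>k<n. \<bar>f (index_dist i k)\<bar> * (y i)\<^sup>2 / 2) + (\<Sum>i<n. \<Sum>k<n. \<bar>f (index_dist i k)\<bar> * (y k)\<^sup>2 / 2)
     + C * ((\<Sum>i<n. a i * \<bar>y i\<bar>) * (\<Sum>i<n. a i * \<bar>y i\<bar>))"
    unfolding sum.distrib sum_product by (simp add: sum_distrib_left)
  also have "(\<Sum>i<n. \<Sum>k<n. \<bar>f (index_dist i k)\<bar> * (y k)\<^sup>2 / 2) = (\<Sum>i<n. \<Sum>k<n. \<bar>f (index_dist i k)\<bar> * (y i)\<^sup>2 / 2)"
    by (subst sum.swap) (simp add: index_dist_def add.commute)
  also have "(\<Sum>i<n. \<Sum>k<n. \<bar>f (index_dist i k)\<bar> * (y i)\<^sup>2 / 2) \<le> (\<Sum>i<n. (2 * P) * ((y i)\<^sup>2 / 2))"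
  proof (intro sum_mono)
    fix i assume "i \<in> {..<n}"
    then have "(\<Sum>k<n. \<bar>f (index_dist i k)\<bar>) \<le> 2 * P" using sum_index_dist_le[of i n "\<lambda>m. \<bar>f m\<bar>"] P by auto
    then have "(\<Sum>k<n. \<bar>f (index_dist i k)\<bar>) * ((y i)\<^sup>2 / 2) \<le> (2 * P) * ((y i)\<^sup>2 / 2)" by (intro mult_right_mono) auto
    then show "(\<Sum>k<n. \<bar>f (index_dist i k)\<bar> * (y i)\<^sup>2 / 2) \<le> (2 * P) * ((y i)\<^sup>2 / 2)" by (simp only: sum_distrib_right sum_divide_distrib times_divide_eq_right)
  qed
  also have "(\<Sum>i<n. (2 * P) * ((y i)\<^sup>2 / 2)) = P * (\<Sum>i<n. (y i)\<^sup>2)" by (simp add: sum_distrib_left)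
  also have "C * ((\<Sum>i<n. a i * \<bar>y i\<bar>) * (\<Sum>i<n. a i * \<bar>y i\<bar>)) \<le> C * (P * (\<Sum>i<n. (y i)\<^sup>2))"
  proof (rule mult_left_mono[OF _ C])
    have "(\<Sum>i<n. a i * \<bar>y i\<bar>)\<^sup>2 \<le> (\<Sum>i<n. (a i)\<^sup>2) * (\<Sum>i<n. \<bar>y i\<bar>\<^sup>2)" by (rule Cauchy_Schwarz_ineq_sum)
    also have "\<dots> \<le> P * (\<Sum>i<n. (y i)\<^sup>2)" using P by (auto intro!: mult_right_mono sum_nonneg)
    finally show "(\<Sum>i<n. a i * \<bar>y i\<bar>) * (\<Sum>i<n. a i * \<bar>y i\<bar>) \<le> P * (\<Sum>i<n. (y i)\<^sup>2)" by (simp add: power2_eq_square)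
  qed
  finally show ?thesis by (simp add: algebra_simps)
qed

text \<open>
  The rate at which the characteristic function of \<open>V\<^sub>k - V\<^sub>l\<close>, for \<open>k \<le> l\<close>, approaches that of a centered
  normal variable of variance 2.
\<close>
definition pair_rate :: "nat \<Rightarrow> nat \<Rightarrow> real" where
  "pair_rate k l = 1 / sqrt (ln (real k + 1)) + sqrt (real k / real l) * sqrt (ln (real l + 1))"

text \<open>
  The error matrix \<open>e\<close> has Hilbert-Schmidt norm at most \<open>C P n\<close>, which is of smaller order than
  \<open>sqrt (n \<Lambda> n)\<close>; so \<open>S n\<close> is eventually at least a constant times \<open>n \<Lambda> n\<close>, and the positivity of \<open>S\<close>
  extends this to all \<open>n \<ge> 1\<close> at the price of a smaller constant. Both conclusions follow by
  comparing the bounds of \<open>fgn_scale\<close> with this lower bound.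
\<close>
lemma quad_var_scale:
  fixes r :: "nat \<Rightarrow> nat \<Rightarrow> real" and S :: "nat \<Rightarrow> real"
  assumes H: "0 < H" "H \<le> 3/4" and C: "C \<ge> 0"
    and dev: "\<And>i j. \<bar>r i j - fgn H (index_dist i j)\<bar> \<le> C * ((real i + 1) powr (H - 1) * (real j + 1) powr (H - 1))"
    and S: "\<And>n. S n = 2 * (\<Sum>i<n. \<Sum>j<n. (r i j)\<^sup>2)"
    and pos: "\<And>n. n \<ge> 1 \<Longrightarrow> S n > 0"
  obtains K where "K > 0"
    "\<And>n y. n \<ge> 1 \<Longrightarrow> (\<Sum>i<n. \<Sum>k<n. r i k * y i * y k) \<le> K * sqrt (S n) / sqrt (ln (real n + 1)) * (\<Sum>i<n. (y i)\<^sup>2)"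
    "\<And>k l. 1 \<le> k \<Longrightarrow> k \<le> l \<Longrightarrow> 2 * (\<Sum>i<k. \<Sum>j<l. (r i j)\<^sup>2)
        \<le> K * pair_rate k l * (sqrt (S k) * sqrt (S l))"
proof -
  define a where "a i = (real i + 1) powr (H - 1)" for i :: nat
  define L where "L n = ln (real n + 1)" for n :: nat
  define e where "e i j = r i j - fgn H (index_dist i j)" for i j
  have L: "L n \<ge> 1/2" if "n \<ge> 1" for n using ln_ge_half[OF that] by (simp add: L_def)
  have a0: "a i \<ge> 0" for i by (simp add: a_def)
  have e: "\<bar>e i j\<bar> \<le> C * (a i * a j)" for i j using dev by (simp add: e_def a_def)
  obtain \<Lambda> P :: "nat \<Rightarrow> real" and c D :: real where sc:
    "c > 0" "D > 0" "\<And>n. n \<ge> 1 \<Longrightarrow> \<Lambda> n > 0" "\<And>n. P n \<ge> 0"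
    "\<And>k l. k \<ge> 1 \<Longrightarrow> l \<ge> 1 \<Longrightarrow> \<Lambda> l \<le> 2 * ln (real l + 1) * \<Lambda> k"
    "\<And>n. (\<Sum>m<n. \<bar>fgn H m\<bar>) \<le> P n"
    "\<And>n. (\<Sum>m<n. ((real m + 1) powr (H - 1))\<^sup>2) \<le> P n"
    "\<And>n. n \<ge> 1 \<Longrightarrow> (\<Sum>m<n. (fgn H m)\<^sup>2) \<le> D * \<Lambda> n"
    "\<And>n. (\<Sum>i<n. \<Sum>j<n. (fgn H (index_dist i j))\<^sup>2) \<ge> c * (real n * \<Lambda> n)"
    "\<And>n. n \<ge> 1 \<Longrightarrow> (P n)\<^sup>2 * ln (real n + 1) \<le> D * (real n * \<Lambda> n)"
    by (rule fgn_scale[OF H], rule that, assumption+)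
  have aP: "(\<Sum>m<n. (a m)\<^sup>2) \<le> P n" for n using sc(7) by (simp add: a_def)
  have e2: "(\<Sum>i<k. \<Sum>j<l. (e i j)\<^sup>2) \<le> C\<^sup>2 * (P k * P l)" for k l
  proof -
    have "(\<Sum>i<k. \<Sum>j<l. (e i j)\<^sup>2) \<le> (\<Sum>i<k. \<Sum>j<l. (C * (a i * a j))\<^sup>2)"
    proof (intro sum_mono)
      fix i j show "(e i j)\<^sup>2 \<le> (C * (a i * a j))\<^sup>2" using e[of i j] by (metis abs_ge_zero power2_abs power_mono)
    qed
    also have "\<dots> = C\<^sup>2 * ((\<Sum>i<k. (a i)\<^sup>2) * (\<Sum>j<l. (a j)\<^sup>2))"
      unfolding sum_product by (simp add: power_mult_distrib sum_distrib_left)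
    also have "\<dots> \<le> C\<^sup>2 * (P k * P l)" by (intro mult_left_mono mult_mono aP sc(4) sum_nonneg) auto
    finally show ?thesis .
  qed
  \<comment> \<open>the order of magnitude of the variance\<close>
  define Q where "Q n = real n * \<Lambda> n" for n
  have Q: "Q n > 0" if "n \<ge> 1" for n using sc(3)[OF that] that by (simp add: Q_def)
  have lower: "c * Q n \<le> S n + 2 * C\<^sup>2 * (P n)\<^sup>2" for n
  proof -
    have "c * Q n \<le> (\<Sum>i<n. \<Sum>j<n. (fgn H (index_dist i j))\<^sup>2)" using sc(9) by (simp add: Q_def)
    also have "\<dots> \<le> (\<Sum>i<n. \<Sum>j<n. 2 * (r i j)\<^sup>2 + 2 * (e i j)\<^sup>2)"
    proof (intro sum_mono)
      fix i j
      show "(fgn H (index_dist i j))\<^sup>2 \<le> 2 * (r i j)\<^sup>2 + 2 * (e i j)\<^sup>2"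
        using zero_le_power2[of "r i j + e i j"] by (simp add: e_def power2_eq_square algebra_simps)
    qed
    also have "\<dots> = S n + 2 * (\<Sum>i<n. \<Sum>j<n. (e i j)\<^sup>2)" by (simp add: S sum.distrib sum_distrib_left)
    also have "\<dots> \<le> S n + 2 * (C\<^sup>2 * (P n * P n))" using e2[of n n] by simp
    finally show ?thesis by (simp add: power2_eq_square mult.assoc)
  qed
  have "filterlim (\<lambda>n. ln (real n + 1)) at_top sequentially"
    using filterlim_compose[OF ln_at_top filterlim_compose[OF filterlim_real_sequentially filterlim_Suc]]
    by (simp add: add.commute)
  then have "\<forall>\<^sub>F n in sequentially. L n \<ge> 4 * C\<^sup>2 * D / c"
    unfolding L_def filterlim_at_top by blast
  then obtain N where N: "\<And>n. n \<ge> N \<Longrightarrow> L n \<ge> 4 * C\<^sup>2 * D / c" unfolding eventually_sequentially by blast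
  have lo: "S n \<ge> (c / 2) * Q n" if n: "n \<ge> max N 1" for n
  proof -
    have n1: "n \<ge> 1" and nN: "n \<ge> N" using n by auto
    have Lp: "L n > 0" using L[OF n1] by simp
    have "(P n)\<^sup>2 \<le> D * Q n / L n" using sc(10)[OF n1] Lp by (simp add: Q_def L_def field_simps)
    then have "2 * C\<^sup>2 * (P n)\<^sup>2 \<le> 2 * C\<^sup>2 * (D * Q n / L n)" by (intro mult_left_mono) auto
    also have "\<dots> = (2 * C\<^sup>2 * D / L n) * Q n" by simp
    also have "\<dots> \<le> (c / 2) * Q n"
      using N[OF nN] Lp sc(1) Q[OF n1] by (intro mult_right_mono) (auto simp: field_simps)
    finally show ?thesis using lower[of n] by (simp add: field_simps)
  qed
  have half: "c / 2 > 0" using sc(1) by simp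
  obtain c' where c': "c' > 0" "\<And>n. n \<ge> 1 \<Longrightarrow> S n \<ge> c' * Q n"
    by (rule eventually_ge_imp_ge_scaled[OF pos Q lo half], assumption, assumption, assumption, rule that, assumption+)
  define K1 where "K1 = sqrt (D / c')"
  have K1: "K1 \<ge> 0" using sc c' by (simp add: K1_def)
  have PS: "P n \<le> K1 * sqrt (S n) / sqrt (L n)" if n: "n \<ge> 1" for n
  proof -
    have Lp: "L n > 0" using L[OF n] by simp
    have "(P n)\<^sup>2 * L n \<le> D * Q n" using sc(10)[OF n] by (simp add: Q_def L_def)
    also have "\<dots> \<le> D * (S n / c')" using c'(2)[OF n] c'(1) sc(2) by (intro mult_left_mono) (auto simp: field_simps)
    finally have "(P n)\<^sup>2 \<le> D * (S n / c') / L n" using Lp by (simp only: pos_le_divide_eq)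
    then have "(P n)\<^sup>2 \<le> D / c' * S n / L n" by simp
    then have "P n \<le> sqrt (D / c' * S n / L n)" by (rule real_le_rsqrt)
    then show ?thesis by (simp add: K1_def real_sqrt_mult real_sqrt_divide)
  qed
  define K where "K = 1 + (2 + C) * K1 + 8 * D * sqrt 2 / c' + 8 * C\<^sup>2 * K1\<^sup>2"
  have Kp: "(2 + C) * K1 \<ge> 0" "8 * D * sqrt 2 / c' \<ge> 0" "8 * C\<^sup>2 * K1\<^sup>2 \<ge> 0"
    using K1 C sc(2) c'(1) by auto
  show ?thesis
  proof
    show "K > 0" unfolding K_def using Kp by linarith
  next
    fix n :: nat and y :: "nat \<Rightarrow> real" assume n: "n \<ge> 1"
    have "(\<Sum>i<n. \<Sum>k<n. r i k * y i * y k) \<le> (2 + C) * P n * (\<Sum>i<n. (y i)\<^sup>2)"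
      using e unfolding e_def by (intro quadratic_form_le[where f="fgn H" and a=a] a0 C sc(6) aP)
    also have "\<dots> \<le> K * sqrt (S n) / sqrt (ln (real n + 1)) * (\<Sum>i<n. (y i)\<^sup>2)"
    proof (intro mult_right_mono sum_nonneg)
      have "(2 + C) * P n \<le> (2 + C) * (K1 * sqrt (S n) / sqrt (L n))" using PS[OF n] C by (intro mult_left_mono) auto
      also have "\<dots> = ((2 + C) * K1) * (sqrt (S n) / sqrt (L n))" by simp
      also have "\<dots> \<le> K * (sqrt (S n) / sqrt (L n))"
        using pos[OF n] L[OF n] Kp unfolding K_def by (intro mult_right_mono) auto
      finally show "(2 + C) * P n \<le> K * sqrt (S n) / sqrt (ln (real n + 1))" by (simp add: L_def)
    qed auto
    finally show "(\<Sum>i<n. \<Sum>k<n. r i k * y i * y k) \<le> K * sqrt (S n) / sqrt (ln (real n + 1)) * (\<Sum>i<n. (y i)\<^sup>2)" .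
  next
    fix k l :: nat assume k: "1 \<le> k" and kl: "k \<le> l"
    then have l: "1 \<le> l" by simp
    define A where "A = sqrt (real k / real l) * sqrt (L l)"
    define B where "B = 1 / sqrt (L k)"
    define T where "T = sqrt (S k) * sqrt (S l)"
    have T: "T \<ge> 0" using pos[OF k] pos[OF l] by (simp add: T_def)
    have AB: "A \<ge> 0" "B \<ge> 0" using L[OF k] L[OF l] by (auto simp: A_def B_def)
    have "2 * (\<Sum>i<k. \<Sum>j<l. (r i j)\<^sup>2) \<le> (\<Sum>i<k. \<Sum>j<l. 4 * (fgn H (index_dist i j))\<^sup>2 + 4 * (e i j)\<^sup>2)"
      unfolding sum_distrib_left
    proof (intro sum_mono)
      fix i j
      show "2 * (r i j)\<^sup>2 \<le> 4 * (fgn H (index_dist i j))\<^sup>2 + 4 * (e i j)\<^sup>2"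
        using zero_le_power2[of "2 * fgn H (index_dist i j) - r i j"] by (simp add: e_def power2_eq_square algebra_simps)
    qed
    also have "\<dots> = 4 * (\<Sum>i<k. \<Sum>j<l. (fgn H (index_dist i j))\<^sup>2) + 4 * (\<Sum>i<k. \<Sum>j<l. (e i j)\<^sup>2)"
      by (simp add: sum.distrib sum_distrib_left)
    also have "\<dots> \<le> 4 * (real k * (2 * (D * \<Lambda> l))) + 4 * (C\<^sup>2 * (P k * P l))"
    proof (intro add_mono mult_left_mono e2)
      have "(\<Sum>i<k. \<Sum>j<l. (fgn H (index_dist i j))\<^sup>2) \<le> (\<Sum>i<k. 2 * (D * \<Lambda> l))"
      proof (intro sum_mono)
        fix i assume "i \<in> {..<k}"
        then show "(\<Sum>j<l. (fgn H (index_dist i j))\<^sup>2) \<le> 2 * (D * \<Lambda> l)"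
          using sum_index_dist_le[of i l "\<lambda>m. (fgn H m)\<^sup>2"] sc(8)[OF l] kl by auto
      qed
      then show "(\<Sum>i<k. \<Sum>j<l. (fgn H (index_dist i j))\<^sup>2) \<le> real k * (2 * (D * \<Lambda> l))" by simp
    qed auto
    also have "4 * (real k * (2 * (D * \<Lambda> l))) \<le> (8 * D * sqrt 2 / c') * A * T"
    proof -
      have \<Lambda>: "\<Lambda> k > 0" "\<Lambda> l > 0" using sc(3) k l by auto
      have "\<Lambda> l = sqrt (\<Lambda> l) * sqrt (\<Lambda> l)" using \<Lambda> by simp
      also have "\<dots> \<le> sqrt (\<Lambda> l) * sqrt (2 * L l * \<Lambda> k)"
        using sc(5)[OF k l] \<Lambda> by (intro mult_left_mono) (auto simp: L_def)
      also have "\<dots> = sqrt 2 * sqrt (L l) * (sqrt (\<Lambda> k) * sqrt (\<Lambda> l))" by (simp add: real_sqrt_mult)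
      finally have "real k * \<Lambda> l \<le> real k * (sqrt 2 * sqrt (L l) * (sqrt (\<Lambda> k) * sqrt (\<Lambda> l)))"
        by (intro mult_left_mono) auto
      also have "\<dots> = sqrt 2 * A * (sqrt (Q k) * sqrt (Q l))"
        using k l by (simp add: A_def Q_def real_sqrt_mult real_sqrt_divide)
      also have "\<dots> \<le> sqrt 2 * A * (T / c')"
      proof (intro mult_left_mono)
        have "c' * (sqrt (Q k) * sqrt (Q l)) = sqrt (c' * Q k) * sqrt (c' * Q l)"
          using c'(1) by (simp add: real_sqrt_mult)
        also have "\<dots> \<le> T" unfolding T_def using c'(2) k l Q pos c'(1)
          by (intro mult_mono real_sqrt_le_mono) (auto intro!: mult_nonneg_nonneg simp: less_imp_le)
        finally show "sqrt (Q k) * sqrt (Q l) \<le> T / c'" using c'(1) by (simp add: field_simps)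
      qed (use AB in auto)
      finally have "(8 * D) * (real k * \<Lambda> l) \<le> (8 * D) * (sqrt 2 * A * (T / c'))" using sc(2) by (intro mult_left_mono) auto
      then show ?thesis by (simp add: mult_ac)
    qed
    also have "4 * (C\<^sup>2 * (P k * P l)) \<le> (8 * C\<^sup>2 * K1\<^sup>2) * B * T"
    proof -
      have sl: "1 / sqrt (L l) \<le> 2" using L[OF l] real_le_rsqrt[of "1/2" "L l"] by (simp add: field_simps power2_eq_square)
      have "P k * P l \<le> (K1 * sqrt (S k) / sqrt (L k)) * (K1 * sqrt (S l) / sqrt (L l))"
        using PS[OF k] PS[OF l] sc(4) order_trans[OF sc(4) PS[OF k]] by (intro mult_mono) auto
      also have "\<dots> = (K1\<^sup>2 * B * T) * (1 / sqrt (L l))" by (simp add: B_def T_def power2_eq_square)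
      also have "\<dots> \<le> (K1\<^sup>2 * B * T) * 2" using AB T by (intro mult_left_mono sl) auto
      finally have "(4 * C\<^sup>2) * (P k * P l) \<le> (4 * C\<^sup>2) * ((K1\<^sup>2 * B * T) * 2)" by (intro mult_left_mono) auto
      then show ?thesis by (simp add: mult_ac)
    qed
    finally have "2 * (\<Sum>i<k. \<Sum>j<l. (r i j)\<^sup>2) \<le> (8 * D * sqrt 2 / c') * A * T + (8 * C\<^sup>2 * K1\<^sup>2) * B * T" by simp
    also have "\<dots> \<le> K * A * T + K * B * T"
      using Kp AB T unfolding K_def by (intro add_mono mult_right_mono) auto
    also have "\<dots> = K * (A + B) * T" by (simp add: algebra_simps)
    finally show "2 * (\<Sum>i<k. \<Sum>j<l. (r i j)\<^sup>2)
        \<le> K * pair_rate k l * (sqrt (S k) * sqrt (S l))"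
      by (simp add: A_def B_def T_def L_def pair_rate_def add.commute)
  qed
qed

section \<open>Covariance of the increments under hypothesis (A)\<close>

lemma differentiable_abs_powr:
  fixes t s p :: real
  assumes "t \<noteq> s"
  shows "(\<lambda>r. \<bar>r - s\<bar> powr p) differentiable (at t)"
proof (cases "s < t")
  case True
  have "((\<lambda>r. (r - s) powr p) has_real_derivative p * (t - s) powr (p - 1)) (at t)"
    using True by (auto intro!: derivative_eq_intros)
  then have "((\<lambda>r. \<bar>r - s\<bar> powr p) has_real_derivative p * (t - s) powr (p - 1)) (at t)"
    by (rule has_field_derivative_transform_within_open[where S="{s<..}"]) (use True in auto)
  then show ?thesis unfolding real_differentiable_def by blast
next
  case False
  then have ts: "t < s" using assms by simp
  have "((\<lambda>r. (s - r) powr p) has_real_derivative - (p * (s - t) powr (p - 1))) (at t)"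
    using ts by (auto intro!: derivative_eq_intros)
  then have "((\<lambda>r. \<bar>r - s\<bar> powr p) has_real_derivative - (p * (s - t) powr (p - 1))) (at t)"
    by (rule has_field_derivative_transform_within_open[where S="{..<s}"]) (use ts in auto)
  then show ?thesis unfolding real_differentiable_def by blast
qed

lemma differentiable_fbm_covariance:
  assumes "t \<noteq> 0" "t \<noteq> s"
  shows "(\<lambda>r. fbm_covariance H r s) differentiable (at t)"
  unfolding fbm_covariance_def
  using differentiable_abs_powr[OF assms(1), of "2 * H"] differentiable_abs_powr[OF assms(2), of "2 * H"]
  by (intro differentiable_divide differentiable_diff differentiable_add) auto

lemma powr_increment_le:
  fixes n :: nat
  assumes "0 < H" "H \<le> 1"
  shows "(real n + 1) powr H - real n powr H \<le> (real n + 1) powr (H - 1)"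
proof (cases "n = 0")
  case True then show ?thesis using assms by simp
next
  case False
  then have n: "real n > 0" by simp
  have "real n * (real n + 1) powr (H - 1) \<le> real n * real n powr (H - 1)"
    using n assms by (intro mult_left_mono powr_mono2') auto
  also have "\<dots> = real n powr H" using n by (simp add: powr_mult_base)
  finally have "real n * (real n + 1) powr (H - 1) \<le> real n powr H" .
  moreover have "(real n + 1) powr H = (real n + 1) * (real n + 1) powr (H - 1)"
    using n by (simp add: powr_mult_base)
  ultimately show ?thesis by (simp add: algebra_simps)
qed

lemma fbm_increment_covariance:
  "fbm_covariance H (real i + 1) (real j + 1) - fbm_covariance H (real i + 1) (real j)
    - (fbm_covariance H (real i) (real j + 1) - fbm_covariance H (real i) (real j)) = fgn H (index_dist i j)"
proof (cases "j \<le> i")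
  case True
  then obtain m where m: "i = j + m" using le_Suc_ex by blast
  then have "index_dist i j = m" by (simp add: index_dist_def)
  then show ?thesis using m by (simp add: fbm_covariance_def fgn_def field_simps)
next
  case False
  then obtain m where m: "j = i + m" using le_Suc_ex nat_le_linear by blast
  then have "index_dist i j = m" by (simp add: index_dist_def)
  moreover have "\<bar>1 - real m\<bar> = \<bar>real m - 1\<bar>" by simp
  ultimately show ?thesis using m by (simp add: fbm_covariance_def fgn_def field_simps)
qed

text \<open>
  Mean value inequality against the primitive \<open>K / H * x powr H\<close>. It needs the derivative only inside
  the interval, so it covers the interval starting at 0, where \<open>x powr (H - 1)\<close> is unbounded.
\<close>
lemma powr_dominated_increment:
  fixes f f' :: "real \<Rightarrow> real" and n :: nat
  assumes H: "0 < H" "H < 1" and K: "K \<ge> 0"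
    and cont: "continuous_on {real n..real n + 1} f"
    and deriv: "\<And>x. real n < x \<Longrightarrow> x < real n + 1 \<Longrightarrow> (f has_real_derivative f' x) (at x)"
    and bound: "\<And>x. real n < x \<Longrightarrow> x < real n + 1 \<Longrightarrow> \<bar>f' x\<bar> \<le> K * x powr (H - 1)"
  shows "\<bar>f (real n + 1) - f (real n)\<bar> \<le> K / H * (real n + 1) powr (H - 1)"
proof -
  define g where "g x = K / H * x powr H" for x
  have "norm (f (real n + 1) - f (real n)) \<le> g (real n + 1) - g (real n)"
  proof (rule differentiable_bound_general[where f'=f' and \<phi>'="\<lambda>x. K * x powr (H - 1)"])
    show "continuous_on {real n..real n + 1} g" unfolding g_def
      using H by (intro continuous_intros continuous_on_powr') auto
    fix x assume x: "real n < x" "x < real n + 1"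
    show "(f has_vector_derivative f' x) (at x)"
      using deriv[OF x] by (simp add: has_real_derivative_iff_has_vector_derivative)
    have "(g has_real_derivative K * x powr (H - 1)) (at x)" unfolding g_def
      using x H by (auto intro!: derivative_eq_intros)
    then show "(g has_vector_derivative K * x powr (H - 1)) (at x)"
      by (simp add: has_real_derivative_iff_has_vector_derivative)
    show "norm (f' x) \<le> K * x powr (H - 1)" using bound[OF x] by simp
  qed (use cont in auto)
  also have "\<dots> = K / H * ((real n + 1) powr H - real n powr H)" by (simp add: g_def right_diff_distrib)
  also have "\<dots> \<le> K / H * (real n + 1) powr (H - 1)"
    using H K by (intro mult_left_mono powr_increment_le) auto
  finally show ?thesis by simp
qed

text \<open>
  The mean value inequality is used twice: in \<open>s\<close> for the function \<open>partial_diff R H t\<close>, whose derivative is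
  dominated by hypothesis, and then in \<open>t\<close> for the difference between the \<open>s\<close>-increments of \<open>R\<close> and
  \<open>R\<^sup>B\<close>. Inside \<open>(i, i + 1)\<close> the variable \<open>t\<close> never meets the integers \<open>j\<close> and \<open>j + 1\<close>, so both
  partial derivatives exist there.
\<close>
lemma increment_covariance_bound:
  assumes A: "hypothesis_A H R" and H: "0 < H" "H < 1" and sym: "\<And>t s. R t s = R s t"
  obtains C where "C \<ge> 0"
    "\<And>i j. \<bar>(R (real i + 1) (real j + 1) - R (real i + 1) (real j) - (R (real i) (real j + 1) - R (real i) (real j)))
        - fgn H (index_dist i j)\<bar> \<le> C * ((real i + 1) powr (H - 1) * (real j + 1) powr (H - 1))"
proof -
  from A[unfolded hypothesis_A_def] obtain C0 where C0: "C0 \<ge> 0" and AT: "\<forall>T>0.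
     (\<forall>s\<ge>0. R 0 s = 0) \<and>
     (\<forall>s\<in>{0<..<T}.
        continuous_on {0..T} (\<lambda>t. R t s) \<and>
        (\<lambda>t. R t s) differentiable_on ({0<..<s} \<union> {s<..<T}) \<and>
        (\<lambda>t. deriv (\<lambda>r. R r s) t) absolutely_integrable_on ({0<..<s} \<union> {s<..<T})) \<and>
     (\<forall>t\<in>{0<..<T}.
        continuous_on {0..T} (partial_diff R H t) \<and>
        partial_diff R H t differentiable_on {0<..<T} \<and>
        (\<forall>s\<in>{0<..<T}. \<bar>deriv (partial_diff R H t) s\<bar> \<le> C0 * \<bar>t * s\<bar> powr (H - 1)))"
    by (elim exE conjE) (rule that)
  have zero: "R t 0 = 0" if "t \<ge> 0" for t using AT[THEN spec[of _ 1]] sym[of t 0] that by simp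
  show ?thesis
  proof
    show "C0 / H / H \<ge> 0" using C0 H by simp
    fix i j :: nat
    \<comment> \<open>any horizon beyond both unit intervals\<close>
    define T where "T = real (i + j + 3)"
    have T: "T > 0" "real i + 1 < T" "real j + 1 < T" by (auto simp: T_def)
    note AT = AT[THEN spec, THEN mp, OF T(1)]
    define aj where "aj = (real j + 1) powr (H - 1)"
    have contR: "continuous_on {real i..real i + 1} (\<lambda>t. R t (real k))" if k: "real k < T" for k :: nat
    proof (cases "k = 0")
      case True
      have "continuous_on {real i..real i + 1} (\<lambda>t. 0::real)" by simp
      then show ?thesis by (rule continuous_on_eq) (auto simp: True zero)
    next
      case False
      then have "continuous_on {0..T} (\<lambda>t. R t (real k))" using AT k by simp
      then show ?thesis by (rule continuous_on_subset) (use T in auto)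
    qed
    have diffR: "(\<lambda>r. R r (real k)) differentiable (at t)"
      if k: "real k < T" and t: "real i < t" "t < real i + 1" for k :: nat and t
    proof (cases "k = 0")
      case True
      have "((\<lambda>r. 0) has_real_derivative 0) (at t)" by simp
      then have "((\<lambda>r. R r 0) has_real_derivative 0) (at t)"
        by (rule has_field_derivative_transform_within_open[where S="{0<..}"]) (use t in \<open>auto simp: zero\<close>)
      then show ?thesis unfolding real_differentiable_def True of_nat_0 by blast
    next
      case False
      have tk: "t \<noteq> real k"
      proof
        assume "t = real k"
        then have "real i < real k" "real k < real (i + 1)" using t by auto
        then show False unfolding of_nat_less_iff by simp
      qed
      have o: "open ({0<..<real k} \<union> {real k<..<T})" by auto
      have "(\<lambda>r. R r (real k)) differentiable_on ({0<..<real k} \<union> {real k<..<T})" using AT k False by simp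
      moreover have "t \<in> {0<..<real k} \<union> {real k<..<T}" using t tk T by auto
      ultimately show ?thesis using o by (simp add: differentiable_on_eq_differentiable_at)
    qed
    define E where "E t = (R t (real j + 1) - fbm_covariance H t (real j + 1)) - (R t (real j) - fbm_covariance H t (real j))" for t
    define E' where "E' t = partial_diff R H t (real j + 1) - partial_diff R H t (real j)" for t
    have "\<bar>E (real i + 1) - E (real i)\<bar> \<le> (C0 / H * aj) / H * (real i + 1) powr (H - 1)"
    proof (rule powr_dominated_increment[OF H, where f'=E'])
      show "0 \<le> C0 / H * aj" using C0 H by (simp add: aj_def)
      have contB: "continuous_on {real i..real i + 1} (\<lambda>t. fbm_covariance H t s)" for s
        unfolding fbm_covariance_def using H by (intro continuous_intros continuous_on_powr') auto
      show "continuous_on {real i..real i + 1} E"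
        unfolding E_def using contR[of j] contR[of "j + 1"] T contB
        by (intro continuous_on_diff) (auto simp: add.commute)
      fix t assume t: "real i < t" "t < real i + 1"
      have t0: "t > 0" using t by linarith
      have tn: "t \<noteq> real k" for k :: nat
      proof
        assume "t = real k"
        then have "real i < real k" "real k < real (i + 1)" using t by auto
        then show False unfolding of_nat_less_iff by simp
      qed
      have d: "((\<lambda>r. R r (real k) - fbm_covariance H r (real k)) has_real_derivative partial_diff R H t (real k)) (at t)"
        if k: "real k < T" for k :: nat
      proof -
        have "((\<lambda>r. R r (real k)) has_real_derivative deriv (\<lambda>r. R r (real k)) t) (at t)"
          using diffR[OF k t] by (simp add: DERIV_deriv_iff_real_differentiable)
        moreover have "((\<lambda>r. fbm_covariance H r (real k)) has_real_derivative deriv (\<lambda>r. fbm_covariance H r (real k)) t) (at t)"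
          using differentiable_fbm_covariance[of t "real k" H] t0 tn by (simp add: DERIV_deriv_iff_real_differentiable)
        moreover have "partial_diff R H t (real k) = deriv (\<lambda>r. R r (real k)) t - deriv (\<lambda>r. fbm_covariance H r (real k)) t"
          unfolding partial_diff_def Let_def using tn[of k] by auto
        ultimately show ?thesis by (auto intro: DERIV_diff)
      qed
      show "(E has_real_derivative E' t) (at t)"
        unfolding E_def E'_def using d[of "j + 1"] d[of j] T
        by (intro DERIV_diff) (auto simp: add.commute)
      have tT: "t \<in> {0<..<T}" using t t0 T by auto
      have "\<bar>partial_diff R H t (real j + 1) - partial_diff R H t (real j)\<bar> \<le> (C0 * t powr (H - 1)) / H * (real j + 1) powr (H - 1)"
      proof (rule powr_dominated_increment[OF H, where f'="deriv (partial_diff R H t)"])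
        show "0 \<le> C0 * t powr (H - 1)" using C0 by simp
        have "continuous_on {0..T} (partial_diff R H t)" using AT tT by blast
        then show "continuous_on {real j..real j + 1} (partial_diff R H t)"
          by (rule continuous_on_subset) (use T in auto)
        fix s assume s: "real j < s" "s < real j + 1"
        then have sT: "s \<in> {0<..<T}" using T by auto
        have "partial_diff R H t differentiable_on {0<..<T}" using AT tT by blast
        then have "partial_diff R H t differentiable (at s)" using sT by (simp add: differentiable_on_eq_differentiable_at)
        then show "(partial_diff R H t has_real_derivative deriv (partial_diff R H t) s) (at s)"
          by (simp add: DERIV_deriv_iff_real_differentiable)
        have "\<bar>deriv (partial_diff R H t) s\<bar> \<le> C0 * \<bar>t * s\<bar> powr (H - 1)" using AT tT sT by blast
        also have "\<bar>t * s\<bar> powr (H - 1) = t powr (H - 1) * s powr (H - 1)"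
          using t0 sT by (simp add: abs_mult powr_mult)
        finally show "\<bar>deriv (partial_diff R H t) s\<bar> \<le> C0 * t powr (H - 1) * s powr (H - 1)" by simp
      qed
      then show "\<bar>E' t\<bar> \<le> C0 / H * aj * t powr (H - 1)" by (simp add: E'_def aj_def mult_ac)
    qed
    moreover have "(R (real i + 1) (real j + 1) - R (real i + 1) (real j) - (R (real i) (real j + 1) - R (real i) (real j)))
        - fgn H (index_dist i j) = E (real i + 1) - E (real i)"
      unfolding E_def fbm_increment_covariance[symmetric] by simp
    ultimately show "\<bar>(R (real i + 1) (real j + 1) - R (real i + 1) (real j) - (R (real i) (real j + 1) - R (real i) (real j)))
        - fgn H (index_dist i j)\<bar> \<le> C0 / H / H * ((real i + 1) powr (H - 1) * (real j + 1) powr (H - 1))"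
      by (simp add: aj_def mult_ac)
  qed
qed

section \<open>Logarithmic averages\<close>

lemma harm_pos': "n \<ge> 1 \<Longrightarrow> (harm n :: real) > 0" by simp

lemma harm_le_3ln:
  assumes "n \<ge> 1"
  shows "harm n \<le> 3 * ln (real n + 1)"
proof -
  have "ln (real n) \<le> ln (real n + 1)" using assms by simp
  then show ?thesis using ln_ge_half[OF assms] harm_le_ln[OF assms] by linarith
qed

lemma harm_sum: "(\<Sum>k=1..n. 1 / real k) = harm n"
  by (simp add: harm_def inverse_eq_divide)

text \<open>
  Comparison with the telescoping sum of \<open>4 (sqrt (ln (k + 1)) - sqrt (ln k))\<close>.
\<close>
lemma sum_inverse_sqrt_ln_le: "(\<Sum>k=1..n. 1 / (real k * sqrt (ln (real k + 1)))) \<le> 4 * sqrt (ln (real n + 1))"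
proof (induction n)
  case 0 then show ?case by simp
next
  case (Suc n)
  define a where "a = sqrt (ln (real n + 2))"
  define b where "b = sqrt (ln (real n + 1))"
  have ap: "a > 0" by (simp add: a_def)
  have b0: "b \<ge> 0" by (simp add: b_def)
  have ba: "b \<le> a" by (simp add: a_def b_def)
  have "1 / (real n + 2) \<le> ln (real n + 2) - ln (real n + 1)"
  proof -
    have "ln (1 + - (1 / (real n + 2))) \<le> - (1 / (real n + 2))" by (intro ln_add_one_self_le_self2) simp
    moreover have "1 + - (1 / (real n + 2)) = (real n + 1) / (real n + 2)" by (simp add: field_simps)
    ultimately show ?thesis by (simp add: ln_div)
  qed
  also have "\<dots> = (a - b) * (a + b)"
    by (simp add: a_def b_def algebra_simps)
  also have "\<dots> \<le> (a - b) * (2 * a)" using ba by (intro mult_left_mono) auto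
  finally have "1 / (real n + 2) \<le> (a - b) * (2 * a)" .
  then have x: "1 / (real n + 2) / a \<le> 2 * (a - b)" using ap by (simp add: pos_divide_le_eq mult_ac)
  have y: "1 / ((real n + 1) * a) \<le> 2 * (1 / (real n + 2) / a)"
  proof -
    have "1 / (real n + 1) \<le> 2 * (1 / (real n + 2))" by (simp add: field_simps)
    from divide_right_mono[OF this, of a] ap show ?thesis by simp
  qed
  have "1 / ((real n + 1) * a) \<le> 4 * a - 4 * b"
    using order_trans[OF y mult_left_mono[OF x, of 2]] by simp
  then show ?case using Suc by (simp add: a_def b_def add.commute)
qed

lemma sum_inverse_sqrt_le: "(\<Sum>k=1..n. 1 / sqrt (real k)) \<le> 2 * sqrt (real n)"
proof (induction n)
  case 0 then show ?case by simp
next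
  case (Suc n)
  define a where "a = sqrt (real n + 1)"
  define b where "b = sqrt (real n)"
  have ap: "a > 0" by (simp add: a_def)
  have ba: "b \<le> a" by (simp add: a_def b_def)
  have "1 = (a - b) * (a + b)" by (simp add: a_def b_def algebra_simps)
  also have "\<dots> \<le> (a - b) * (2 * a)" using ba by (intro mult_left_mono) auto
  finally have "1 / a \<le> 2 * (a - b)" using ap by (simp add: pos_divide_le_eq mult_ac)
  then show ?case using Suc by (simp add: a_def b_def add.commute)
qed

lemma weighted_double_sum_le:
  assumes n: "n \<ge> 1"
  shows "(\<Sum>l=1..n. \<Sum>k=1..l. 1 / (real k * real l) * pair_rate k l)
     \<le> 18 * (ln (real n + 1) * sqrt (ln (real n + 1)))"
proof -
  define L where "L = ln (real n + 1)"
  have L: "L \<ge> 1/2" using ln_ge_half[OF n] by (simp add: L_def)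
  have "(\<Sum>l=1..n. \<Sum>k=1..l. 1 / (real k * real l) * pair_rate k l)
    \<le> (\<Sum>l=1..n. 1 / real l * (6 * sqrt L))"
  proof (rule sum_mono)
    fix l assume l: "l \<in> {1..n}"
    then have l0: "real l > 0" by simp
    have Ll: "ln (real l + 1) \<le> L" using l by (simp add: L_def)
    have "(\<Sum>k=1..l. 1 / (real k * real l) * pair_rate k l)
      = 1 / real l * (\<Sum>k=1..l. 1 / (real k * sqrt (ln (real k + 1)))) + 1 / real l * (sqrt (ln (real l + 1)) / sqrt (real l)) * (\<Sum>k=1..l. 1 / sqrt (real k))"
    proof -
      have "1 / (real k * real l) * pair_rate k l
        = 1 / real l * (1 / (real k * sqrt (ln (real k + 1)))) + 1 / real l * (sqrt (ln (real l + 1)) / sqrt (real l)) * (1 / sqrt (real k))"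
        if "k \<in> {1..l}" for k
      proof -
        have k: "sqrt (real k) / real k = 1 / sqrt (real k)" using that by (simp add: real_div_sqrt field_simps)
        have "1 / (real k * real l) * (sqrt (real k / real l) * sqrt (ln (real l + 1)))
          = (sqrt (real k) / real k) * (1 / real l * (sqrt (ln (real l + 1)) / sqrt (real l)))"
          by (simp add: real_sqrt_divide)
        then show ?thesis unfolding pair_rate_def k distrib_left by (simp add: mult_ac)
      qed
      then show ?thesis by (simp add: sum.distrib sum_distrib_left)
    qed
    also have "\<dots> \<le> 1 / real l * (4 * sqrt L) + 1 / real l * (sqrt L / sqrt (real l)) * (2 * sqrt (real l))"
    proof (intro add_mono mult_left_mono)
      show "(\<Sum>k=1..l. 1 / (real k * sqrt (ln (real k + 1)))) \<le> 4 * sqrt L"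
        by (rule order_trans[OF sum_inverse_sqrt_ln_le]) (use Ll in simp)
      show "1 / real l * (sqrt (ln (real l + 1)) / sqrt (real l)) * (\<Sum>k=1..l. 1 / sqrt (real k))
        \<le> 1 / real l * (sqrt L / sqrt (real l)) * (2 * sqrt (real l))"
        using l0 Ll L by (intro mult_mono sum_inverse_sqrt_le mult_left_mono divide_right_mono) (auto intro!: sum_nonneg)
    qed (use l0 in auto)
    also have "\<dots> = 1 / real l * (6 * sqrt L)" using l0 by simp
    finally show "(\<Sum>k=1..l. 1 / (real k * real l) * pair_rate k l) \<le> 1 / real l * (6 * sqrt L)" .
  qed
  also have "\<dots> = harm n * (6 * sqrt L)" by (simp only: sum_distrib_right[symmetric] harm_sum)
  also have "\<dots> \<le> (3 * L) * (6 * sqrt L)" using harm_le_3ln[OF n] L by (intro mult_right_mono) (auto simp: L_def)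
  finally show ?thesis by (simp add: L_def)
qed

text \<open>
  Between two consecutive times \<open>q j \<le> n < q (j + 1)\<close> the sum \<open>T\<close> moves by at most \<open>B\<close> times the
  increment of \<open>h\<close>, which is negligible against \<open>h (q j)\<close> because the ratio of consecutive values tends to 1.
\<close>
lemma subsequence_interpolation:
  fixes T h :: "nat \<Rightarrow> real" and q :: "nat \<Rightarrow> nat"
  assumes q: "strict_mono q"
    and h: "mono h" "\<And>n. n \<ge> 1 \<Longrightarrow> h n > 0" and q0: "\<And>j. q j \<ge> 1"
    and T: "\<And>m n. m \<le> n \<Longrightarrow> \<bar>T n - T m\<bar> \<le> B * (h n - h m)" and B: "B \<ge> 0"
    and sub: "(\<lambda>j. T (q j) / h (q j)) \<longlonglongrightarrow> 0"
    and ratio: "(\<lambda>j. h (q (Suc j)) / h (q j)) \<longlonglongrightarrow> 1"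
  shows "(\<lambda>n. T n / h n) \<longlonglongrightarrow> 0"
proof (rule LIMSEQ_I)
  fix e :: real assume e: "e > 0"
  have "(\<lambda>j. \<bar>T (q j) / h (q j)\<bar> + B * (h (q (Suc j)) / h (q j) - 1)) \<longlonglongrightarrow> \<bar>0\<bar> + B * (1 - 1)"
    by (intro tendsto_intros sub ratio)
  then have "\<forall>\<^sub>F j in sequentially. \<bar>T (q j) / h (q j)\<bar> + B * (h (q (Suc j)) / h (q j) - 1) < e"
    using e by (intro order_tendstoD(2)) auto
  then obtain J where J: "\<And>j. j \<ge> J \<Longrightarrow> \<bar>T (q j) / h (q j)\<bar> + B * (h (q (Suc j)) / h (q j) - 1) < e"
    unfolding eventually_sequentially by blast
  show "\<exists>N. \<forall>n\<ge>N. norm (T n / h n - 0) < e"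
  proof (intro exI allI impI)
    fix n assume n: "n \<ge> q J"
    define j where "j = Max {j. q j \<le> n}"
    have fin: "finite {j. q j \<le> n}"
      by (rule finite_subset[of _ "{..n}"]) (auto intro: order_trans[OF strict_mono_imp_increasing[OF q]])
    have j: "q j \<le> n" "J \<le> j" using Max_in[OF fin] Max_ge[OF fin, of J] n unfolding j_def by auto
    have jn: "n < q (Suc j)"
    proof (rule ccontr)
      assume "\<not> n < q (Suc j)"
      then have "Suc j \<le> j" unfolding j_def using Max_ge[OF fin, of "Suc (Max {j. q j \<le> n})"] by simp
      then show False by simp
    qed
    have hq: "h (q j) > 0" "h (q j) \<le> h n" "h n \<le> h (q (Suc j))"
      using h(2)[OF q0] h(1) j jn by (auto simp: mono_def)
    have "\<bar>T n\<bar> \<le> \<bar>T (q j)\<bar> + B * (h n - h (q j))" using T[OF j(1)] by linarith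
    also have "\<dots> \<le> \<bar>T (q j)\<bar> + B * (h (q (Suc j)) - h (q j))" using hq B by (intro add_left_mono mult_left_mono) auto
    finally have "\<bar>T n\<bar> / h n \<le> (\<bar>T (q j)\<bar> + B * (h (q (Suc j)) - h (q j))) / h (q j)"
      using hq B by (intro frac_le) auto
    also have "\<dots> = \<bar>T (q j) / h (q j)\<bar> + B * (h (q (Suc j)) / h (q j) - 1)"
    proof -
      have "(x + B * (y - z)) / z = x / z + B * (y / z - 1)" if "z > 0" for x y z :: real
        using that by (simp add: field_simps)
      from this[OF hq(1)] show ?thesis using hq(1) by (simp add: abs_divide)
    qed
    also have "\<dots> < e" by (rule J[OF j(2)])
    finally show "norm (T n / h n - 0) < e" using hq by simp
  qed
qed

lemma (in prob_space) AE_tendsto_zero_of_summable_expectation: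
  fixes Y :: "nat \<Rightarrow> 'a \<Rightarrow> real"
  assumes int: "\<And>j. integrable M (Y j)" and nonneg: "\<And>j \<omega>. Y j \<omega> \<ge> 0"
    and sum: "summable (\<lambda>j. expectation (Y j))"
  shows "AE \<omega> in M. (\<lambda>j. Y j \<omega>) \<longlonglongrightarrow> 0"
proof -
  have [measurable]: "Y j \<in> borel_measurable M" for j using int by auto
  have "(\<integral>\<^sup>+\<omega>. (\<Sum>j. ennreal (Y j \<omega>)) \<partial>M) = (\<Sum>j. \<integral>\<^sup>+\<omega>. ennreal (Y j \<omega>) \<partial>M)"
    by (rule nn_integral_suminf) measurable
  also have "\<dots> = (\<Sum>j. ennreal (expectation (Y j)))"
    by (simp add: nn_integral_eq_integral int nonneg)
  also have "\<dots> = ennreal (\<Sum>j. expectation (Y j))"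
    by (rule suminf_ennreal2) (use sum nonneg in auto)
  finally have "(\<integral>\<^sup>+\<omega>. (\<Sum>j. ennreal (Y j \<omega>)) \<partial>M) \<noteq> \<infinity>" by simp
  then have "AE \<omega> in M. (\<Sum>j. ennreal (Y j \<omega>)) \<noteq> \<infinity>" by (rule nn_integral_PInf_AE[rotated]) measurable
  then show ?thesis
  proof (rule AE_mp, intro AE_I2 impI)
    fix \<omega> assume "(\<Sum>j. ennreal (Y j \<omega>)) \<noteq> \<infinity>"
    then have "summable (\<lambda>j. Y j \<omega>)" using nonneg by (intro summable_suminf_not_top) auto
    then show "(\<lambda>j. Y j \<omega>) \<longlonglongrightarrow> 0" by (rule summable_LIMSEQ_zero)
  qed
qed

definition log_empirical :: "(nat \<Rightarrow> real) \<Rightarrow> nat \<Rightarrow> real measure" where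
  "log_empirical v n = distr (point_measure {1..n} (\<lambda>k. ennreal (1 / (real k * harm n)))) borel v"

lemma log_empirical:
  fixes f :: "real \<Rightarrow> 'b::{banach, second_countable_topology}"
  assumes n: "n \<ge> 1"
  shows "real_distribution (log_empirical v n)"
    and "f \<in> borel_measurable borel \<Longrightarrow> integral\<^sup>L (log_empirical v n) f = (\<Sum>k=1..n. (1 / (real k * harm n)) *\<^sub>R f (v k))"
proof -
  have h: "(harm n :: real) > 0" using n by simp
  have "(\<Sum>k=1..n. 1 / (real k * harm n)) = (\<Sum>k=1..n. 1 / real k) / harm n"
    by (simp add: sum_divide_distrib)
  also have "\<dots> = 1" unfolding harm_sum using h by (intro divide_self) linarith
  finally have s: "(\<Sum>k=1..n. 1 / (real k * harm n)) = 1" .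
  have "(\<Sum>k=1..n. ennreal (1 / (real k * harm n))) = ennreal (\<Sum>k=1..n. 1 / (real k * harm n))"
    by (rule sum_ennreal) (auto intro!: mult_nonneg_nonneg harm_nonneg)
  then have se: "(\<Sum>k=1..n. ennreal (1 / (real k * harm n))) = 1" unfolding s by simp
  have "prob_space (point_measure {1..n} (\<lambda>k. ennreal (1 / (real k * harm n))))"
    by (rule prob_space_point_measure) (simp_all only: se finite_atLeastAtMost zero_le)
  then show "real_distribution (log_empirical v n)"
    unfolding log_empirical_def by (rule prob_space.real_distribution_distr) (simp add: point_measure_def)
  assume f: "f \<in> borel_measurable borel"
  show "integral\<^sup>L (log_empirical v n) f = (\<Sum>k=1..n. (1 / (real k * harm n)) *\<^sub>R f (v k))"
  proof -
    have "integral\<^sup>L (log_empirical v n) f = integral\<^sup>L (point_measure {1..n} (\<lambda>k. ennreal (1 / (real k * harm n)))) (\<lambda>k. f (v k))"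
      unfolding log_empirical_def by (rule integral_distr) (use f in \<open>simp_all add: point_measure_def\<close>)
    also have "\<dots> = (\<Sum>k=1..n. (1 / (real k * harm n)) *\<^sub>R f (v k))"
      by (rule lebesgue_integral_point_measure_finite) (auto intro!: mult_nonneg_nonneg harm_nonneg)
    finally show ?thesis .
  qed
qed

section \<open>From characteristic functions to the almost sure limit\<close>

lemma sum_symmetric_le:
  fixes x :: "nat \<Rightarrow> nat \<Rightarrow> real"
  assumes sym: "\<And>k l. x k l = x l k" and nonneg: "\<And>k l. x k l \<ge> 0"
  shows "(\<Sum>k=1..n. \<Sum>l=1..n. x k l) \<le> 2 * (\<Sum>l=1..n. \<Sum>k=1..l. x k l)"
proof -
  have half: "(\<Sum>l=1..n. \<Sum>k=1..n. if k \<le> l then x k l else 0) = (\<Sum>l=1..n. \<Sum>k=1..l. x k l)"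
  proof (rule sum.cong[OF refl])
    fix l assume "l \<in> {1..n}"
    then show "(\<Sum>k=1..n. if k \<le> l then x k l else 0) = (\<Sum>k=1..l. x k l)"
      by (intro sum.mono_neutral_cong_right) auto
  qed
  have "(\<Sum>k=1..n. \<Sum>l=1..n. x k l) \<le> (\<Sum>k=1..n. \<Sum>l=1..n. (if l \<le> k then x l k else 0) + (if k \<le> l then x k l else 0))"
    by (intro sum_mono) (use sym nonneg in auto)
  also have "\<dots> = (\<Sum>k=1..n. \<Sum>l=1..n. if l \<le> k then x l k else 0) + (\<Sum>k=1..n. \<Sum>l=1..n. if k \<le> l then x k l else 0)"
    by (simp add: sum.distrib)
  also have "(\<Sum>k=1..n. \<Sum>l=1..n. if k \<le> l then x k l else 0) = (\<Sum>l=1..n. \<Sum>k=1..n. if k \<le> l then x k l else 0)"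
    by (rule sum.swap)
  finally show ?thesis unfolding half by simp
qed

text \<open>
  Quantitative asymptotic normality of each \<open>V\<^sub>k\<close>, and of the differences \<open>V\<^sub>k - V\<^sub>l\<close>. The latter expresses
  that \<open>V\<^sub>k\<close> and \<open>V\<^sub>l\<close> are nearly independent, which is what the law of large numbers behind the
  almost sure limit rests on.
\<close>
locale asclt_bounds = prob_space M for M :: "'a measure" +
  fixes V :: "nat \<Rightarrow> 'a \<Rightarrow> real" and K :: real
  assumes V_measurable [measurable]: "\<And>k. V k \<in> borel_measurable M"
    and V_square: "\<And>k. k \<ge> 1 \<Longrightarrow> integrable M (\<lambda>\<omega>. (V k \<omega>)\<^sup>2)"
      "\<And>k. k \<ge> 1 \<Longrightarrow> expectation (\<lambda>\<omega>. (V k \<omega>)\<^sup>2) = 1"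
    and K_nonneg: "K \<ge> 0"
    and char_single: "\<And>k t. k \<ge> 1 \<Longrightarrow>
      norm (expectation (\<lambda>\<omega>. iexp (t * V k \<omega>)) - of_real (exp (- (t\<^sup>2 / 2)))) \<le> t\<^sup>2 * (K / sqrt (ln (real k + 1)))"
    and char_pair: "\<And>k l t. 1 \<le> k \<Longrightarrow> k \<le> l \<Longrightarrow>
      norm (expectation (\<lambda>\<omega>. iexp (t * (V k \<omega> - V l \<omega>))) - of_real (exp (- t\<^sup>2)))
        \<le> t\<^sup>2 * (K * pair_rate k l)"
begin

definition dev :: "real \<Rightarrow> nat \<Rightarrow> 'a \<Rightarrow> complex" where
  "dev t k \<omega> = iexp (t * V k \<omega>) - of_real (exp (- (t\<^sup>2 / 2)))"

lemma dev_measurable [measurable]: "dev t k \<in> borel_measurable M"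
  unfolding dev_def by measurable

lemma norm_dev_le: "norm (dev t k \<omega>) \<le> 2"
proof -
  have "norm (dev t k \<omega>) \<le> norm (iexp (t * V k \<omega>)) + norm (complex_of_real (exp (- (t\<^sup>2 / 2))))"
    unfolding dev_def by (rule norm_triangle_ineq4)
  also have "\<dots> \<le> 1 + 1" by (intro add_mono) (simp_all add: norm_of_real)
  finally show ?thesis by simp
qed

lemma integrable_dev_mult: "integrable M (\<lambda>\<omega>. dev t k \<omega> * cnj (dev t l \<omega>))"
proof (rule integrable_bounded[where B="2 * 2"])
  have "(\<lambda>\<omega>. cnj (dev t l \<omega>)) \<in> borel_measurable M"
    by (rule borel_measurable_continuous_on[OF _ dev_measurable]) (intro continuous_intros)
  then show "(\<lambda>\<omega>. dev t k \<omega> * cnj (dev t l \<omega>)) \<in> borel_measurable M" by measurable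
  show "norm (dev t k \<omega> * cnj (dev t l \<omega>)) \<le> 2 * 2" for \<omega>
    unfolding norm_mult complex_mod_cnj by (intro mult_mono norm_dev_le) auto
qed

text \<open>
  Expanding the product gives the characteristic functions of \<open>V\<^sub>k - V\<^sub>l\<close>, \<open>V\<^sub>k\<close> and \<open>- V\<^sub>l\<close>; after subtracting
  the Gaussian limits \<open>c\<^sup>2\<close>, \<open>c\<close>, \<open>c\<close> with \<open>c = exp (- t\<^sup>2 / 2)\<close>, the constant terms cancel.
\<close>
lemma norm_expectation_dev_mult_le:
  assumes k: "1 \<le> k" "k \<le> l"
  shows "norm (expectation (\<lambda>\<omega>. dev t k \<omega> * cnj (dev t l \<omega>))) \<le> 3 * K * t\<^sup>2 * pair_rate k l"
proof -
  define c where "c = exp (- (t\<^sup>2 / 2))"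
  define \<phi> where "\<phi> = expectation (\<lambda>\<omega>. iexp (t * V k \<omega>))"
  define \<psi> where "\<psi> = expectation (\<lambda>\<omega>. iexp ((- t) * V l \<omega>))"
  define A where "A = expectation (\<lambda>\<omega>. iexp (t * (V k \<omega> - V l \<omega>)))"
  have c: "c * c = exp (- t\<^sup>2)" "0 \<le> c" "c \<le> 1" by (simp_all add: c_def exp_add[symmetric])
  have i: "integrable M (\<lambda>\<omega>. iexp (f \<omega>))" if "f \<in> borel_measurable M" for f
    by (rule integrable_bounded[where B=1]) (use that in auto)
  have i1: "integrable M (\<lambda>\<omega>. iexp (t * (V k \<omega> - V l \<omega>)))" "integrable M (\<lambda>\<omega>. iexp (t * V k \<omega>))" "integrable M (\<lambda>\<omega>. iexp ((- t) * V l \<omega>))"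
    by (rule i; measurable)+
  have "dev t k \<omega> * cnj (dev t l \<omega>) = iexp (t * (V k \<omega> - V l \<omega>)) - of_real c * iexp (t * V k \<omega>)
      - of_real c * iexp ((- t) * V l \<omega>) + of_real (c * c)" for \<omega>
  proof -
    have "cnj (dev t l \<omega>) = iexp ((- t) * V l \<omega>) - of_real c"
      by (simp add: dev_def c_def exp_cnj)
    moreover have "iexp (t * V k \<omega>) * iexp ((- t) * V l \<omega>) = iexp (t * (V k \<omega> - V l \<omega>))"
      unfolding exp_add[symmetric] by (simp add: algebra_simps)
    ultimately show ?thesis unfolding dev_def c_def[symmetric] by (simp add: left_diff_distrib right_diff_distrib)
  qed
  then have "expectation (\<lambda>\<omega>. dev t k \<omega> * cnj (dev t l \<omega>)) = expectation (\<lambda>\<omega>. iexp (t * (V k \<omega> - V l \<omega>)) - of_real c * iexp (t * V k \<omega>)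
      - of_real c * iexp ((- t) * V l \<omega>) + of_real (c * c))" by simp
  also have "\<dots> = A - of_real c * \<phi> - of_real c * \<psi> + of_real (c * c)"
    unfolding A_def \<phi>_def \<psi>_def using i1
    by (simp only: Bochner_Integration.integral_add Bochner_Integration.integral_diff Bochner_Integration.integrable_add
        Bochner_Integration.integrable_diff integrable_mult_right integral_mult_right_zero lebesgue_integral_const prob_space integrable_const) simp
  also have "\<dots> = (A - of_real (c * c)) - of_real c * (\<phi> - of_real c) - of_real c * (\<psi> - of_real c)"
    by (simp add: algebra_simps)
  also have "norm \<dots> \<le> norm (A - of_real (c * c)) + norm (of_real c * (\<phi> - of_real c)) + norm (of_real c * (\<psi> - of_real c))"
    by (intro order_trans[OF norm_triangle_ineq4] add_mono norm_triangle_ineq4 order_refl)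
  also have "\<dots> \<le> t\<^sup>2 * (K * pair_rate k l) + 1 * (t\<^sup>2 * (K * pair_rate k l)) + 1 * (t\<^sup>2 * (K * pair_rate k l))"
  proof -
    have Lk: "ln (real k + 1) > 0" "ln (real l + 1) \<ge> ln (real k + 1)" using k by auto
    have w1: "1 / sqrt (ln (real k + 1)) \<le> pair_rate k l" using Lk by (simp add: pair_rate_def)
    have w2: "1 / sqrt (ln (real l + 1)) \<le> pair_rate k l"
      by (rule order_trans[OF _ w1]) (use Lk in \<open>auto intro!: divide_left_mono\<close>)
    have "norm (A - of_real (c * c)) \<le> t\<^sup>2 * (K * pair_rate k l)"
      using char_pair[OF k, of t] unfolding A_def c(1) by simp
    moreover have "norm (of_real c * (\<phi> - of_real c)) \<le> 1 * (t\<^sup>2 * (K * pair_rate k l))"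
      unfolding norm_mult
    proof (intro mult_mono)
      have "norm (\<phi> - of_real c) \<le> t\<^sup>2 * (K * (1 / sqrt (ln (real k + 1))))"
        using char_single[OF k(1), of t] by (simp add: \<phi>_def c_def)
      also have "\<dots> \<le> t\<^sup>2 * (K * pair_rate k l)" using w1 K_nonneg by (intro mult_left_mono) auto
      finally show "norm (\<phi> - of_real c) \<le> t\<^sup>2 * (K * pair_rate k l)" .
    qed (use c in auto)
    moreover have "norm (of_real c * (\<psi> - of_real c)) \<le> 1 * (t\<^sup>2 * (K * pair_rate k l))"
      unfolding norm_mult
    proof (intro mult_mono)
      have "norm (\<psi> - of_real c) \<le> t\<^sup>2 * (K * (1 / sqrt (ln (real l + 1))))"
        using char_single[of l "- t"] k by (simp add: \<psi>_def c_def)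
      also have "\<dots> \<le> t\<^sup>2 * (K * pair_rate k l)" using w2 K_nonneg by (intro mult_left_mono) auto
      finally show "norm (\<psi> - of_real c) \<le> t\<^sup>2 * (K * pair_rate k l)" .
    qed (use c in auto)
    ultimately show ?thesis by linarith
  qed
  finally show ?thesis by (simp add: algebra_simps)
qed

definition dev_sum :: "real \<Rightarrow> nat \<Rightarrow> 'a \<Rightarrow> complex" where
  "dev_sum t n \<omega> = (\<Sum>k=1..n. of_real (1 / real k) * dev t k \<omega>)"

lemma dev_sum_measurable [measurable]: "dev_sum t n \<in> borel_measurable M"
  unfolding dev_sum_def by measurable

lemma dev_sum_square:
  assumes n: "n \<ge> 1"
  shows "integrable M (\<lambda>\<omega>. (norm (dev_sum t n \<omega>))\<^sup>2)"
    "expectation (\<lambda>\<omega>. (norm (dev_sum t n \<omega>))\<^sup>2) \<le> 108 * K * t\<^sup>2 * (ln (real n + 1) * sqrt (ln (real n + 1)))"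
proof -
  define x where "x k l = norm (of_real (1 / real k * (1 / real l)) * expectation (\<lambda>\<omega>. dev t k \<omega> * cnj (dev t l \<omega>)))" for k l
  have e: "complex_of_real ((norm (dev_sum t n \<omega>))\<^sup>2) = (\<Sum>k=1..n. \<Sum>l=1..n. of_real (1 / real k * (1 / real l)) * (dev t k \<omega> * cnj (dev t l \<omega>)))" for \<omega>
    unfolding complex_norm_square dev_sum_def cnj_sum sum_product by (intro sum.cong refl) (simp add: mult_ac)
  have ie: "integrable M (\<lambda>\<omega>. complex_of_real ((norm (dev_sum t n \<omega>))\<^sup>2))"
    unfolding e by (intro Bochner_Integration.integrable_sum integrable_mult_right integrable_dev_mult)
  then show int: "integrable M (\<lambda>\<omega>. (norm (dev_sum t n \<omega>))\<^sup>2)" by (simp only: complex_of_real_integrable_eq)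
  have "expectation (\<lambda>\<omega>. complex_of_real ((norm (dev_sum t n \<omega>))\<^sup>2)) = (\<Sum>k=1..n. \<Sum>l=1..n. of_real (1 / real k * (1 / real l)) * expectation (\<lambda>\<omega>. dev t k \<omega> * cnj (dev t l \<omega>)))"
    unfolding e using integrable_dev_mult
    by (simp only: Bochner_Integration.integral_sum Bochner_Integration.integrable_sum integrable_mult_right integral_mult_right_zero)
  then have "norm (complex_of_real (expectation (\<lambda>\<omega>. (norm (dev_sum t n \<omega>))\<^sup>2))) \<le> (\<Sum>k=1..n. \<Sum>l=1..n. x k l)"
    unfolding integral_complex_of_real x_def by (simp only:) (intro order_trans[OF norm_sum] sum_mono order_refl)
  then have "expectation (\<lambda>\<omega>. (norm (dev_sum t n \<omega>))\<^sup>2) \<le> (\<Sum>k=1..n. \<Sum>l=1..n. x k l)" by simp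
  also have "\<dots> \<le> 2 * (\<Sum>l=1..n. \<Sum>k=1..l. x k l)"
  proof (rule sum_symmetric_le)
    fix k l
    have "expectation (\<lambda>\<omega>. dev t l \<omega> * cnj (dev t k \<omega>)) = expectation (\<lambda>\<omega>. cnj (dev t k \<omega> * cnj (dev t l \<omega>)))"
      by (simp add: mult.commute)
    also have "\<dots> = cnj (expectation (\<lambda>\<omega>. dev t k \<omega> * cnj (dev t l \<omega>)))" by (rule Bochner_Integration.integral_cnj)
    finally show "x k l = x l k" unfolding x_def norm_mult by (simp add: mult.commute)
  qed (simp add: x_def)
  also have "\<dots> \<le> 2 * (\<Sum>l=1..n. \<Sum>k=1..l. (3 * K * t\<^sup>2) * (1 / (real k * real l) * pair_rate k l))"
  proof (intro mult_left_mono sum_mono)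
    fix k l assume "l \<in> {1..n}" "k \<in> {1..l}"
    then have k: "1 \<le> k" "k \<le> l" by auto
    have "x k l = 1 / (real k * real l) * norm (expectation (\<lambda>\<omega>. dev t k \<omega> * cnj (dev t l \<omega>)))"
      by (simp add: x_def norm_mult norm_divide)
    also have "\<dots> \<le> 1 / (real k * real l) * (3 * K * t\<^sup>2 * pair_rate k l)"
      by (intro mult_left_mono norm_expectation_dev_mult_le k) auto
    finally show "x k l \<le> (3 * K * t\<^sup>2) * (1 / (real k * real l) * pair_rate k l)" by (simp add: mult_ac)
  qed simp
  also have "\<dots> = 6 * K * t\<^sup>2 * (\<Sum>l=1..n. \<Sum>k=1..l. 1 / (real k * real l) * pair_rate k l)"
    by (simp add: sum_distrib_left mult.assoc)
  also have "\<dots> \<le> 6 * K * t\<^sup>2 * (18 * (ln (real n + 1) * sqrt (ln (real n + 1))))"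
    using K_nonneg by (intro mult_left_mono weighted_double_sum_le n) auto
  finally show "expectation (\<lambda>\<omega>. (norm (dev_sum t n \<omega>))\<^sup>2) \<le> 108 * K * t\<^sup>2 * (ln (real n + 1) * sqrt (ln (real n + 1)))" by simp
qed

definition abs_sum :: "nat \<Rightarrow> 'a \<Rightarrow> real" where
  "abs_sum n \<omega> = (\<Sum>k=1..n. 1 / real k * \<bar>V k \<omega>\<bar>)"

lemma abs_sum_measurable [measurable]: "abs_sum n \<in> borel_measurable M"
  unfolding abs_sum_def by measurable

lemma abs_sum_nonneg: "abs_sum n \<omega> \<ge> 0"
  unfolding abs_sum_def by (intro sum_nonneg) auto

lemma abs_sum_square: "integrable M (\<lambda>\<omega>. (abs_sum n \<omega>)\<^sup>2)" "expectation (\<lambda>\<omega>. (abs_sum n \<omega>)\<^sup>2) \<le> (harm n)\<^sup>2"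
proof -
  have le: "(abs_sum n \<omega>)\<^sup>2 \<le> harm n * (\<Sum>k=1..n. 1 / real k * (V k \<omega>)\<^sup>2)" for \<omega>
  proof -
    have "(abs_sum n \<omega>)\<^sup>2 = (\<Sum>k=1..n. sqrt (1 / real k) * (sqrt (1 / real k) * \<bar>V k \<omega>\<bar>))\<^sup>2"
      unfolding abs_sum_def by (simp add: mult.assoc[symmetric] real_sqrt_mult[symmetric])
    also have "\<dots> \<le> (\<Sum>k=1..n. (sqrt (1 / real k))\<^sup>2) * (\<Sum>k=1..n. (sqrt (1 / real k) * \<bar>V k \<omega>\<bar>)\<^sup>2)"
      by (rule Cauchy_Schwarz_ineq_sum)
    also have "\<dots> = (\<Sum>k=1..n. 1 / real k) * (\<Sum>k=1..n. 1 / real k * (V k \<omega>)\<^sup>2)"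
      by (simp add: power_mult_distrib)
    finally show ?thesis unfolding harm_sum .
  qed
  have int: "integrable M (\<lambda>\<omega>. harm n * (\<Sum>k=1..n. 1 / real k * (V k \<omega>)\<^sup>2))"
    by (intro integrable_mult_right Bochner_Integration.integrable_sum V_square) auto
  then show i: "integrable M (\<lambda>\<omega>. (abs_sum n \<omega>)\<^sup>2)"
    by (rule Bochner_Integration.integrable_bound) (measurable, intro AE_I2, unfold real_norm_def abs_power2, rule order_trans[OF le abs_ge_self])
  have "expectation (\<lambda>\<omega>. (abs_sum n \<omega>)\<^sup>2) \<le> expectation (\<lambda>\<omega>. harm n * (\<Sum>k=1..n. 1 / real k * (V k \<omega>)\<^sup>2))"
    by (rule integral_mono[OF i int le])
  also have "\<dots> = harm n * (\<Sum>k=1..n. 1 / real k * expectation (\<lambda>\<omega>. (V k \<omega>)\<^sup>2))"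
    using V_square(1) by (subst integral_mult_right_zero, subst Bochner_Integration.integral_sum) auto
  also have "(\<Sum>k=1..n. 1 / real k * expectation (\<lambda>\<omega>. (V k \<omega>)\<^sup>2)) = (\<Sum>k=1..n. 1 / real k)"
    by (intro sum.cong refl) (simp add: V_square(2))
  finally show "expectation (\<lambda>\<omega>. (abs_sum n \<omega>)\<^sup>2) \<le> (harm n)\<^sup>2" unfolding harm_sum by (simp add: power2_eq_square)
qed

text \<open>
  The exponent 16 leaves room for a grid of about \<open>j\<^sup>3\<close> points \<open>t\<close> with \<open>|t| \<le> j\<close>: the bound \<open>t\<^sup>2 / j\<^sup>8\<close> on each
  second moment still sums to a term of order \<open>j\<^sup>-\<^sup>3\<close>.
\<close>
definition sparse_time :: "nat \<Rightarrow> nat" where "sparse_time j = 2 ^ (j ^ 16)"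

lemma sparse_ge_1: "sparse_time j \<ge> 1" by (simp add: sparse_time_def)

lemma ln_sparse: "ln (real (sparse_time j) + 1) \<ge> real j ^ 16 / 4"
proof -
  have "real j ^ 16 / 4 \<le> real j ^ 16 * ln 2" using mult_left_mono[of "1/4" "ln 2" "real j ^ 16"] ln2_ge_two_thirds by simp
  also have "\<dots> = ln (real (sparse_time j))" by (simp add: sparse_time_def ln_realpow)
  also have "\<dots> \<le> ln (real (sparse_time j) + 1)" using sparse_ge_1[of j] by simp
  finally show ?thesis .
qed

lemma dev_sum_sparse_le:
  assumes j: "j \<ge> 1"
  shows "expectation (\<lambda>\<omega>. (norm (dev_sum t (sparse_time j) \<omega>) / harm (sparse_time j))\<^sup>2) \<le> 216 * K * t\<^sup>2 / real j ^ 8"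
proof -
  let ?n = "sparse_time j"
  define L where "L = ln (real ?n + 1)"
  define h where "h = (harm ?n :: real)"
  have j8: "real j ^ 8 > 0" using j by simp
  have "(real j ^ 8 / 2)\<^sup>2 \<le> L" using ln_sparse[of j] by (simp add: L_def power_divide power_mult[symmetric])
  then have sL: "real j ^ 8 / 2 \<le> sqrt L" by (rule real_le_rsqrt)
  have Lp: "L > 0" using sparse_ge_1[of j] by (simp add: L_def)
  have hL: "L \<le> h" using ln_le_harm[of ?n] by (simp add: L_def h_def)
  have "expectation (\<lambda>\<omega>. (norm (dev_sum t ?n \<omega>) / h)\<^sup>2) = expectation (\<lambda>\<omega>. (norm (dev_sum t ?n \<omega>))\<^sup>2) / h\<^sup>2"
    by (simp add: power_divide)
  also have "\<dots> \<le> (108 * K * t\<^sup>2 * (L * sqrt L)) / L\<^sup>2"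
    using dev_sum_square[OF sparse_ge_1[of j], of t] hL Lp K_nonneg
    by (intro frac_le power_mono) (auto simp: L_def)
  also have "\<dots> = 108 * K * t\<^sup>2 / sqrt L"
  proof -
    have "L * sqrt L / L\<^sup>2 = 1 / sqrt L" using Lp by (simp add: power2_eq_square real_div_sqrt field_simps)
    then show ?thesis by (metis (no_types, opaque_lifting) mult.right_neutral times_divide_eq_right)
  qed
  also have "\<dots> \<le> 108 * K * t\<^sup>2 / (real j ^ 8 / 2)"
    using sL j8 K_nonneg Lp by (intro divide_left_mono) auto
  also have "\<dots> = 216 * K * t\<^sup>2 / real j ^ 8" by simp
  finally show ?thesis by (simp add: h_def)
qed

text \<open>
  The squared deviations of the empirical characteristic function on a grid of mesh \<open>1 / j\<^sup>2\<close> in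
  \<open>[- j, j]\<close>, and the square of its Lipschitz constant times the mesh. Together they control the
  deviation at every real \<open>t\<close>, with a single exceptional null set.
\<close>
definition grid_error :: "nat \<Rightarrow> 'a \<Rightarrow> real" where
  "grid_error j \<omega> = (\<Sum>a\<in>{- int (j ^ 3)..int (j ^ 3)}. (norm (dev_sum (real_of_int a / (real j)\<^sup>2) (sparse_time j) \<omega>) / harm (sparse_time j))\<^sup>2)
      + (abs_sum (sparse_time j) \<omega> / harm (sparse_time j) / (real j)\<^sup>2)\<^sup>2"

lemma grid_error_integrable: "integrable M (grid_error j)"
  unfolding grid_error_def[abs_def] power_divide
  by (intro Bochner_Integration.integrable_add Bochner_Integration.integrable_sum integrable_divide dev_sum_square abs_sum_square sparse_ge_1)

lemma grid_error_nonneg: "grid_error j \<omega> \<ge> 0"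
  unfolding grid_error_def by (intro add_nonneg_nonneg sum_nonneg) auto

lemma expectation_grid_error_le:
  assumes j: "j \<ge> 1"
  shows "expectation (grid_error j) \<le> (648 * K + 1) * inverse (real j ^ 2)"
proof -
  have jp: "real j > 0" using j by simp
  let ?I = "{- int (j ^ 3)..int (j ^ 3)}"
  let ?d = "\<lambda>a. (\<lambda>\<omega>. (norm (dev_sum (real_of_int a / (real j)\<^sup>2) (sparse_time j) \<omega>) / harm (sparse_time j))\<^sup>2)"
  have id: "integrable M (?d a)" for a
    unfolding power_divide by (intro integrable_divide dev_sum_square sparse_ge_1)
  have iW: "integrable M (\<lambda>\<omega>. (abs_sum (sparse_time j) \<omega> / harm (sparse_time j) / (real j)\<^sup>2)\<^sup>2)"
    unfolding power_divide by (intro integrable_divide abs_sum_square)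
  have "expectation (grid_error j) = (\<Sum>a\<in>?I. expectation (?d a)) + expectation (\<lambda>\<omega>. (abs_sum (sparse_time j) \<omega> / harm (sparse_time j) / (real j)\<^sup>2)\<^sup>2)"
    unfolding grid_error_def[abs_def] using id iW
    by (simp only: Bochner_Integration.integral_add Bochner_Integration.integral_sum Bochner_Integration.integrable_sum)
  also have "(\<Sum>a\<in>?I. expectation (?d a)) \<le> (\<Sum>a\<in>?I. 216 * K / real j ^ 6)"
  proof (rule sum_mono)
    fix a assume a: "a \<in> ?I"
    then have "\<bar>real_of_int a\<bar> \<le> real j ^ 3" by (auto simp: abs_le_iff) (metis of_int_le_iff of_int_minus of_int_of_nat_eq of_nat_power minus_le_iff)+
    then have "(real_of_int a)\<^sup>2 \<le> (real j ^ 3)\<^sup>2" by (metis abs_ge_zero power2_abs power_mono)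
    then have a2: "(real_of_int a)\<^sup>2 \<le> real j ^ 6" by (simp add: power_mult[symmetric])
    have "expectation (?d a) \<le> 216 * K * (real_of_int a / (real j)\<^sup>2)\<^sup>2 / real j ^ 8" by (rule dev_sum_sparse_le[OF j])
    also have "\<dots> = 216 * K * ((real_of_int a)\<^sup>2 / real j ^ 12)"
      by (simp add: power_divide power_mult[symmetric] power_add[symmetric])
    also have "\<dots> \<le> 216 * K * (real j ^ 6 / real j ^ 12)"
      using K_nonneg a2 by (intro mult_left_mono divide_right_mono) auto
    also have "real j ^ 6 / real j ^ 12 = 1 / real j ^ 6"
      using jp by (simp add: field_simps power_add[symmetric])
    finally show "expectation (?d a) \<le> 216 * K / real j ^ 6" by simp
  qed
  also have "\<dots> = (2 * real j ^ 3 + 1) * (216 * K / real j ^ 6)" by simp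
  also have "\<dots> \<le> (3 * real j ^ 3) * (216 * K / real j ^ 6)"
    using jp K_nonneg j by (intro mult_right_mono) auto
  also have "\<dots> = 648 * K * (1 / real j ^ 3)" using jp by (simp add: field_simps power_add[symmetric])
  also have "\<dots> \<le> 648 * K * inverse (real j ^ 2)"
    using jp K_nonneg j by (intro mult_left_mono) (auto simp: inverse_eq_divide intro!: divide_left_mono power_increasing)
  also have "expectation (\<lambda>\<omega>. (abs_sum (sparse_time j) \<omega> / harm (sparse_time j) / (real j)\<^sup>2)\<^sup>2) \<le> 1 * inverse (real j ^ 2)"
  proof -
    have h: "(harm (sparse_time j) :: real) > 0" using sparse_ge_1[of j] by simp
    then have h2: "((harm (sparse_time j))\<^sup>2 :: real) > 0" by (rule zero_less_power)
    have "expectation (\<lambda>\<omega>. (abs_sum (sparse_time j) \<omega> / harm (sparse_time j) / (real j)\<^sup>2)\<^sup>2) = expectation (\<lambda>\<omega>. (abs_sum (sparse_time j) \<omega>)\<^sup>2) / (harm (sparse_time j))\<^sup>2 / ((real j)\<^sup>2)\<^sup>2"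
      unfolding power_divide by simp
    also have "\<dots> \<le> 1 / ((real j)\<^sup>2)\<^sup>2"
      using abs_sum_square(2)[of "sparse_time j"] h2 by (intro divide_right_mono) (simp_all only: pos_divide_le_eq mult_1_left zero_le_power2)
    also have "\<dots> \<le> 1 / (real j ^ 2)"
      using j jp by (intro divide_left_mono) (auto simp: power_mult[symmetric] intro!: power_increasing)
    finally show ?thesis by (simp add: inverse_eq_divide)
  qed
  finally show ?thesis by (simp add: distrib_right)
qed

lemma AE_grid_error_tendsto: "AE \<omega> in M. (\<lambda>j. grid_error j \<omega>) \<longlonglongrightarrow> 0"
proof (rule AE_tendsto_zero_of_summable_expectation[OF grid_error_integrable grid_error_nonneg])
  show "summable (\<lambda>j. expectation (grid_error j))"
  proof (rule summable_comparison_test)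
    show "summable (\<lambda>j. (648 * K + 1) * inverse (real j ^ 2))"
      by (intro summable_mult inverse_power_summable) simp
    show "\<exists>N. \<forall>j\<ge>N. norm (expectation (grid_error j)) \<le> (648 * K + 1) * inverse (real j ^ 2)"
    proof (intro exI allI impI)
      fix j :: nat assume "j \<ge> 1"
      moreover have "expectation (grid_error j) \<ge> 0" by (intro Bochner_Integration.integral_nonneg grid_error_nonneg)
      ultimately show "norm (expectation (grid_error j)) \<le> (648 * K + 1) * inverse (real j ^ 2)"
        using expectation_grid_error_le by simp
    qed
  qed
qed

end

lemma norm_iexp_diff_le: "norm (iexp x - iexp y) \<le> \<bar>x - y\<bar>"
proof -
  have "iexp x - iexp y = iexp y * (iexp (x - y) - 1)"
    unfolding right_diff_distrib exp_add[symmetric] by (simp add: algebra_simps)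
  then have "norm (iexp x - iexp y) = norm (iexp (x - y) - 1)" by (simp only: norm_mult norm_exp_i_times)
  also have "\<dots> \<le> \<bar>x - y\<bar>" using iexp_approx1[of "x - y" 0] by simp
  finally show ?thesis .
qed

lemma harm_over_ln_tendsto: "(\<lambda>n. harm n / ln (real n)) \<longlonglongrightarrow> 1"
proof (rule tendsto_sandwich[where f="\<lambda>_. 1" and h="\<lambda>n. 1 + inverse (ln (real n))"])
  have "(\<lambda>n. inverse (ln (real n))) \<longlonglongrightarrow> 0"
    by (intro tendsto_inverse_0_at_top filterlim_compose[OF ln_at_top filterlim_real_sequentially])
  then show "(\<lambda>n. 1 + inverse (ln (real n))) \<longlonglongrightarrow> 1" using tendsto_add[OF tendsto_const[of 1]] by fastforce
  show "\<forall>\<^sub>F n in sequentially. 1 \<le> harm n / ln (real n)"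
  proof (rule eventually_sequentiallyI[of 2])
    fix n :: nat assume n: "2 \<le> n"
    then have "ln (real n) \<le> ln (real n + 1)" "ln (real n) > 0" by auto
    then show "1 \<le> harm n / ln (real n)" using ln_le_harm[of n] by (simp add: le_divide_eq)
  qed
  show "\<forall>\<^sub>F n in sequentially. harm n / ln (real n) \<le> 1 + inverse (ln (real n))"
  proof (rule eventually_sequentiallyI[of 2])
    fix n :: nat assume n: "2 \<le> n"
    then have "ln (real n) > 0" by auto
    then show "harm n / ln (real n) \<le> 1 + inverse (ln (real n))" using harm_le_ln[of n] n
      by (simp add: field_simps)
  qed
qed simp

context asclt_bounds
begin

abbreviation emp :: "'a \<Rightarrow> nat \<Rightarrow> real measure" where
  "emp \<omega> n \<equiv> log_empirical (\<lambda>k. V k \<omega>) n"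

lemma strict_mono_sparse: "strict_mono sparse_time"
  unfolding sparse_time_def by (intro strict_monoI power_strict_increasing power_strict_mono) auto

lemma harm_sparse_ratio: "(\<lambda>j. harm (sparse_time (Suc j)) / harm (sparse_time j)) \<longlonglongrightarrow> (1::real)"
proof (rule tendsto_sandwich[where f="\<lambda>_. 1" and h="\<lambda>j. (1 / real j) ^ 16 * (1 / ln 2) + (1 + 1 / real j) ^ 16"])
  have r1: "(\<lambda>j. 1 / real j) \<longlonglongrightarrow> 0" by (rule lim_const_over_n)
  have "(\<lambda>j. (1 / real j) ^ 16 * (1 / ln 2) + (1 + 1 / real j) ^ 16) \<longlonglongrightarrow> 0 ^ 16 * (1 / ln 2) + (1 + 0) ^ 16"
    by (intro tendsto_intros r1)
  then show "(\<lambda>j. (1 / real j) ^ 16 * (1 / ln 2) + (1 + 1 / real j) ^ 16) \<longlonglongrightarrow> 1" by simp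
  show "\<forall>\<^sub>F j in sequentially. 1 \<le> (harm (sparse_time (Suc j)) / harm (sparse_time j) :: real)"
  proof (rule always_eventually, rule allI)
    fix j
    have "sparse_time j \<le> sparse_time (Suc j)" using strict_mono_sparse by (simp add: strict_mono_less_eq)
    then have "(harm (sparse_time j) :: real) \<le> harm (sparse_time (Suc j))" by (rule harm_mono)
    moreover have "(harm (sparse_time j) :: real) > 0" using sparse_ge_1[of j] by simp
    ultimately show "1 \<le> (harm (sparse_time (Suc j)) / harm (sparse_time j) :: real)" by (simp only: le_divide_eq) simp
  qed
  show "\<forall>\<^sub>F j in sequentially. (harm (sparse_time (Suc j)) / harm (sparse_time j) :: real) \<le> (1 / real j) ^ 16 * (1 / ln 2) + (1 + 1 / real j) ^ 16"
  proof (rule eventually_sequentiallyI[of 1])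
    fix j :: nat assume j: "1 \<le> j"
    have l: "ln 2 > (0::real)" by simp
    have lnq: "ln (real (sparse_time i)) = real i ^ 16 * ln 2" for i by (simp add: sparse_time_def ln_realpow)
    have jp: "real j ^ 16 * ln 2 > 0" using j by simp
    have "harm (sparse_time (Suc j)) \<le> real (Suc j) ^ 16 * ln 2 + 1" using harm_le_ln[OF sparse_ge_1[of "Suc j"]] unfolding lnq .
    moreover have "real j ^ 16 * ln 2 \<le> harm (sparse_time j)"
      using ln_le_harm[of "sparse_time j"] sparse_ge_1[of j] unfolding lnq[symmetric] by (smt (verit) ln_less_cancel_iff of_nat_0_less_iff less_le_trans zero_less_one)
    ultimately have "(harm (sparse_time (Suc j)) / harm (sparse_time j) :: real) \<le> (real (Suc j) ^ 16 * ln 2 + 1) / (real j ^ 16 * ln 2)"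
      using jp l by (intro frac_le) auto
    also have "\<dots> = (real (Suc j) / real j) ^ 16 + (1 / real j) ^ 16 * (1 / ln 2)"
    proof -
      have "(s ^ 16 * L + 1) / (r ^ 16 * L) = (s / r) ^ 16 + (1 / r) ^ 16 * (1 / L)" if "r > 0" "L > 0" for s r L :: real
        using that by (simp add: power_divide add_divide_distrib)
      from this[of "real j" "ln 2" "real (Suc j)"] show ?thesis using j l by simp
    qed
    also have "real (Suc j) / real j = 1 + 1 / real j" using j by (simp add: field_simps)
    finally show "(harm (sparse_time (Suc j)) / harm (sparse_time j) :: real) \<le> (1 / real j) ^ 16 * (1 / ln 2) + (1 + 1 / real j) ^ 16" by simp
  qed
qed simp

lemma char_log_empirical:
  assumes n: "n \<ge> 1"
  shows "char (emp \<omega> n) t = dev_sum t n \<omega> / of_real (harm n) + of_real (exp (- (t\<^sup>2 / 2)))"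
proof -
  have h: "harm n \<noteq> (0::real)" using harm_pos'[OF n] by linarith
  define c where "c = complex_of_real (exp (- (t\<^sup>2 / 2)))"
  have "char (emp \<omega> n) t = (\<Sum>k=1..n. (1 / (real k * harm n)) *\<^sub>R iexp (t * V k \<omega>))"
    unfolding char_def by (rule log_empirical(2)[OF n]) simp
  also have "\<dots> = (\<Sum>k=1..n. of_real (1 / real k) * iexp (t * V k \<omega>)) / of_real (harm n)"
    by (simp add: sum_divide_distrib scaleR_conv_of_real)
  also have "(\<Sum>k=1..n. of_real (1 / real k) * iexp (t * V k \<omega>)) = dev_sum t n \<omega> + of_real (harm n) * c"
  proof -
    have "of_real (harm n) * c = (\<Sum>k=1..n. of_real (1 / real k) * c)"
      unfolding harm_sum[symmetric] of_real_sum sum_distrib_right ..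
    then show ?thesis unfolding dev_sum_def dev_def c_def[symmetric] by (simp add: sum.distrib[symmetric] right_diff_distrib)
  qed
  also have "(dev_sum t n \<omega> + of_real (harm n) * c) / of_real (harm n) = dev_sum t n \<omega> / of_real (harm n) + c"
    using h by (simp add: add_divide_distrib)
  finally show ?thesis by (simp add: c_def)
qed

lemma char_log_empirical_lipschitz:
  assumes n: "n \<ge> 1"
  shows "norm (char (emp \<omega> n) t - char (emp \<omega> n) s) \<le> \<bar>t - s\<bar> * (abs_sum n \<omega> / harm n)"
proof -
  have e: "char (emp \<omega> n) t = (\<Sum>k=1..n. (1 / (real k * harm n)) *\<^sub>R iexp (t * V k \<omega>))" for t
    unfolding char_def by (rule log_empirical(2)[OF n]) simp
  have "norm (char (emp \<omega> n) t - char (emp \<omega> n) s)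
     \<le> (\<Sum>k=1..n. 1 / (real k * harm n) * (\<bar>t - s\<bar> * \<bar>V k \<omega>\<bar>))"
    unfolding e sum_subtractf[symmetric] scaleR_diff_right[symmetric]
  proof (intro order_trans[OF norm_sum] sum_mono)
    fix k
    have "0 \<le> 1 / (real k * harm n)" by (intro divide_nonneg_nonneg mult_nonneg_nonneg harm_nonneg) auto
    moreover have "norm (iexp (t * V k \<omega>) - iexp (s * V k \<omega>)) \<le> \<bar>t - s\<bar> * \<bar>V k \<omega>\<bar>"
      using norm_iexp_diff_le[of "t * V k \<omega>" "s * V k \<omega>"] by (simp add: left_diff_distrib[symmetric] abs_mult)
    ultimately show "norm ((1 / (real k * harm n)) *\<^sub>R (iexp (t * V k \<omega>) - iexp (s * V k \<omega>))) \<le> 1 / (real k * harm n) * (\<bar>t - s\<bar> * \<bar>V k \<omega>\<bar>)"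
      unfolding norm_scaleR abs_of_nonneg[OF \<open>0 \<le> 1 / (real k * harm n)\<close>] by (rule mult_left_mono[rotated])
  qed
  also have "\<dots> = \<bar>t - s\<bar> * (abs_sum n \<omega> / harm n)"
    unfolding abs_sum_def by (simp add: sum_distrib_left sum_divide_distrib mult_ac)
  finally show ?thesis .
qed

text \<open>
  For \<open>j \<ge> |t| + 1\<close> the grid point \<open>s j\<close> just below \<open>t\<close> lies in the grid. The passage from \<open>t\<close> to \<open>s j\<close>
  costs the Lipschitz term of \<open>grid_error\<close>, the deviation at \<open>s j\<close> one of the grid terms.
\<close>
lemma char_log_empirical_tendsto:
  assumes small: "(\<lambda>j. grid_error j \<omega>) \<longlonglongrightarrow> 0"
  shows "(\<lambda>j. char (emp \<omega> (sparse_time j)) t) \<longlonglongrightarrow> of_real (exp (- (t\<^sup>2 / 2)))"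
proof -
  let ?\<psi> = "\<lambda>j t. char (emp \<omega> (sparse_time j)) t"
  define s where "s j = real_of_int \<lfloor>t * (real j)\<^sup>2\<rfloor> / (real j)\<^sup>2" for j :: nat
  have ts: "\<bar>t - s j\<bar> \<le> 1 / (real j)\<^sup>2" if j: "j \<ge> 1" for j
  proof -
    have j2: "(real j)\<^sup>2 > 0" using j by simp
    have "t - s j = (t * (real j)\<^sup>2 - \<lfloor>t * (real j)\<^sup>2\<rfloor>) / (real j)\<^sup>2"
      using j by (simp add: s_def diff_divide_distrib)
    moreover have "\<bar>t * (real j)\<^sup>2 - \<lfloor>t * (real j)\<^sup>2\<rfloor>\<bar> \<le> 1" by linarith
    ultimately show ?thesis using j2 by (simp only: abs_divide abs_power2) (intro divide_right_mono, auto)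
  qed
  have inv0: "(\<lambda>j. 1 / (real j)\<^sup>2) \<longlonglongrightarrow> 0"
  proof -
    have "(\<lambda>j. (1 / real j)\<^sup>2) \<longlonglongrightarrow> 0\<^sup>2" by (intro tendsto_intros lim_const_over_n)
    then show ?thesis by (simp add: power_divide)
  qed
  have "(\<lambda>j. t - s j) \<longlonglongrightarrow> 0"
    by (rule Lim_null_comparison[OF _ inv0]) (auto intro!: eventually_sequentiallyI[of 1] ts)
  then have "(\<lambda>j. t - (t - s j)) \<longlonglongrightarrow> t - 0" by (intro tendsto_intros)
  then have s: "s \<longlonglongrightarrow> t" by simp
  have "(\<lambda>j. ?\<psi> j t - of_real (exp (- ((s j)\<^sup>2 / 2)))) \<longlonglongrightarrow> 0"
  proof (rule Lim_null_comparison)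
    show "(\<lambda>j. 2 * sqrt (grid_error j \<omega>)) \<longlonglongrightarrow> 0" using tendsto_mult[OF tendsto_const[of 2] tendsto_real_sqrt[OF small]] by simp
    show "\<forall>\<^sub>F j in sequentially. norm (?\<psi> j t - of_real (exp (- ((s j)\<^sup>2 / 2)))) \<le> 2 * sqrt (grid_error j \<omega>)"
    proof (rule eventually_sequentiallyI[of "nat \<lceil>\<bar>t\<bar>\<rceil> + 1"])
      fix j assume j: "nat \<lceil>\<bar>t\<bar>\<rceil> + 1 \<le> j"
      then have j1: "j \<ge> 1" by simp
      have tj: "\<bar>t\<bar> + 1 \<le> real j"
      proof -
        have "real (nat \<lceil>\<bar>t\<bar>\<rceil> + 1) \<le> real j" using j by (simp only: of_nat_le_iff)
        then show ?thesis using real_nat_ceiling_ge[of "\<bar>t\<bar>"] by linarith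
      qed
      \<comment> \<open>since \<open>|t| \<le> j - 1\<close>, rounding does not leave the grid\<close>
      define a where "a = \<lfloor>t * (real j)\<^sup>2\<rfloor>"
      have "a \<in> {- int (j ^ 3)..int (j ^ 3)}"
      proof -
        have "\<bar>t * (real j)\<^sup>2\<bar> \<le> (real j - 1) * (real j)\<^sup>2"
          using tj unfolding abs_mult by (intro mult_mono) auto
        also have "\<dots> = real j ^ 3 - (real j)\<^sup>2" by (simp add: power3_eq_cube power2_eq_square algebra_simps)
        also have "\<dots> \<le> real j ^ 3 - 1" using j1 by simp
        finally have "\<bar>t * (real j)\<^sup>2\<bar> \<le> real (j ^ 3) - 1" by simp
        then have "- real (j ^ 3) \<le> t * (real j)\<^sup>2" "t * (real j)\<^sup>2 \<le> real (j ^ 3)" by linarith+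
        then have "of_int (- int (j ^ 3)) \<le> t * (real j)\<^sup>2" "t * (real j)\<^sup>2 \<le> of_int (int (j ^ 3))" by (simp_all only: of_int_minus of_int_of_nat_eq)
        then show ?thesis unfolding a_def by (simp only: atLeastAtMost_iff le_floor_iff floor_le_iff) (rule conjI, rule TrueI, linarith)
      qed
      then have "(norm (dev_sum (real_of_int a / (real j)\<^sup>2) (sparse_time j) \<omega>) / harm (sparse_time j))\<^sup>2
         \<le> (\<Sum>a\<in>{- int (j ^ 3)..int (j ^ 3)}. (norm (dev_sum (real_of_int a / (real j)\<^sup>2) (sparse_time j) \<omega>) / harm (sparse_time j))\<^sup>2)"
        by (intro member_le_sum) auto
      also have "\<dots> \<le> grid_error j \<omega>" unfolding grid_error_def by simp
      finally have "norm (dev_sum (s j) (sparse_time j) \<omega>) / harm (sparse_time j) \<le> sqrt (grid_error j \<omega>)"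
        unfolding s_def a_def by (rule real_le_rsqrt)
      then have 1: "norm (?\<psi> j (s j) - of_real (exp (- ((s j)\<^sup>2 / 2)))) \<le> sqrt (grid_error j \<omega>)"
        unfolding char_log_empirical[OF sparse_ge_1] by (simp add: norm_divide norm_harm harm_nonneg)
      have "(abs_sum (sparse_time j) \<omega> / harm (sparse_time j) / (real j)\<^sup>2)\<^sup>2 \<le> grid_error j \<omega>" unfolding grid_error_def by (simp add: sum_nonneg)
      then have "abs_sum (sparse_time j) \<omega> / harm (sparse_time j) / (real j)\<^sup>2 \<le> sqrt (grid_error j \<omega>)" by (rule real_le_rsqrt)
      moreover have "norm (?\<psi> j t - ?\<psi> j (s j)) \<le> 1 / (real j)\<^sup>2 * (abs_sum (sparse_time j) \<omega> / harm (sparse_time j))"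
        by (rule order_trans[OF char_log_empirical_lipschitz[OF sparse_ge_1] mult_right_mono[OF ts[OF j1]]])
           (intro divide_nonneg_nonneg abs_sum_nonneg harm_nonneg)
      ultimately have 2: "norm (?\<psi> j t - ?\<psi> j (s j)) \<le> sqrt (grid_error j \<omega>)" by (simp add: mult.commute)
      from norm_diff_triangle_le[OF 2 1] show "norm (?\<psi> j t - of_real (exp (- ((s j)\<^sup>2 / 2)))) \<le> 2 * sqrt (grid_error j \<omega>)" by simp
    qed
  qed
  moreover have "(\<lambda>j. complex_of_real (exp (- ((s j)\<^sup>2 / 2)))) \<longlonglongrightarrow> of_real (exp (- (t\<^sup>2 / 2)))"
    by (intro tendsto_intros s) simp
  ultimately show ?thesis using tendsto_add by fastforce
qed

text \<open>
  Weak convergence along \<open>sparse_time\<close> by Levy's continuity theorem, then interpolation. The averages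
  are first normalized by harmonic numbers, to have probability measures, and only at the end by logarithms.
\<close>
lemma log_average_tendsto:
  fixes \<phi> :: "real \<Rightarrow> real"
  assumes small: "(\<lambda>j. grid_error j \<omega>) \<longlonglongrightarrow> 0" and cont: "continuous_on UNIV \<phi>" and bdd: "bounded (range \<phi>)"
  shows "(\<lambda>n. 1 / ln (real n) * (\<Sum>k=1..n. 1 / real k * \<phi> (V k \<omega>))) \<longlonglongrightarrow> integral\<^sup>L std_normal_distribution \<phi>"
proof -
  let ?\<mu> = "\<lambda>j. emp \<omega> (sparse_time j)"
  define m where "m = integral\<^sup>L std_normal_distribution \<phi>"
  obtain B where B: "\<And>x. norm (\<phi> x) \<le> B" using bdd unfolding bounded_iff by auto
  have rd: "real_distribution (?\<mu> j)" for j by (rule log_empirical(1)[OF sparse_ge_1])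
  have "weak_conv_m ?\<mu> std_normal_distribution"
  proof (rule levy_continuity[OF rd real_dist_normal_dist])
    show "(\<lambda>j. char (?\<mu> j) t) \<longlonglongrightarrow> char std_normal_distribution t" for t
      using char_log_empirical_tendsto[OF small, of t] unfolding char_std_normal_distribution by (simp add: power2_eq_square)
  qed
  with rd real_dist_normal_dist have "(\<lambda>j. integral\<^sup>L (?\<mu> j) \<phi>) \<longlonglongrightarrow> integral\<^sup>L std_normal_distribution \<phi>"
    by (rule weak_conv_imp_integral_bdd_continuous_conv) (use cont B in \<open>auto simp: continuous_on_eq_continuous_at\<close>)
  then have conv: "(\<lambda>j. integral\<^sup>L (?\<mu> j) \<phi>) \<longlonglongrightarrow> m" by (simp add: m_def)
  define T where "T n = (\<Sum>k=1..n. 1 / real k * (\<phi> (V k \<omega>) - m))" for n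
  have T: "T n = (\<Sum>k=1..n. 1 / real k * \<phi> (V k \<omega>)) - m * harm n" for n
    unfolding T_def harm_sum[symmetric] sum_distrib_left sum_subtractf[symmetric] by (intro sum.cong refl) (simp add: algebra_simps)
  have "(\<lambda>n. T n / harm n) \<longlonglongrightarrow> 0"
  proof (rule subsequence_interpolation[OF strict_mono_sparse])
    show "mono (harm :: nat \<Rightarrow> real)" by (intro monoI harm_mono)
    show "0 < (harm n :: real)" if "n \<ge> 1" for n using harm_pos'[OF that] .
    show "1 \<le> sparse_time j" for j by (rule sparse_ge_1)
    show "\<bar>T n' - T n\<bar> \<le> (B + \<bar>m\<bar>) * (harm n' - harm n)" if "n \<le> n'" for n n'
    proof -
      have split: "(\<Sum>k=1..n'. f k) - (\<Sum>k=1..n. f k) = (\<Sum>k\<in>{n<..n'}. f k)" for f :: "nat \<Rightarrow> real"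
      proof -
        have "{1..n'} = {1..n} \<union> {n<..n'}" using that by auto
        then have "(\<Sum>k=1..n'. f k) = (\<Sum>k\<in>{1..n} \<union> {n<..n'}. f k)" by (rule arg_cong)
        also have "\<dots> = (\<Sum>k=1..n. f k) + (\<Sum>k\<in>{n<..n'}. f k)" by (rule sum.union_disjoint) auto
        finally show ?thesis by simp
      qed
      have "\<bar>T n' - T n\<bar> \<le> (\<Sum>k\<in>{n<..n'}. \<bar>1 / real k * (\<phi> (V k \<omega>) - m)\<bar>)"
        unfolding T_def split by (rule sum_abs)
      also have "\<dots> \<le> (\<Sum>k\<in>{n<..n'}. (B + \<bar>m\<bar>) * (1 / real k))"
      proof (rule sum_mono)
        fix k
        have "\<bar>\<phi> (V k \<omega>) - m\<bar> \<le> B + \<bar>m\<bar>" using B[of "V k \<omega>"] by simp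
        then have "1 / real k * \<bar>\<phi> (V k \<omega>) - m\<bar> \<le> 1 / real k * (B + \<bar>m\<bar>)" by (intro mult_left_mono) auto
        then show "\<bar>1 / real k * (\<phi> (V k \<omega>) - m)\<bar> \<le> (B + \<bar>m\<bar>) * (1 / real k)" by (simp add: abs_mult mult.commute)
      qed
      also have "\<dots> = (B + \<bar>m\<bar>) * (harm n' - harm n)"
        unfolding sum_distrib_left[symmetric] split[symmetric] harm_sum ..
      finally show ?thesis .
    qed
    show "0 \<le> B + \<bar>m\<bar>" using order_trans[OF norm_ge_zero B] by simp
    show "(\<lambda>j. harm (sparse_time (Suc j)) / harm (sparse_time j)) \<longlonglongrightarrow> (1::real)" by (rule harm_sparse_ratio)
    have "T (sparse_time j) / harm (sparse_time j) = integral\<^sup>L (?\<mu> j) \<phi> - m" for j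
    proof -
      have h: "harm (sparse_time j) \<noteq> (0::real)" using harm_pos'[OF sparse_ge_1[of j]] by linarith
      have "integral\<^sup>L (?\<mu> j) \<phi> = (\<Sum>k=1..sparse_time j. (1 / (real k * harm (sparse_time j))) *\<^sub>R \<phi> (V k \<omega>))"
        by (rule log_empirical(2)[OF sparse_ge_1]) (rule borel_measurable_continuous_onI[OF cont])
      also have "\<dots> = (\<Sum>k=1..sparse_time j. 1 / real k * \<phi> (V k \<omega>)) / harm (sparse_time j)"
        by (simp add: sum_divide_distrib)
      finally show ?thesis unfolding T using h by (simp add: diff_divide_distrib)
    qed
    then show "(\<lambda>j. T (sparse_time j) / harm (sparse_time j)) \<longlonglongrightarrow> 0" using tendsto_diff[OF conv tendsto_const[of m]] by simp
  qed
  from tendsto_add[OF tendsto_mult[OF this harm_over_ln_tendsto] tendsto_mult[OF tendsto_const[of m] harm_over_ln_tendsto]]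
  have lim: "(\<lambda>n. T n / harm n * (harm n / ln (real n)) + m * (harm n / ln (real n))) \<longlonglongrightarrow> m" by simp
  have "\<forall>\<^sub>F n in sequentially. T n / harm n * (harm n / ln (real n)) + m * (harm n / ln (real n))
      = 1 / ln (real n) * (\<Sum>k=1..n. 1 / real k * \<phi> (V k \<omega>))"
  proof (rule eventually_sequentiallyI[of 1])
    fix n :: nat assume "1 \<le> n"
    then have h: "harm n \<noteq> (0::real)" using harm_pos'[of n] by linarith
    have "T n / harm n * (harm n / ln (real n)) + m * (harm n / ln (real n)) = (T n + m * harm n) / ln (real n)"
      using h by (simp add: add_divide_distrib)
    then show "T n / harm n * (harm n / ln (real n)) + m * (harm n / ln (real n))
      = 1 / ln (real n) * (\<Sum>k=1..n. 1 / real k * \<phi> (V k \<omega>))" unfolding T by simp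
  qed
  from Lim_transform_eventually[OF lim this] show ?thesis unfolding m_def .
qed

theorem asclt: "satisfies_ASCLT M V"
  unfolding satisfies_ASCLT_def
proof (intro allI impI)
  fix \<phi> :: "real \<Rightarrow> real" assume \<phi>: "continuous_on UNIV \<phi> \<and> bounded (range \<phi>)"
  show "AE \<omega> in M. (\<lambda>n. 1 / ln (real n) * (\<Sum>k=1..n. 1 / real k * \<phi> (V k \<omega>))) \<longlonglongrightarrow> integral\<^sup>L std_normal_distribution \<phi>"
    by (rule AE_mp[OF AE_grid_error_tendsto], intro AE_I2 impI, rule log_average_tendsto) (use \<phi> in auto)
qed

end

section \<open>The quadratic variation of the Gaussian process\<close>

lemma sum_increments_eq:
  fixes g :: "nat \<Rightarrow> real"
  shows "(\<Sum>i<n. c i * (g (Suc i) - g i)) = (\<Sum>k\<le>n. ((if 0 < k then c (k - 1) else 0) - (if k < n then c k else 0)) * g k)"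
proof -
  have "(\<Sum>k\<le>n. (if 0 < k then c (k - 1) else 0) * g k) = (\<Sum>i<n. c i * g (Suc i))"
    unfolding lessThan_Suc_atMost[symmetric] sum.lessThan_Suc_shift by simp
  moreover have "(\<Sum>k\<le>n. (if k < n then c k else 0) * g k) = (\<Sum>i<n. c i * g i)"
    unfolding lessThan_Suc_atMost[symmetric] by simp
  ultimately show ?thesis by (simp add: left_diff_distrib right_diff_distrib sum_subtractf)
qed

lemma centered_gaussian_processD:
  assumes "centered_gaussian_process M G" "finite I" "I \<subseteq> {0..}"
  shows "\<exists>m s. s \<ge> 0 \<and> distr M borel (\<lambda>\<omega>. \<Sum>t\<in>I. c t * G t \<omega>) = normal_law m s"
  using assms unfolding centered_gaussian_process_def by blast

lemma
  assumes "prob_space M" and gp: "centered_gaussian_process M G" and t: "t \<ge> 0"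
  shows centered_gaussian_process_measurable: "G t \<in> borel_measurable M"
    and centered_gaussian_process_mean: "integral\<^sup>L M (G t) = 0"
    and centered_gaussian_process_power: "integrable M (\<lambda>\<omega>. G t \<omega> ^ k)"
proof -
  show m: "G t \<in> borel_measurable M" and "integral\<^sup>L M (G t) = 0"
    using gp t unfolding centered_gaussian_process_def by auto
  obtain m s where "s \<ge> 0" "distr M borel (\<lambda>\<omega>. \<Sum>r\<in>{t}. 1 * G r \<omega>) = normal_law m s"
    using centered_gaussian_processD[OF gp, of "{t}" "\<lambda>_. 1"] t by auto
  then show "integrable M (\<lambda>\<omega>. G t \<omega> ^ k)"
    using normal_law_facts(1)[OF assms(1) m, of s m k] by simp
qed

text \<open>
  A linear combination of increments is one of values of the process at integer times (summation by
  parts). The coefficient function \<open>d\<close> is transported to real times by rounding, as the definition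
  of a Gaussian process sums over a set of times.
\<close>
lemma gaussian_seq_increments:
  assumes M: "prob_space M" and gp: "centered_gaussian_process M G"
  shows "gaussian_seq M (\<lambda>i \<omega>. G (real i + 1) \<omega> - G (real i) \<omega>)"
proof -
  interpret prob_space M by fact
  have [measurable]: "G (real i + 1) \<in> borel_measurable M" "G (real i) \<in> borel_measurable M" for i
    using centered_gaussian_process_measurable[OF M gp] by simp_all
  show ?thesis
  proof
    show "(\<lambda>\<omega>. G (real i + 1) \<omega> - G (real i) \<omega>) \<in> borel_measurable M" for i by measurable
    show "expectation (\<lambda>\<omega>. G (real i + 1) \<omega> - G (real i) \<omega>) = 0" for i
      using centered_gaussian_process_mean[OF M gp] centered_gaussian_process_power[OF M gp, where k=1] by simp
    fix n and c :: "nat \<Rightarrow> real"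
    define d where "d k = (if 0 < k then c (k - 1) else 0) - (if k < n then c k else 0)" for k
    have "(\<Sum>i<n. c i * (G (real i + 1) \<omega> - G (real i) \<omega>)) = (\<Sum>t\<in>real ` {..n}. d (nat \<lfloor>t\<rfloor>) * G t \<omega>)" for \<omega>
    proof -
      have "(\<Sum>i<n. c i * (G (real i + 1) \<omega> - G (real i) \<omega>)) = (\<Sum>k\<le>n. d k * G (real k) \<omega>)"
        using sum_increments_eq[of c "\<lambda>k. G (real k) \<omega>" n] by (simp add: d_def add.commute)
      also have "\<dots> = (\<Sum>t\<in>real ` {..n}. d (nat \<lfloor>t\<rfloor>) * G t \<omega>)"
        by (subst sum.reindex) (auto simp: inj_on_def)
      finally show ?thesis .
    qed
    moreover have "\<exists>m s. s \<ge> 0 \<and> distr M borel (\<lambda>\<omega>. \<Sum>t\<in>real ` {..n}. d (nat \<lfloor>t\<rfloor>) * G t \<omega>) = normal_law m s"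
      by (rule centered_gaussian_processD[OF gp]) auto
    ultimately show "\<exists>m s. s \<ge> 0 \<and> distr M borel (\<lambda>\<omega>. \<Sum>i<n. c i * (G (real i + 1) \<omega> - G (real i) \<omega>)) = normal_law m s"
      by simp
  qed
qed

context gaussian_seq
begin

text \<open>
  The weights of the quadratic form \<open>V\<^sub>n\<close>. They extend by zero beyond \<open>n\<close>, so that \<open>V\<^sub>k\<close> and \<open>V\<^sub>l\<close> can be
  treated as forms in the same number of variables.
\<close>
definition cutoff :: "nat \<Rightarrow> real \<Rightarrow> nat \<Rightarrow> real" where
  "cutoff n \<sigma> i = (if i < n then 1 / \<sigma> else 0)"

lemma sum_cutoff: "n \<le> N \<Longrightarrow> (\<Sum>i<N. cutoff n \<sigma> i * f i) = (\<Sum>i<n. f i) / \<sigma>"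
proof -
  assume "n \<le> N"
  then have "(\<Sum>i<N. cutoff n \<sigma> i * f i) = (\<Sum>i<n. f i / \<sigma>)"
    by (intro sum.mono_neutral_cong_right) (auto simp: cutoff_def)
  then show ?thesis by (simp add: sum_divide_distrib)
qed

lemma qf_cutoff: "n \<le> N \<Longrightarrow> qf N (cutoff n \<sigma>) \<omega> = (\<Sum>i<n. (X i \<omega>)\<^sup>2 - cv i i) / \<sigma>"
  unfolding qf_def by (rule sum_cutoff)

lemma qcov_cutoff:
  assumes "k \<le> N" "l \<le> N"
  shows "qcov N (cutoff k \<sigma>) (cutoff l \<tau>) = 2 * (\<Sum>i<k. \<Sum>j<l. (cv i j)\<^sup>2) / (\<sigma> * \<tau>)"
proof -
  have "(\<Sum>i<N. \<Sum>j<N. cutoff k \<sigma> i * cutoff l \<tau> j * (cv i j)\<^sup>2) = (\<Sum>i<N. cutoff k \<sigma> i * (\<Sum>j<N. cutoff l \<tau> j * (cv i j)\<^sup>2))"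
    by (simp add: sum_distrib_left mult.assoc)
  also have "\<dots> = (\<Sum>i<k. (\<Sum>j<l. (cv i j)\<^sup>2) / \<tau>) / \<sigma>" unfolding sum_cutoff[OF assms(1)] sum_cutoff[OF assms(2)] ..
  finally show ?thesis unfolding qcov_def by (simp add: sum_divide_distrib[symmetric] mult.commute)
qed

lemma opbound_cutoff:
  assumes n: "n \<le> N" and \<sigma>: "\<sigma> > 0" and b: "b \<ge> 0"
    and le: "\<And>y. (\<Sum>i<n. \<Sum>k<n. cv i k * y i * y k) \<le> b * \<sigma> * (\<Sum>i<n. (y i)\<^sup>2)"
  shows "opbound N (cutoff n \<sigma>) b"
  unfolding opbound_def
proof (intro conjI allI impI b)
  show "0 \<le> cutoff n \<sigma> i" for i using \<sigma> by (simp add: cutoff_def)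
  fix y :: "nat \<Rightarrow> real"
  have "(\<Sum>i<N. \<Sum>k<N. cv i k * (cutoff n \<sigma> i * y i) * (cutoff n \<sigma> k * y k))
     = (\<Sum>i<N. cutoff n \<sigma> i * (\<Sum>k<N. cutoff n \<sigma> k * (cv i k * y i * y k)))"
    by (simp add: sum_distrib_left mult_ac)
  also have "\<dots> = (\<Sum>i<n. \<Sum>k<n. cv i k * y i * y k) / \<sigma> / \<sigma>"
    unfolding sum_cutoff[OF n] by (simp add: sum_divide_distrib)
  also have "\<dots> \<le> (b * \<sigma> * (\<Sum>i<n. (y i)\<^sup>2)) / \<sigma> / \<sigma>"
    using le[of y] \<sigma> by (intro divide_right_mono) auto
  also have "\<dots> = b * ((\<Sum>i<n. (y i)\<^sup>2) / \<sigma>)" using \<sigma> by simp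
  finally show "(\<Sum>i<N. \<Sum>k<N. cv i k * (cutoff n \<sigma> i * y i) * (cutoff n \<sigma> k * y k)) \<le> b * (\<Sum>i<N. cutoff n \<sigma> i * (y i)\<^sup>2)"
    unfolding sum_cutoff[OF n] .
qed

text \<open>
  The almost sure central limit theorem for any Gaussian sequence whose covariance is close to that
  of fractional Gaussian noise. The constant 13 is \<open>6 + 6 + 1\<close>: two operator bounds and one covariance
  in \<open>qf_diff_char_normal\<close>.
\<close>
theorem asclt_of_fgn_perturbation:
  fixes V :: "nat \<Rightarrow> 'a \<Rightarrow> real" and \<sigma> :: "nat \<Rightarrow> real"
  assumes H: "0 < H" "H \<le> 3/4" and C: "C \<ge> 0"
    and dev: "\<And>i j. \<bar>cv i j - fgn H (index_dist i j)\<bar> \<le> C * ((real i + 1) powr (H - 1) * (real j + 1) powr (H - 1))"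
    and \<sigma>: "\<And>n. \<sigma> n = sqrt (2 * (\<Sum>i<n. \<Sum>j<n. (cv i j)\<^sup>2))"
    and pos: "\<And>n. n \<ge> 1 \<Longrightarrow> \<sigma> n > 0"
    and V: "\<And>n \<omega>. V n \<omega> = (\<Sum>i<n. (X i \<omega>)\<^sup>2 - cv i i) / \<sigma> n"
  shows "satisfies_ASCLT M V"
proof -
  define S where "S n = 2 * (\<Sum>i<n. \<Sum>j<n. (cv i j)\<^sup>2)" for n
  have \<sigma>S: "\<sigma> n = sqrt (S n)" for n by (simp add: \<sigma> S_def)
  have Sp: "S n > 0" if "n \<ge> 1" for n using pos[OF that] unfolding \<sigma>S by simp
  obtain K where K: "K > 0"
    "\<And>n y. n \<ge> 1 \<Longrightarrow> (\<Sum>i<n. \<Sum>k<n. cv i k * y i * y k) \<le> K * sqrt (S n) / sqrt (ln (real n + 1)) * (\<Sum>i<n. (y i)\<^sup>2)"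
    "\<And>k l. 1 \<le> k \<Longrightarrow> k \<le> l \<Longrightarrow> 2 * (\<Sum>i<k. \<Sum>j<l. (cv i j)\<^sup>2)
        \<le> K * pair_rate k l * (sqrt (S k) * sqrt (S l))"
    by (rule quad_var_scale[OF H C dev S_def Sp], assumption, rule that, assumption+)
  define u where "u n = cutoff n (\<sigma> n)" for n
  define b where "b n = K / sqrt (ln (real n + 1))" for n :: nat
  have Vq: "V n \<omega> = qf N (u n) \<omega>" if "n \<le> N" for n N \<omega>
    unfolding V u_def using qf_cutoff[OF that] by simp
  have b0: "b n \<ge> 0" for n unfolding b_def using K(1) by simp
  have ob: "opbound N (u n) (b n)" if "1 \<le> n" "n \<le> N" for n N
    unfolding u_def
  proof (rule opbound_cutoff[OF that(2) pos[OF that(1)] b0])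
    show "(\<Sum>i<n. \<Sum>k<n. cv i k * y i * y k) \<le> b n * \<sigma> n * (\<Sum>i<n. (y i)\<^sup>2)" for y
      using K(2)[OF that(1), of y] by (simp add: b_def \<sigma>S)
  qed
  have q1: "qcov N (u n) (u n) = 1" if "1 \<le> n" "n \<le> N" for n N
    unfolding u_def qcov_cutoff[OF that(2) that(2)] S_def[symmetric] \<sigma>S using Sp[OF that(1)] by simp
  interpret asclt_bounds M V "13 * K"
  proof
    show "V k \<in> borel_measurable M" for k
    proof -
      have "V k = qf k (u k)" using Vq[OF order_refl] by auto
      then show ?thesis by simp
    qed
    have V2: "(\<lambda>\<omega>. (V k \<omega>)\<^sup>2) = (\<lambda>\<omega>. (qf k (u k) \<omega>)\<^sup>2)" for k using Vq[OF order_refl] by simp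
    show "integrable M (\<lambda>\<omega>. (V k \<omega>)\<^sup>2)" for k unfolding V2 by (rule qf_square)
    show "expectation (\<lambda>\<omega>. (V k \<omega>)\<^sup>2) = 1" if "k \<ge> 1" for k unfolding V2 qf_square by (rule q1[OF that order_refl])
    show "0 \<le> 13 * K" using K(1) by simp
    show "norm (expectation (\<lambda>\<omega>. iexp (t * V k \<omega>)) - of_real (exp (- (t\<^sup>2 / 2)))) \<le> t\<^sup>2 * (13 * K / sqrt (ln (real k + 1)))"
      if "k \<ge> 1" for k t
    proof -
      have "norm (expectation (\<lambda>\<omega>. iexp (t * V k \<omega>)) - of_real (exp (- (t\<^sup>2 / 2)))) \<le> 2 * t\<^sup>2 * b k"
        unfolding Vq[OF order_refl] by (rule qf_char_normal[OF ob[OF that order_refl] q1[OF that order_refl]])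
      also have "\<dots> \<le> 13 * t\<^sup>2 * b k" using b0 by (intro mult_right_mono) auto
      also have "\<dots> = t\<^sup>2 * (13 * K / sqrt (ln (real k + 1)))" by (simp add: b_def)
      finally show ?thesis .
    qed
    fix k l :: nat and t assume k: "1 \<le> k" and kl: "k \<le> l"
    then have l: "1 \<le> l" by simp
    have Lk: "ln (real k + 1) > 0" "ln (real l + 1) \<ge> ln (real k + 1)" using k kl by auto
    have bk: "b k \<le> K * pair_rate k l" unfolding b_def pair_rate_def using K(1) Lk by (simp add: distrib_left)
    have "b l \<le> b k" unfolding b_def using K(1) Lk by (intro divide_left_mono) auto
    with bk have bl: "b l \<le> K * pair_rate k l" by simp
    have "qcov l (u k) (u l) = 2 * (\<Sum>i<k. \<Sum>j<l. (cv i j)\<^sup>2) / (sqrt (S k) * sqrt (S l))"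
      unfolding u_def qcov_cutoff[OF kl order_refl] \<sigma>S ..
    moreover have "\<dots> \<le> K * pair_rate k l"
      using K(3)[OF k kl] Sp[OF k] Sp[OF l] by (simp add: pos_divide_le_eq)
    moreover have "0 \<le> 2 * (\<Sum>i<k. \<Sum>j<l. (cv i j)\<^sup>2) / (sqrt (S k) * sqrt (S l))"
      using Sp[OF k] Sp[OF l] by (intro divide_nonneg_nonneg mult_nonneg_nonneg sum_nonneg) auto
    ultimately have c: "\<bar>qcov l (u k) (u l)\<bar> \<le> K * pair_rate k l" by simp
    have "norm (expectation (\<lambda>\<omega>. iexp (t * (V k \<omega> - V l \<omega>))) - of_real (exp (- t\<^sup>2))) \<le> t\<^sup>2 * (6 * (b k + b l) + \<bar>qcov l (u k) (u l)\<bar>)"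
      unfolding Vq[OF kl] Vq[OF order_refl, of l]
      by (rule qf_diff_char_normal[OF ob[OF k kl] q1[OF k kl] ob[OF l order_refl] q1[OF l order_refl]])
    also have "\<dots> \<le> t\<^sup>2 * (13 * K * pair_rate k l)" using bk bl c by (intro mult_left_mono) auto
    finally show "norm (expectation (\<lambda>\<omega>. iexp (t * (V k \<omega> - V l \<omega>))) - of_real (exp (- t\<^sup>2)))
        \<le> t\<^sup>2 * (13 * K * pair_rate k l)" .
  qed
  show ?thesis by (rule asclt)
qed

end

theorem theorem1p7:
  fixes M :: "'a measure" and G :: "real \<Rightarrow> 'a \<Rightarrow> real" and H :: real
  assumes "prob_space M"
    and "centered_gaussian_process M G"
    and "AE \<omega> in M. continuous_on {0..} (\<lambda>t. G t \<omega>)"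
    and "AE \<omega> in M. G 0 \<omega> = 0"
    and "continuous_on ({0..} \<times> {0..}) (\<lambda>(t, s). covariance_fun M G t s)"
    and "H \<in> {0<..<1}"
    and "hypothesis_A H (covariance_fun M G)"
    and "\<And>n. n \<ge> 1 \<Longrightarrow> quad_var_sd M G n > 0"
    and "H \<in> {0<..3/4}"
  shows "satisfies_ASCLT M (renorm_quad_var M G)"
proof -
  define X where "X i \<omega> = G (real i + 1) \<omega> - G (real i) \<omega>" for i \<omega>
  let ?R = "covariance_fun M G"
  interpret gaussian_seq M X
    unfolding X_def[abs_def] by (rule gaussian_seq_increments[OF assms(1,2)])
  have GG: "integrable M (\<lambda>\<omega>. G t \<omega> * G s \<omega>)" if "t \<ge> 0" "s \<ge> 0" for t s
  proof (rule Bochner_Integration.integrable_bound)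
    show "integrable M (\<lambda>\<omega>. G t \<omega> ^ 2 + G s \<omega> ^ 2)"
      by (intro Bochner_Integration.integrable_add centered_gaussian_process_power[OF assms(1,2)] that)
    show "(\<lambda>\<omega>. G t \<omega> * G s \<omega>) \<in> borel_measurable M"
      by (intro borel_measurable_times centered_gaussian_process_measurable[OF assms(1,2)] that)
    show "AE \<omega> in M. norm (G t \<omega> * G s \<omega>) \<le> norm (G t \<omega> ^ 2 + G s \<omega> ^ 2)"
    proof (rule AE_I2)
      fix \<omega> show "norm (G t \<omega> * G s \<omega>) \<le> norm (G t \<omega> ^ 2 + G s \<omega> ^ 2)"
        using sum_squares_bound[of "\<bar>G t \<omega>\<bar>" "\<bar>G s \<omega>\<bar>"]
          mult_nonneg_nonneg[OF abs_ge_zero[of "G t \<omega>"] abs_ge_zero[of "G s \<omega>"]]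
        unfolding real_norm_def abs_mult power2_abs by linarith
    qed
  qed
  have cvR: "cv i j = ?R (real i + 1) (real j + 1) - ?R (real i + 1) (real j) - (?R (real i) (real j + 1) - ?R (real i) (real j))" for i j
    unfolding cv_def X_def covariance_fun_def left_diff_distrib right_diff_distrib
    using GG by (simp add: Bochner_Integration.integral_diff)
  have H: "0 < H" "H < 1" "H \<le> 3/4" using assms(6,9) by auto
  have sym: "?R t s = ?R s t" for t s unfolding covariance_fun_def by (simp add: mult.commute)
  obtain C where C: "C \<ge> 0"
    "\<And>i j. \<bar>cv i j - fgn H (index_dist i j)\<bar> \<le> C * ((real i + 1) powr (H - 1) * (real j + 1) powr (H - 1))"
    by (rule increment_covariance_bound[OF assms(7) H(1,2) sym], rule that, assumption, simp only: cvR)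
  have qv: "quad_var M G n \<omega> = (\<Sum>i<n. (X i \<omega>)\<^sup>2 - cv i i)" for n \<omega>
    unfolding quad_var_def cv_def X_def by (simp add: power2_eq_square add.commute)
  have sd: "quad_var_sd M G n = sqrt (2 * (\<Sum>i<n. \<Sum>j<n. (cv i j)\<^sup>2))" for n
    using qf_square(1)[of n "\<lambda>_. 1"] unfolding quad_var_sd_def qv qf_def qcov_def by simp
  show ?thesis
    by (rule asclt_of_fgn_perturbation[OF H(1,3) C sd assms(8)])
       (simp_all add: renorm_quad_var_def qv)
qed

end
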